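(* Let $A\subseteq B\subseteq\{0,1\}$. A map $X\to Y$ in $\mathsf{cSet}_A^+$ is a fibration between comical sets if and only if it is isomorphic to the image under $i^*:\mathsf{cSet}_B^+\to\mathsf{cSet}_A^+$ of a fibration between comical sets in $\mathsf{cSet}_B^+$. In particular, an object $X\in\mathsf{cSet}_A^+$ is a comical set if and only if it is the image under $i^*$ of a comical set in $\mathsf{cSet}_B^+$. (Fibrations are those of the comical model structures.)
   Context: **Cubical sets.** For $A\subseteq\{0,1\}$, $\Box_A$ is the subcategory of the category of posets with objects $[1]^n$ ($n\ge 0$, $[1]=\{0<1\}$) and morphisms generated under composition by: faces $\partial_{i,\varepsilon}:[1]^{n-1}\to[1]^n$ ($1\le i\le n$, $\varepsilon\in\{0,1\}$; insert $\varepsilon$ as $i$-th coordinate); degeneracies $\sigma_i:[1]^n\to[1]^{n-1}$ ($1\le i\le n$; delete the $i$-th coordinate); and, for each $\varepsilon\in A$, connections $\gamma_{i,\varepsilon}:[1]^n\to[1]^{n-1}$ ($1\le i\le n-1$; replace $x_i,x_{i+1}$ by $\max\{x_i,x_{i+1}\}$ if $\varepsilon=0$, by $\min\{x_i,x_{i+1}\}$ if $\varepsilon=1$). $\mathsf{cSet}_A$ is the category of presheaves of sets on $\Box_A$, $\Box^n_A$ the representable at $[1]^n$; elements of $X_n=X([1]^n)$ are $n$-cubes. A cube is degenerate if it is in the image of a degeneracy or a connection of $\Box_A$. **Marked cubical sets.** An object of $\mathsf{cSet}_A^+$ is a pair $(X,eX)$ with $X\in\mathsf{cSet}_A$ and $eX\subseteq\bigcup_{n\ge1}X_n$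 a set of "marked" cubes containing all degenerate cubes; morphisms are cubical maps preserving marked cubes. $\Box^n_A$ also denotes the marked cubical set with only degenerate cubes marked. A map is regular if a cube is marked iff its image is marked, and entire if its underlying cubical map is an isomorphism; a regular subcomplex inclusion is a regular monomorphism. $\tau_nX$ is obtained from $X$ by marking all cubes of dimension $>n$. **Comical sets.** Every monomorphism $\delta:[1]^m\to[1]^n$ of $\Box_A$ is uniquely a composite $\partial_{c_1,\varepsilon_1}\cdots\partial_{c_r,\varepsilon_r}$ with $c_1>\dots>c_r$. It is a critical face with respect to $\partial_{i,\varepsilon}$ if this composite contains none of: (1) $\partial_{i,\varepsilon}$ or $\partial_{i,1-\varepsilon}$; (2) for some $j>i$, $\partial_{j,\varepsilon}$ together with $\partial_{k,1-\varepsilon}$ for all $i<k<j$; (3) for some $j<i$, $\partial_{j,\varepsilon}$ together with $\partial_{k,1-\varepsilon}$ for all $j<k<i$. The comical cube $\Box^n_{A,i,\varepsilon}$ ($n\ge1$) is $\Box^n_A$ with all critical faces with respect to $\partial_{i,\varepsilon}$ marked; the comical open box $\sqcap^n_{A,i,\varepsilon}$ is its regular subcomplex whose non-degenerate cubes are all faces except $\mathrm{id}_{[1]^n}$ and $\partial_{i,\varepsilon}$; the inclusion is a comical open box inclusion. For $n\ge2$, $(\Box^n_{A,i,\varepsilon})'$ is obtained from $\Box^n_{A,i,\varepsilon}$ by marking all $(n-1)$-dimensional faces except $\partial_{i,\varepsilon}$; the entire map $(\Box^n_{A,i,\varepsilon})'\to\tau_{n-2}\Box^n_{A,i,\varepsilon}$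 is a comical marking extension. A comical set is a marked cubical set with the right lifting property against all comical open box inclusions and comical marking extensions. **Comical model structure** (known to exist on each $\mathsf{cSet}_A^+$). Cofibrations are the monomorphisms, fibrant objects are the comical sets, and a map with fibrant codomain is a fibration iff it has the right lifting property against comical open box inclusions and comical marking extensions. **The functor $i^*$.** For $A\subseteq B$, the inclusion $i:\Box_A\hookrightarrow\Box_B$ induces $i^*:\mathsf{cSet}_B^+\to\mathsf{cSet}_A^+$, which restricts structure maps, keeping the same cubes and the same marked cubes. *)

theory Defs
  imports Main "HOL-Library.FuncSet"
begin

section \<open>The box categories\<close>

text \<open>
  The poset \<open>[1] = {0 < 1}\<close> is \<^typ>\<open>bool\<close> with \<open>0 = False\<close> and \<open>1 = True\<close>, so that a subset
  \<open>A\<close> of \<open>{0,1}\<close> is an arbitrary \<^typ>\<open>bool set\<close>.  The elements of \<open>[1]^n\<close> are the lists of length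
  \<open>n\<close>.  A map out of \<open>[1]^m\<close> is a function that is extensional on \<open>vertices m\<close>, so equality of
  morphisms is equality in HOL.  Coordinates are numbered from 1.
\<close>

type_synonym cubemap = "bool list \<Rightarrow> bool list"

definition vertices :: "nat \<Rightarrow> bool list set" where
  "vertices n = {xs. length xs = n}"

definition idbox :: "nat \<Rightarrow> cubemap" where
  "idbox n = (\<lambda>xs\<in>vertices n. xs)"

text \<open>\<open>face n i e : [1]^(n-1) \<rightarrow> [1]^n\<close> for \<open>1 \<le> i \<le> n\<close>.\<close>
definition face :: "nat \<Rightarrow> nat \<Rightarrow> bool \<Rightarrow> cubemap" where
  "face n i e = (\<lambda>xs\<in>vertices (n - 1). take (i - 1) xs @ e # drop (i - 1) xs)"

text \<open>\<open>degen n i : [1]^n \<rightarrow> [1]^(n-1)\<close> for \<open>1 \<le> i \<le> n\<close>.\<close>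
definition degen :: "nat \<Rightarrow> nat \<Rightarrow> cubemap" where
  "degen n i = (\<lambda>xs\<in>vertices n. take (i - 1) xs @ drop i xs)"

text \<open>\<open>conn n i e : [1]^n \<rightarrow> [1]^(n-1)\<close> for \<open>1 \<le> i \<le> n - 1\<close>; maximum for \<open>e = 0\<close>, minimum for \<open>e = 1\<close>.\<close>
definition conn :: "nat \<Rightarrow> nat \<Rightarrow> bool \<Rightarrow> cubemap" where
  "conn n i e = (\<lambda>xs\<in>vertices n. take (i - 1) xs @
     (if e then min (xs ! (i - 1)) (xs ! i) else max (xs ! (i - 1)) (xs ! i)) # drop (i + 1) xs)"

text \<open>\<open>boxmor A m n f\<close>: \<open>f : [1]^m \<rightarrow> [1]^n\<close> is a morphism of the box category of \<open>A\<close>.\<close>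
inductive boxmor :: "bool set \<Rightarrow> nat \<Rightarrow> nat \<Rightarrow> cubemap \<Rightarrow> bool" for A where
  boxmor_id: "boxmor A n n (idbox n)"
| boxmor_face: "1 \<le> i \<Longrightarrow> i \<le> n \<Longrightarrow> boxmor A (n - 1) n (face n i e)"
| boxmor_degen: "1 \<le> i \<Longrightarrow> i \<le> n \<Longrightarrow> boxmor A n (n - 1) (degen n i)"
| boxmor_conn: "e \<in> A \<Longrightarrow> 1 \<le> i \<Longrightarrow> i \<le> n - 1 \<Longrightarrow> boxmor A n (n - 1) (conn n i e)"
| boxmor_comp: "boxmor A k m f \<Longrightarrow> boxmor A m n g \<Longrightarrow> boxmor A k n (compose (vertices k) g f)"


section \<open>Marked cubical sets\<close>

text \<open>
  \<open>act X m n f : X_n \<rightarrow> X_m\<close> is the structure map of \<open>f : [1]^m \<rightarrow> [1]^n\<close>, and \<open>marked X n\<close> the set of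
  marked \<open>n\<close>-cubes.  Structure maps are extensional, and trivial when \<open>f\<close> is not a morphism, so that
  equality of records is equality of marked cubical sets.
\<close>

record 'a mcset =
  cubes :: "nat \<Rightarrow> 'a set"
  act :: "nat \<Rightarrow> nat \<Rightarrow> cubemap \<Rightarrow> 'a \<Rightarrow> 'a"
  marked :: "nat \<Rightarrow> 'a set"

definition cset :: "bool set \<Rightarrow> 'a mcset \<Rightarrow> bool" where
  "cset A X \<longleftrightarrow>
     (\<forall>m n f. boxmor A m n f \<longrightarrow> act X m n f \<in> cubes X n \<rightarrow>\<^sub>E cubes X m) \<and>
     (\<forall>m n f. \<not> boxmor A m n f \<longrightarrow> act X m n f = (\<lambda>_. undefined)) \<and>
     (\<forall>n. act X n n (idbox n) = (\<lambda>x\<in>cubes X n. x)) \<and>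
     (\<forall>k m n f g. boxmor A k m f \<longrightarrow> boxmor A m n g \<longrightarrow>
        act X k n (compose (vertices k) g f) = compose (cubes X n) (act X k m f) (act X m n g))"

definition degenerate :: "bool set \<Rightarrow> 'a mcset \<Rightarrow> nat \<Rightarrow> 'a \<Rightarrow> bool" where
  "degenerate A X n x \<longleftrightarrow>
     (\<exists>i y. 1 \<le> i \<and> i \<le> n \<and> y \<in> cubes X (n - 1) \<and> x = act X n (n - 1) (degen n i) y) \<or>
     (\<exists>i e y. e \<in> A \<and> 1 \<le> i \<and> i \<le> n - 1 \<and> y \<in> cubes X (n - 1) \<and>
        x = act X n (n - 1) (conn n i e) y)"

definition mcset :: "bool set \<Rightarrow> 'a mcset \<Rightarrow> bool" where
  "mcset A X \<longleftrightarrow> cset A X \<and> (\<forall>n. marked X n \<subseteq> cubes X n) \<and> marked X 0 = {} \<and>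
     (\<forall>n x. degenerate A X n x \<longrightarrow> x \<in> marked X n)"

type_synonym ('a, 'b) mcfun = "nat \<Rightarrow> 'a \<Rightarrow> 'b"

definition mcmap :: "bool set \<Rightarrow> 'a mcset \<Rightarrow> 'b mcset \<Rightarrow> ('a, 'b) mcfun \<Rightarrow> bool" where
  "mcmap A X Y f \<longleftrightarrow> mcset A X \<and> mcset A Y \<and>
     (\<forall>n. f n \<in> cubes X n \<rightarrow>\<^sub>E cubes Y n) \<and>
     (\<forall>m n g. boxmor A m n g \<longrightarrow> (\<forall>x\<in>cubes X n. f m (act X m n g x) = act Y m n g (f n x))) \<and>
     (\<forall>n. \<forall>x\<in>marked X n. f n x \<in> marked Y n)"

definition mcid :: "'a mcset \<Rightarrow> ('a, 'a) mcfun" where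
  "mcid X n = (\<lambda>x\<in>cubes X n. x)"

definition mccomp :: "'a mcset \<Rightarrow> ('b, 'c) mcfun \<Rightarrow> ('a, 'b) mcfun \<Rightarrow> ('a, 'c) mcfun" where
  "mccomp X g f n = compose (cubes X n) (g n) (f n)"

definition mciso :: "bool set \<Rightarrow> 'a mcset \<Rightarrow> 'b mcset \<Rightarrow> ('a, 'b) mcfun \<Rightarrow> bool" where
  "mciso A X Y f \<longleftrightarrow> mcmap A X Y f \<and>
     (\<exists>g. mcmap A Y X g \<and> mccomp X g f = mcid X \<and> mccomp Y f g = mcid Y)"

definition arrow_iso ::
  "bool set \<Rightarrow> 'a mcset \<Rightarrow> 'a mcset \<Rightarrow> ('a, 'a) mcfun \<Rightarrow>
   'b mcset \<Rightarrow> 'b mcset \<Rightarrow> ('b, 'b) mcfun \<Rightarrow> bool" where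
  "arrow_iso A X Y f X' Y' f' \<longleftrightarrow> mcmap A X Y f \<and> mcmap A X' Y' f' \<and>
     (\<exists>u v. mciso A X X' u \<and> mciso A Y Y' v \<and> mccomp X v f = mccomp X f' u)"

definition tau :: "nat \<Rightarrow> 'a mcset \<Rightarrow> 'a mcset" where
  "tau n X = X\<lparr>marked := (\<lambda>m. if m > n then cubes X m else marked X m)\<rparr>"

text \<open>The regular subcomplex of \<open>X\<close> on a family \<open>S\<close> of cubes closed under the structure maps.\<close>
definition regular_sub :: "'a mcset \<Rightarrow> (nat \<Rightarrow> 'a set) \<Rightarrow> 'a mcset" where
  "regular_sub X S = \<lparr>cubes = S, act = (\<lambda>m n f. restrict (act X m n f) (S n)),
     marked = (\<lambda>n. marked X n \<inter> S n)\<rparr>"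


section \<open>Comical sets\<close>

definition standard_cube :: "bool set \<Rightarrow> nat \<Rightarrow> cubemap mcset" where
  "standard_cube A n =
     (let X = \<lparr>cubes = (\<lambda>m. {f. boxmor A m n f}),
               act = (\<lambda>k m g. if boxmor A k m g
                  then (\<lambda>f\<in>{f. boxmor A m n f}. compose (vertices k) f g) else (\<lambda>_. undefined)),
               marked = (\<lambda>_. {})\<rparr>
      in X\<lparr>marked := (\<lambda>m. {f. degenerate A X m f})\<rparr>)"

text \<open>
  A face of \<open>[1]^n\<close> is given by its normal form: the list of the \<open>(c_k, e_k)\<close>, outermost factor first
  and with the \<open>c_k\<close> decreasing.  The empty list gives the identity.
\<close>
definition face_word :: "nat \<Rightarrow> (nat \<times> bool) list \<Rightarrow> bool" where
  "face_word n cs \<longleftrightarrow> sorted_wrt (>) (map fst cs) \<and> (\<forall>c\<in>fst ` set cs. 1 \<le> c \<and> c \<le> n)"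

fun face_composite :: "nat \<Rightarrow> (nat \<times> bool) list \<Rightarrow> cubemap" where
  "face_composite n [] = idbox n"
| "face_composite n ((c, e) # cs) =
     compose (vertices (n - length ((c, e) # cs))) (face n c e) (face_composite (n - 1) cs)"

definition critical_face :: "nat \<Rightarrow> nat \<Rightarrow> bool \<Rightarrow> nat \<Rightarrow> cubemap \<Rightarrow> bool" where
  "critical_face n i e m d \<longleftrightarrow>
     (\<exists>cs. face_word n cs \<and> m + length cs = n \<and> d = face_composite n cs \<and>
        \<not> ((i, e) \<in> set cs \<or> (i, \<not> e) \<in> set cs) \<and>
        \<not> (\<exists>j>i. (j, e) \<in> set cs \<and> (\<forall>k. i < k \<and> k < j \<longrightarrow> (k, \<not> e) \<in> set cs)) \<and>
        \<not> (\<exists>j<i. (j, e) \<in> set cs \<and> (\<forall>k. j < k \<and> k < i \<longrightarrow> (k, \<not> e) \<in> set cs)))"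

definition comical_cube :: "bool set \<Rightarrow> nat \<Rightarrow> nat \<Rightarrow> bool \<Rightarrow> cubemap mcset" where
  "comical_cube A n i e = (standard_cube A n)
     \<lparr>marked := (\<lambda>m. marked (standard_cube A n) m \<union> {d. critical_face n i e m d})\<rparr>"

text \<open>
  The subcomplex whose non-degenerate cubes are all faces other than the identity and \<open>face n i e\<close>
  consists of all cubes that factor through one of these faces.
\<close>
definition open_box :: "bool set \<Rightarrow> nat \<Rightarrow> nat \<Rightarrow> bool \<Rightarrow> cubemap mcset" where
  "open_box A n i e = regular_sub (comical_cube A n i e)
     (\<lambda>m. {compose (vertices m) (face_composite n cs) g | cs g.
        face_word n cs \<and> cs \<noteq> [] \<and> cs \<noteq> [(i, e)] \<and> boxmor A m (n - length cs) g})"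

definition comical_cube' :: "bool set \<Rightarrow> nat \<Rightarrow> nat \<Rightarrow> bool \<Rightarrow> cubemap mcset" where
  "comical_cube' A n i e = (comical_cube A n i e)
     \<lparr>marked := (\<lambda>m. marked (comical_cube A n i e) m \<union>
        {face n j e' | j e'. m = n - 1 \<and> 1 \<le> j \<and> j \<le> n \<and> (j, e') \<noteq> (i, e)})\<rparr>"

text \<open>The comical open box inclusions and the comical marking extensions.\<close>
inductive comical_anodyne_generator ::
  "bool set \<Rightarrow> cubemap mcset \<Rightarrow> cubemap mcset \<Rightarrow> (cubemap, cubemap) mcfun \<Rightarrow> bool" for A where
  open_box_inclusion: "1 \<le> n \<Longrightarrow> 1 \<le> i \<Longrightarrow> i \<le> n \<Longrightarrow>
     comical_anodyne_generator A (open_box A n i e) (comical_cube A n i e) (mcid (open_box A n i e))"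
| marking_extension: "2 \<le> n \<Longrightarrow> 1 \<le> i \<Longrightarrow> i \<le> n \<Longrightarrow>
     comical_anodyne_generator A (comical_cube' A n i e) (tau (n - 2) (comical_cube A n i e))
       (mcid (comical_cube' A n i e))"

text \<open>Every square from \<open>j : U \<rightarrow> V\<close> to \<open>p : X \<rightarrow> Y\<close> has a diagonal filler.\<close>
definition lifts ::
  "bool set \<Rightarrow> 'b mcset \<Rightarrow> 'b mcset \<Rightarrow> ('b, 'b) mcfun \<Rightarrow>
   'a mcset \<Rightarrow> 'a mcset \<Rightarrow> ('a, 'a) mcfun \<Rightarrow> bool" where
  "lifts A U V j X Y p \<longleftrightarrow>
     (\<forall>u v. mcmap A U X u \<and> mcmap A V Y v \<and> mccomp U p u = mccomp U v j \<longrightarrow>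
        (\<exists>h. mcmap A V X h \<and> mccomp U h j = u \<and> mccomp V p h = v))"

definition comical_rlp :: "bool set \<Rightarrow> 'a mcset \<Rightarrow> 'a mcset \<Rightarrow> ('a, 'a) mcfun \<Rightarrow> bool" where
  "comical_rlp A X Y p \<longleftrightarrow> (\<forall>U V j. comical_anodyne_generator A U V j \<longrightarrow> lifts A U V j X Y p)"

text \<open>The lifting property of an object, that is, of its map to the terminal object.\<close>
definition comical :: "bool set \<Rightarrow> 'a mcset \<Rightarrow> bool" where
  "comical A X \<longleftrightarrow> mcset A X \<and>
     (\<forall>U V j. comical_anodyne_generator A U V j \<longrightarrow>
        (\<forall>u. mcmap A U X u \<longrightarrow> (\<exists>h. mcmap A V X h \<and> mccomp U h j = u)))"


section \<open>The comical model structure\<close>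

text \<open>
  A class of maps is a predicate on triples of source, target and map.  The universe of sets is that
  of the subsets of the type \<open>'a\<close>: the category in question is that of the marked cubical sets whose
  cubes lie in \<open>'a\<close>.
\<close>

type_synonym 'a mcclass = "'a mcset \<Rightarrow> 'a mcset \<Rightarrow> ('a, 'a) mcfun \<Rightarrow> bool"

definition monomorphism :: "bool set \<Rightarrow> 'a mcclass" where
  "monomorphism A X Y f \<longleftrightarrow> mcmap A X Y f \<and>
     (\<forall>(Z :: 'a mcset) g h. mcmap A Z X g \<and> mcmap A Z X h \<and> mccomp Z f g = mccomp Z f h \<longrightarrow> g = h)"

definition retract_closed :: "bool set \<Rightarrow> 'a mcclass \<Rightarrow> bool" where
  "retract_closed A K \<longleftrightarrow>
     (\<forall>X Y f X' Y' f' s r s' r'. K X' Y' f' \<and> mcmap A X Y f \<and>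
        mcmap A X X' s \<and> mcmap A X' X r \<and> mcmap A Y Y' s' \<and> mcmap A Y' Y r' \<and>
        mccomp X r s = mcid X \<and> mccomp Y r' s' = mcid Y \<and>
        mccomp X f' s = mccomp X s' f \<and> mccomp X' f r = mccomp X' r' f' \<longrightarrow> K X Y f)"

definition two_of_three :: "bool set \<Rightarrow> 'a mcclass \<Rightarrow> bool" where
  "two_of_three A W \<longleftrightarrow>
     (\<forall>X Y Z f g. mcmap A X Y f \<and> mcmap A Y Z g \<longrightarrow>
        (W X Y f \<and> W Y Z g \<longrightarrow> W X Z (mccomp X g f)) \<and>
        (W X Y f \<and> W X Z (mccomp X g f) \<longrightarrow> W Y Z g) \<and>
        (W Y Z g \<and> W X Z (mccomp X g f) \<longrightarrow> W X Y f))"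

text \<open>\<open>W\<close>, \<open>C\<close> and \<open>F\<close> are the weak equivalences, cofibrations and fibrations.\<close>
definition model_structure ::
  "bool set \<Rightarrow> 'a mcclass \<Rightarrow> 'a mcclass \<Rightarrow> 'a mcclass \<Rightarrow> bool" where
  "model_structure A W C F \<longleftrightarrow>
     (\<forall>X Y f. W X Y f \<or> C X Y f \<or> F X Y f \<longrightarrow> mcmap A X Y f) \<and>
     two_of_three A W \<and> retract_closed A W \<and> retract_closed A C \<and> retract_closed A F \<and>
     (\<forall>U V j X Y p. C U V j \<and> F X Y p \<and> (W U V j \<or> W X Y p) \<longrightarrow> lifts A U V j X Y p) \<and>
     (\<forall>X Y f. mcmap A X Y f \<longrightarrow>
        (\<exists>Z j p. C X Z j \<and> W X Z j \<and> F Z Y p \<and> f = mccomp X p j) \<and>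
        (\<exists>Z j p. C X Z j \<and> F Z Y p \<and> W Z Y p \<and> f = mccomp X p j))"

definition terminal :: "bool set \<Rightarrow> 'a mcset \<Rightarrow> bool" where
  "terminal A T \<longleftrightarrow> mcset A T \<and> (\<forall>X :: 'a mcset. mcset A X \<longrightarrow> (\<exists>!t. mcmap A X T t))"

definition fibrant :: "bool set \<Rightarrow> 'a mcclass \<Rightarrow> 'a mcset \<Rightarrow> bool" where
  "fibrant A F X \<longleftrightarrow> (\<exists>T t. terminal A T \<and> F X T t)"

definition comical_model_structure :: "bool set \<Rightarrow> 'a mcclass \<Rightarrow> 'a mcclass \<Rightarrow> bool" where
  "comical_model_structure A W F \<longleftrightarrow>
     model_structure A W (monomorphism A) F \<and>
     (\<forall>X. fibrant A F X \<longleftrightarrow> comical A X) \<and>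
     (\<forall>X Y p. mcmap A X Y p \<and> fibrant A F Y \<longrightarrow> (F X Y p \<longleftrightarrow> comical_rlp A X Y p))"


section \<open>Restriction along the inclusion of box categories\<close>

text \<open>
  On objects; a map \<open>f : X \<rightarrow> Y\<close> is sent to the same family of functions, regarded as a map
  \<open>i_star A X \<rightarrow> i_star A Y\<close>.
\<close>
definition i_star :: "bool set \<Rightarrow> 'a mcset \<Rightarrow> 'a mcset" where
  "i_star A X = X\<lparr>act := (\<lambda>m n f. if boxmor A m n f then act X m n f else (\<lambda>_. undefined))\<rparr>"

end

theory Submission
  imports Defs
begin

text \<open>
  Both families of generators are described by the faces of a single cube, so the lifting properties
  do not see the degeneracies and connections: \<open>i\<^sup>*\<close> preserves and reflects comical fibrations.  For
  the converse it remains to construct the connections of \<open>B\<close> outside \<open>A\<close> on a given fibration, one kind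
  at a time.  For an \<open>n\<close>-cube \<open>x\<close> the cubes \<open>x T\<close> with \<open>T : [1]^m \<rightarrow> [1]^n\<close> in \<open>\<box>\<^sub>B\<close> are constructed by
  induction.  If \<open>T\<close> factors through a new connection then all faces of \<open>x T\<close> are known, and \<open>x T\<close> is
  obtained as the missing face of an open box one dimension higher.  Since \<open>x T\<close> should occur twice among
  the faces of \<open>x T \<gamma>\<^sub>p\<close>, one of the two occurrences is replaced by an auxiliary cube that agrees
  with \<open>x T\<close> on the faces \<open>\<partial>\<^sub>t\<close> with \<open>t \<le> p\<close> only.  Functoriality in \<open>x\<close> is arranged by extending
  cubes in the order of their dimension: those that are already of the form \<open>y \<rho>\<close> inherit the
  extension of \<open>y\<close>, and for the others only the faces impose conditions.
\<close>

text \<open>An open box lacks exactly one face, while \<open>x T\<close> is the face of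
  \<open>x T \<gamma>\<close> in both directions \<open>q\<close> and \<open>q + 1\<close> at the
  neutral value \<open>e\<close>. In the auxiliary version the face in direction \<open>q\<close> is
  the true cube and the one in direction \<open>q + 1\<close> the auxiliary cube, so each can be the
  missing face of a box containing the other. If \<open>q\<close> is the least position at which
  \<open>T\<close> factors through a new connection, the auxiliary cube is a filler obtained one
  dimension lower, and the true cube is the missing face; at other positions the true cube comes
  first. \<open>rank\<close> turns this into a well-founded order. Marking extensions enter because
  a true cube found as a missing face still has to be marked. With one new kind at a time the old
  structure has at most one kind, and two distinct old quotients admit sections whose idempotents
  commute; so a cell that is degenerate in two ways receives one value. Functoriality in
  \<open>x\<close> rests on the uniqueness of a minimal presentation of \<open>x\<close> as
  \<open>y \<rho>\<close>: a split epimorphism of the box category is determined by its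
  sections.\<close>

abbreviation cmp :: "nat \<Rightarrow> cubemap \<Rightarrow> cubemap \<Rightarrow> cubemap" where
  "cmp m g f \<equiv> compose (vertices m) g f"

lemma vertices_iff [simp]: "xs \<in> vertices n \<longleftrightarrow> length xs = n"
  by (simp add: vertices_def)

lemma face_length [simp]:
  "length xs = n - 1 \<Longrightarrow> 1 \<le> i \<Longrightarrow> i \<le> n \<Longrightarrow> length (face n i e xs) = n"
  by (auto simp: face_def)

lemma face_nth:
  "length xs = n - 1 \<Longrightarrow> 1 \<le> i \<Longrightarrow> i \<le> n \<Longrightarrow> k < n \<Longrightarrow>
   face n i e xs ! k = (if k < i - 1 then xs ! k else if k = i - 1 then e else xs ! (k - 1))"
  by (auto simp: face_def nth_append min_def)

lemma degen_length [simp]: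
  "length xs = n \<Longrightarrow> 1 \<le> i \<Longrightarrow> i \<le> n \<Longrightarrow> length (degen n i xs) = n - 1"
  by (auto simp: degen_def)

lemma degen_nth:
  "length xs = n \<Longrightarrow> 1 \<le> i \<Longrightarrow> i \<le> n \<Longrightarrow> k < n - 1 \<Longrightarrow>
   degen n i xs ! k = (if k < i - 1 then xs ! k else xs ! (k + 1))"
  by (auto simp: degen_def nth_append min_def)

lemma conn_length [simp]:
  "length xs = n \<Longrightarrow> 1 \<le> i \<Longrightarrow> i < n \<Longrightarrow> length (conn n i e xs) = n - 1"
  by (auto simp: conn_def)

text \<open>The operation performed by the connection of kind \<open>e\<close>, written so that both
  kinds are treated at once: \<open>e\<close> is its neutral and \<open>\<not> e\<close> its
  absorbing element.\<close>

definition bin :: "bool \<Rightarrow> bool \<Rightarrow> bool \<Rightarrow> bool" where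
  "bin e a b = (if e then a \<and> b else a \<or> b)"

lemma bin_simps [simp]:
  "bin e e b = b" "bin e b e = b" "bin e (\<not> e) b = (\<not> e)" "bin e b (\<not> e) = (\<not> e)"
  "bin (\<not> e) e b = e" "bin (\<not> e) b e = e"
  by (auto simp: bin_def)

lemma bin_assoc: "bin e (bin e a b) c = bin e a (bin e b c)"
  by (auto simp: bin_def)

lemma conn_nth:
  "length xs = n \<Longrightarrow> 1 \<le> i \<Longrightarrow> i < n \<Longrightarrow> k < n - 1 \<Longrightarrow>
   conn n i e xs ! k = (if k < i - 1 then xs ! k
      else if k = i - 1 then bin e (xs ! (i - 1)) (xs ! i) else xs ! (k + 1))"
  by (auto simp: conn_def nth_append min_def max_def bin_def nth_Cons' Suc_diff_le)

lemma idbox_nth [simp]: "length xs = n \<Longrightarrow> idbox n xs = xs"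
  by (simp add: idbox_def)

lemma cmp_apply [simp]: "length xs = m \<Longrightarrow> cmp m g f xs = g (f xs)"
  by (simp add: compose_def)

lemma face_ext [simp]: "face n i e \<in> extensional (vertices (n - 1))"
  and degen_ext [simp]: "degen n i \<in> extensional (vertices n)"
  and conn_ext [simp]: "conn n i e \<in> extensional (vertices n)"
  and idbox_ext [simp]: "idbox n \<in> extensional (vertices n)"
  by (simp_all add: face_def degen_def conn_def idbox_def)

lemma cubemap_eqI:
  assumes "f \<in> extensional (vertices m)" "g \<in> extensional (vertices m)"
    and "\<And>xs. length xs = m \<Longrightarrow> length (f xs) = n \<and> length (g xs) = n \<and> (\<forall>k<n. f xs ! k = g xs ! k)"
  shows "f = g"
proof (rule extensionalityI[OF assms(1,2)])
  fix xs assume "xs \<in> vertices m"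
  then show "f xs = g xs"
    using assms(3)[of xs] by (intro nth_equalityI) auto
qed

lemma cmp_eqI:
  assumes "\<And>xs. length xs = m \<Longrightarrow>
    length (g (f xs)) = n \<and> length (g' (f' xs)) = n \<and> (\<forall>k<n. g (f xs) ! k = g' (f' xs) ! k)"
  shows "cmp m g f = cmp m g' f'"
  by (rule cubemap_eqI[where n = n and m = m]) (use assms in simp_all)

lemma cmp_eq_idboxI:
  assumes "\<And>xs. length xs = m \<Longrightarrow> length (g (f xs)) = m \<and> (\<forall>k<m. g (f xs) ! k = xs ! k)"
  shows "cmp m g f = idbox m"
  by (rule cubemap_eqI[where n = m and m = m]) (use assms in simp_all)

section \<open>Cubical identities\<close>

lemma face_face:
  assumes "1 \<le> j" "j < k" "k \<le> n"
  shows "cmp (n - 2) (face n k c') (face (n - 1) j c) = cmp (n - 2) (face n j c) (face (n - 1) (k - 1) c')"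
proof -
  \<comment> \<open>Writing the indices as successors removes truncated subtraction from the
    coordinate comparison.\<close>
  obtain j' k' n' where *: "j = Suc j'" "k = Suc (Suc k')" "n = Suc (Suc n')"
    using assms by (metis Suc_le_D One_nat_def Suc_le_eq le_trans less_imp_Suc_add add_Suc_right add_Suc)
  show ?thesis
    by (rule cmp_eqI[where n = n]) (use assms in \<open>auto simp: * face_nth nth_Cons' less_Suc_eq_le\<close>)
qed

lemma degen_face_same:
  assumes "1 \<le> i" "i \<le> m"
  shows "cmp (m - 1) (degen m i) (face m i c) = idbox (m - 1)"
  by (rule cmp_eq_idboxI) (use assms in \<open>simp add: face_nth degen_nth\<close>)

lemma degen_face_less:
  assumes "1 \<le> t" "t < i" "i \<le> m"
  shows "cmp (m - 1) (degen m i) (face m t c) = cmp (m - 1) (face (m - 1) t c) (degen (m - 1) (i - 1))"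
  by (rule cmp_eqI[where n = "m - 1"]) (use assms in \<open>simp add: face_nth degen_nth\<close>)

lemma degen_face_greater:
  assumes "1 \<le> i" "i < t" "t \<le> m"
  shows "cmp (m - 1) (degen m i) (face m t c) = cmp (m - 1) (face (m - 1) (t - 1) c) (degen (m - 1) i)"
  by (rule cmp_eqI[where n = "m - 1"]) (use assms in \<open>simp add: face_nth degen_nth\<close>)

lemma conn_face_same:
  assumes "1 \<le> i" "i < m" "t = i \<or> t = i + 1"
  shows "cmp (m - 1) (conn m i e) (face m t e) = idbox (m - 1)"
  using assms(3)
proof (elim disjE)
  assume t: "t = i" show ?thesis unfolding t
    by (rule cmp_eq_idboxI) (use assms(1,2) in \<open>simp add: face_nth conn_nth\<close>)
next
  assume t: "t = i + 1" show ?thesis unfolding t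
    by (rule cmp_eq_idboxI) (use assms(1,2) in \<open>simp add: face_nth conn_nth\<close>)
qed

text \<open>\<open>\<not> e\<close> is absorbing for kind \<open>e\<close>: once one of the two
  merged coordinates has this value, so does the result, whatever the other coordinate is.\<close>

lemma conn_face_opp:
  assumes "1 \<le> i" "i < m" "t = i \<or> t = i + 1"
  shows "cmp (m - 1) (conn m i e) (face m t (\<not> e)) = cmp (m - 1) (face (m - 1) i (\<not> e)) (degen (m - 1) i)"
  using assms(3)
proof (elim disjE)
  assume t: "t = i" show ?thesis unfolding t
    by (rule cmp_eqI[where n = "m - 1"]) (use assms(1,2) in \<open>simp add: face_nth conn_nth degen_nth\<close>)
next
  assume t: "t = i + 1" show ?thesis unfolding t
    by (rule cmp_eqI[where n = "m - 1"]) (use assms(1,2) in \<open>simp add: face_nth conn_nth degen_nth\<close>)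
qed

lemma conn_face_less:
  assumes "1 \<le> t" "t < i" "i < m"
  shows "cmp (m - 1) (conn m i e) (face m t c) = cmp (m - 1) (face (m - 1) t c) (conn (m - 1) (i - 1) e)"
proof -
  obtain i' t' m' where *: "t = Suc t'" "i = Suc (Suc i')" "m = Suc (Suc m')"
    using assms by (metis Suc_le_D One_nat_def Suc_le_eq le_trans less_imp_Suc_add add_Suc_right add_Suc)
  show ?thesis
    by (rule cmp_eqI[where n = "m - 1"]) (use assms in \<open>simp add: * face_nth conn_nth less_Suc_eq_le\<close>, intro conjI impI allI; linarith)
qed

lemma conn_face_greater:
  assumes "1 \<le> i" "i + 1 < t" "t \<le> m"
  shows "cmp (m - 1) (conn m i e) (face m t c) = cmp (m - 1) (face (m - 1) (t - 1) c) (conn (m - 1) i e)"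
proof -
  obtain i' t' m' where *: "i = Suc i'" "t = Suc (Suc t')" "m = Suc (Suc m')"
    using assms by (metis Suc_le_D One_nat_def Suc_le_eq le_trans less_imp_Suc_add add_Suc_right add_Suc)
  show ?thesis
    by (rule cmp_eqI[where n = "m - 1"]) (use assms in \<open>simp add: * face_nth conn_nth less_Suc_eq_le\<close>, intro conjI impI allI; linarith)
qed

lemma degen_conn_less:
  assumes "1 \<le> i" "i < p" "p \<le> m"
  shows "cmp (m + 1) (degen m i) (conn (m + 1) p e) = cmp (m + 1) (conn m (p - 1) e) (degen (m + 1) i)"
  by (rule cmp_eqI[where n = "m - 1"]) (use assms in \<open>simp add: degen_nth conn_nth\<close>)

lemma degen_conn_same:
  assumes "1 \<le> p" "p \<le> m"
  shows "cmp (m + 1) (degen m p) (conn (m + 1) p e) = cmp (m + 1) (degen m p) (degen (m + 1) p)"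
  by (rule cmp_eqI[where n = "m - 1"]) (use assms in \<open>simp add: degen_nth conn_nth\<close>)

lemma degen_conn_greater:
  assumes "1 \<le> p" "p < i" "i \<le> m"
  shows "cmp (m + 1) (degen m i) (conn (m + 1) p e) = cmp (m + 1) (conn m p e) (degen (m + 1) (i + 1))"
  by (rule cmp_eqI[where n = "m - 1"]) (use assms in \<open>simp add: degen_nth conn_nth\<close>)

lemma conn_conn_less:
  assumes "1 \<le> i" "i + 1 < p" "p \<le> m"
  shows "cmp (m + 1) (conn m i e') (conn (m + 1) p e) = cmp (m + 1) (conn m (p - 1) e) (conn (m + 1) i e')"
proof -
  obtain i' t' m' where *: "i = Suc i'" "p = Suc (Suc t')" "m = Suc (Suc m')"
    using assms by (metis Suc_le_D One_nat_def Suc_le_eq le_trans less_imp_Suc_add add_Suc_right add_Suc)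
  show ?thesis
    by (rule cmp_eqI[where n = "m - 1"]) (use assms in \<open>simp add: * conn_nth less_Suc_eq_le\<close>)
qed

lemma conn_conn_assoc:
  assumes "1 \<le> i" "i < m"
  shows "cmp (m + 1) (conn m i e) (conn (m + 1) (i + 1) e) = cmp (m + 1) (conn m i e) (conn (m + 1) i e)"
  by (rule cmp_eqI[where n = "m - 1"]) (use assms in \<open>simp add: conn_nth bin_assoc\<close>)

lemma conn_conn_greater:
  assumes "1 \<le> p" "p < i" "i < m"
  shows "cmp (m + 1) (conn m i e') (conn (m + 1) p e) = cmp (m + 1) (conn m p e) (conn (m + 1) (i + 1) e')"
  by (rule cmp_eqI[where n = "m - 1"]) (use assms in \<open>simp add: conn_nth\<close>)

section \<open>Morphisms of the box categories and their elementary quotients\<close>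

lemma boxmor_funcset: "boxmor A m n f \<Longrightarrow> f \<in> vertices m \<rightarrow>\<^sub>E vertices n"
proof (induction rule: boxmor.induct)
  case (boxmor_id n)
  then show ?case by (auto simp: idbox_def)
next
  case (boxmor_face i n e)
  then show ?case by (auto intro!: PiE_I simp: extensional_def)(auto simp: face_def)
next
  case (boxmor_degen i n)
  then show ?case by (auto intro!: PiE_I)(auto simp: degen_def)
next
  case (boxmor_conn e i n)
  then show ?case by (auto intro!: PiE_I)(auto simp: conn_def)
next
  case (boxmor_comp k m f n g)
  then show ?case by (auto simp: PiE_iff)
qed

lemma boxmor_length: "boxmor A m n f \<Longrightarrow> length xs = m \<Longrightarrow> length (f xs) = n"
  using boxmor_funcset[of A m n f] by (auto simp: PiE_iff)

lemma boxmor_ext: "boxmor A m n f \<Longrightarrow> f \<in> extensional (vertices m)"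
  using boxmor_funcset[of A m n f] by (auto simp: PiE_iff)

lemma boxmor_eqI:
  "boxmor A m n f \<Longrightarrow> boxmor B m n' g \<Longrightarrow> (\<And>xs. length xs = m \<Longrightarrow> f xs = g xs) \<Longrightarrow> f = g"
  by (rule extensionalityI[of _ "vertices m"]) (auto intro: boxmor_ext)

lemma boxmor_mono: "boxmor A m n f \<Longrightarrow> A \<subseteq> B \<Longrightarrow> boxmor B m n f"
  by (induction rule: boxmor.induct) (auto intro: boxmor.intros simp del: One_nat_def)

lemma boxmor_cmp_assoc: "boxmor A k m f \<Longrightarrow> cmp k (cmp m h g) f = cmp k h (cmp k g f)"
  by (rule extensionalityI[of _ "vertices k"]) (auto dest: boxmor_length)

lemma boxmor_id_left: "boxmor A m n f \<Longrightarrow> cmp m (idbox n) f = f"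
  by (rule extensionalityI[of _ "vertices m"]) (auto dest: boxmor_length boxmor_ext)

lemma boxmor_id_right: "boxmor A m n f \<Longrightarrow> cmp m f (idbox m) = f"
  by (rule extensionalityI[of _ "vertices m"]) (auto dest: boxmor_length boxmor_ext)

text \<open>The one-step quotients that leave the first \<open>p\<close> coordinates alone;
  \<open>p = 0\<close> gives all degeneracies and connections over \<open>A\<close>. The bound is
  the parameter of an auxiliary cell, which has to respect only these quotients.\<close>

definition elementary :: "bool set \<Rightarrow> nat \<Rightarrow> nat \<Rightarrow> cubemap \<Rightarrow> bool" where
  "elementary A p m s \<longleftrightarrow> (\<exists>i. p < i \<and> i \<le> m \<and> s = degen m i) \<or>
     (\<exists>i e. e \<in> A \<and> p < i \<and> i < m \<and> s = conn m i e)"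

text \<open>Constancy on the fibres of \<open>s\<close>. For a quotient with a section this amounts
  to \<open>T\<close> being a composite of some map with \<open>s\<close>, but naming no second
  factor makes it easy to transport along commuting squares.\<close>

definition factors :: "nat \<Rightarrow> cubemap \<Rightarrow> cubemap \<Rightarrow> bool" where
  "factors m s T \<longleftrightarrow> (\<forall>xs ys. length xs = m \<longrightarrow> length ys = m \<longrightarrow> s xs = s ys \<longrightarrow> T xs = T ys)"

text \<open>For a box morphism this means factoring through a face, so that \<open>x T\<close> is
  determined by a proper face of \<open>x\<close>.\<close>

definition const_coord :: "nat \<Rightarrow> nat \<Rightarrow> cubemap \<Rightarrow> bool" where
  "const_coord m n T \<longleftrightarrow> (\<exists>j c. 1 \<le> j \<and> j \<le> n \<and> (\<forall>xs. length xs = m \<longrightarrow> T xs ! (j - 1) = c))"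

lemma elementary_boxmor: "elementary A p m s \<Longrightarrow> boxmor A m (m - 1) s"
  by (auto simp: elementary_def simp del: One_nat_def intro!: boxmor_degen[of _ m] boxmor_conn[of _ _ _ m])

lemma elementary_less: "elementary A p m s \<Longrightarrow> p < m"
  by (auto simp: elementary_def)

lemma elementary_le: "elementary A p m s \<Longrightarrow> q \<le> p \<Longrightarrow> elementary A q m s"
  unfolding elementary_def by (elim disjE exE conjE) (metis le_less_trans)+

lemma elementary_mono: "elementary A p m s \<Longrightarrow> A \<subseteq> B \<Longrightarrow> elementary B p m s"
  unfolding elementary_def by blast

lemma elementary_section:
  assumes "elementary A p m s"
  obtains t e where "p < t" "t \<le> m" "cmp (m - 1) s (face m t e) = idbox (m - 1)"
  using assms unfolding elementary_def
proof (elim disjE exE conjE)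
  fix i assume "p < i" "i \<le> m" "s = degen m i"
  then show thesis
    by (intro that[of i True]) (auto simp: degen_face_same[simplified])
next
  fix i e assume "p < i" "i < m" "s = conn m i e"
  then show thesis
    by (intro that[of i e]) (auto simp: conn_face_same[simplified])
qed

lemma elementary_face:
  assumes "elementary A p m s" "p < t" "t \<le> m"
  shows "cmp (m - 1) s (face m t c) = idbox (m - 1) \<or>
    (\<exists>t' c' s'. p < t' \<and> t' \<le> m - 1 \<and> elementary A p (m - 1) s' \<and>
       cmp (m - 1) s (face m t c) = cmp (m - 1) (face (m - 1) t' c') s')"
  using assms(1) unfolding elementary_def[of A p m]
proof (elim disjE exE conjE)
  fix i assume i: "p < i" "i \<le> m" "s = degen m i"
  consider "t = i" | "t < i" | "i < t" by linarith
  then show ?thesis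
  proof cases
    case 1 then show ?thesis using i degen_face_same[of i m c] by simp
  next
    case 2
    then have "elementary A p (m - 1) (degen (m - 1) (i - 1))"
      unfolding elementary_def using i assms by (intro disjI1 exI[of _ "i - 1"]) auto
    then show ?thesis using i assms 2 degen_face_less[of t i m c]
      by (intro disjI2 exI[of _ t] exI[of _ c] exI[of _ "degen (m - 1) (i - 1)"]) auto
  next
    case 3
    then have "elementary A p (m - 1) (degen (m - 1) i)"
      unfolding elementary_def using i assms by (intro disjI1 exI[of _ i]) auto
    then show ?thesis using i assms 3 degen_face_greater[of i t m c]
      by (intro disjI2 exI[of _ "t - 1"] exI[of _ c] exI[of _ "degen (m - 1) i"]) auto
  qed
next
  fix i e assume i: "e \<in> A" "p < i" "i < m" "s = conn m i e"
  consider "t = i \<or> t = i + 1" "c = e" | "t = i \<or> t = i + 1" "c = (\<not> e)" | "t < i" | "i + 1 < t"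
    by (cases "c = e") (auto, linarith+)
  then show ?thesis
  proof cases
    case 1 then show ?thesis using i conn_face_same[of i m t e] by simp
  next
    case 2
    then have "elementary A p (m - 1) (degen (m - 1) i)"
      unfolding elementary_def using i assms by (intro disjI1 exI[of _ i]) auto
    then show ?thesis using i assms 2 conn_face_opp[of i m t e]
      by (intro disjI2 exI[of _ i] exI[of _ c] exI[of _ "degen (m - 1) i"]) auto
  next
    case 3
    then have "elementary A p (m - 1) (conn (m - 1) (i - 1) e)"
      unfolding elementary_def using i assms by (intro disjI2 exI[of _ "i - 1"] exI[of _ e]) auto
    then show ?thesis using i assms 3 conn_face_less[of t i m e c]
      by (intro disjI2 exI[of _ t] exI[of _ c] exI[of _ "conn (m - 1) (i - 1) e"]) auto
  next
    case 4
    then have "elementary A p (m - 1) (conn (m - 1) i e)"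
      unfolding elementary_def using i assms by (intro disjI2 exI[of _ i] exI[of _ e]) auto
    then show ?thesis using i assms 4 conn_face_greater[of i t m e c]
      by (intro disjI2 exI[of _ "t - 1"] exI[of _ c] exI[of _ "conn (m - 1) i e"]) auto
  qed
qed

text \<open>A direction at most \<open>p\<close> is not touched by \<open>s\<close>, so the face
  passes through unchanged; the bound drops because a coordinate below it has disappeared.\<close>

lemma elementary_face_low:
  assumes "elementary A p m s" "1 \<le> t" "t \<le> p"
  obtains s' where "elementary A (p - 1) (m - 1) s'"
    "cmp (m - 1) s (face m t c) = cmp (m - 1) (face (m - 1) t c) s'"
  using assms(1) unfolding elementary_def[of A p m]
proof (elim disjE exE conjE)
  fix i assume i: "p < i" "i \<le> m" "s = degen m i"
  show thesis
  proof (rule that)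
    show "elementary A (p - 1) (m - 1) (degen (m - 1) (i - 1))"
      unfolding elementary_def using i assms by (intro disjI1 exI[of _ "i - 1"]) auto
    show "cmp (m - 1) s (face m t c) = cmp (m - 1) (face (m - 1) t c) (degen (m - 1) (i - 1))"
      using i assms degen_face_less[of t i m c] by simp
  qed
next
  fix i e assume i: "e \<in> A" "p < i" "i < m" "s = conn m i e"
  show thesis
  proof (rule that)
    show "elementary A (p - 1) (m - 1) (conn (m - 1) (i - 1) e)"
      unfolding elementary_def using i assms by (intro disjI2 exI[of _ "i - 1"] exI[of _ e]) auto
    show "cmp (m - 1) s (face m t c) = cmp (m - 1) (face (m - 1) t c) (conn (m - 1) (i - 1) e)"
      using i assms conn_face_less[of t i m e c] by simp
  qed
qed

text \<open>Since \<open>d\<close> is a section, \<open>s\<close> takes the same value at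
  \<open>xs\<close> and at \<open>d (s xs)\<close>; constancy on fibres then gives
  \<open>T xs = T (d (s xs))\<close>.\<close>

lemma factors_factor:
  assumes "factors m s T" "boxmor A m n T" "boxmor B m k s" "boxmor C k m d" "cmp k s d = idbox k"
  shows "T = cmp m (cmp k T d) s"
proof (rule extensionalityI[of _ "vertices m"])
  fix xs assume "xs \<in> vertices m"
  then have xs: "length xs = m" by simp
  note sx = boxmor_length[OF assms(3) xs]
  note dsx = boxmor_length[OF assms(4) sx]
  have "s (d (s xs)) = s xs"
    using fun_cong[OF assms(5), of "s xs"] sx by simp
  then have "T xs = T (d (s xs))"
    using assms(1) xs dsx unfolding factors_def by metis
  then show "T xs = cmp m (cmp k T d) s xs"
    using xs sx by simp
qed (simp_all add: boxmor_ext[OF assms(2)])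

lemma factors_cmp: "factors m s (cmp m T s)"
  by (simp add: factors_def)

lemma factors_cmp_left: "factors m s T \<Longrightarrow> factors m s (cmp m g T)"
  unfolding factors_def by (metis cmp_apply)

lemma elementary_factor:
  assumes "elementary A p m s" "factors m s T" "boxmor B m n T"
  obtains T' where "boxmor B (m - 1) n T'" "T = cmp m T' s"
proof -
  obtain t d where t: "p < t" "t \<le> m" "cmp (m - 1) s (face m t d) = idbox (m - 1)" using elementary_section[OF assms(1)] .
  have f: "boxmor B (m - 1) m (face m t d)" using t by (intro boxmor_face) auto
  show thesis
    using that[OF boxmor_comp[OF f assms(3)]] factors_factor[OF assms(2,3) elementary_boxmor[OF assms(1)] f t(3)] by simp
qed

text \<open>The device by which a factorisation of \<open>T\<close> is passed on to its faces: each
  cubical identity for \<open>s\<close> is such a square.\<close>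

lemma factors_square:
  assumes "factors m s T" "boxmor A k m a" "cmp k s a = cmp k b s'"
  shows "factors k s' (cmp k T a)"
  unfolding factors_def
proof (intro allI impI)
  fix xs ys assume *: "length xs = k" "length ys = k" "s' xs = s' ys"
  have "s (a xs) = s (a ys)"
    using fun_cong[OF assms(3), of xs] fun_cong[OF assms(3), of ys] * by simp
  then show "cmp k T a xs = cmp k T a ys"
    using * assms boxmor_length[OF assms(2)] by (simp add: factors_def)
qed

lemma const_coord_cmp: "const_coord m n T \<Longrightarrow> boxmor A k m a \<Longrightarrow> const_coord k n (cmp k T a)"
  unfolding const_coord_def by (metis boxmor_length cmp_apply)

lemma const_coord_factor:
  assumes "boxmor A m n T" "1 \<le> j" "j \<le> n" "\<And>xs. length xs = m \<Longrightarrow> T xs ! (j - 1) = c"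
  shows "T = cmp m (face n j c) (cmp m (degen n j) T)"
proof (rule cubemap_eqI[where n = n and m = m])
  fix xs :: "bool list" assume xs: "length xs = m"
  then have "length (T xs) = n" using assms boxmor_length by blast
  then show "length (T xs) = n \<and> length (cmp m (face n j c) (cmp m (degen n j) T) xs) = n \<and>
    (\<forall>k<n. T xs ! k = cmp m (face n j c) (cmp m (degen n j) T) xs ! k)"
    using assms xs by (auto simp: face_nth degen_nth)
qed (use assms boxmor_ext in auto)

lemma const_coord_obtain:
  assumes "boxmor A m n T" "const_coord m n T"
  obtains j c T' where "1 \<le> j" "j \<le> n" "boxmor A m (n - 1) T'" "T = cmp m (face n j c) T'"
proof -
  obtain j c where "1 \<le> j" "j \<le> n" "\<And>xs. length xs = m \<Longrightarrow> T xs ! (j - 1) = c"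
    using assms(2) by (auto simp: const_coord_def)
  then show thesis
    using that[of j "cmp m (degen n j) T" c] const_coord_factor[OF assms(1)]
      boxmor_comp[OF assms(1) boxmor_degen] by simp
qed

lemma const_coord_face: "1 \<le> j \<Longrightarrow> j \<le> n \<Longrightarrow> boxmor A m (n - 1) T \<Longrightarrow> const_coord m n (cmp m (face n j c) T)"
  unfolding const_coord_def by (intro exI[of _ j] exI[of _ c]) (auto simp: face_nth boxmor_length)

section \<open>Normal forms\<close>

text \<open>Composites of faces involve no connections, hence are morphisms over every
  \<open>A\<close>. Therefore the given structure of \<open>X\<close> acts along sections of
  morphisms that exist only over \<open>B\<close>.\<close>

inductive monic :: "nat \<Rightarrow> nat \<Rightarrow> cubemap \<Rightarrow> bool" where
  monic_id: "monic n n (idbox n)"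
| monic_face: "monic k n d \<Longrightarrow> 1 \<le> j \<Longrightarrow> j \<le> Suc n \<Longrightarrow> monic k (Suc n) (cmp k (face (Suc n) j c) d)"

inductive epi :: "bool set \<Rightarrow> nat \<Rightarrow> nat \<Rightarrow> cubemap \<Rightarrow> bool" for A where
  epi_id: "epi A n n (idbox n)"
| epi_elem: "elementary A 0 (Suc m) s \<Longrightarrow> epi A m k g \<Longrightarrow> epi A (Suc m) k (cmp (Suc m) g s)"

lemma monic_boxmor: "monic k n d \<Longrightarrow> boxmor A k n d"
proof (induction rule: monic.induct)
  case (monic_face k n d j c)
  have "boxmor A n (Suc n) (face (Suc n) j c)"
    using boxmor_face[of j "Suc n" A c] monic_face.hyps by simp
  then show ?case by (rule boxmor_comp[OF monic_face.IH])
qed (rule boxmor_id)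

lemma epi_boxmor: "epi A m k g \<Longrightarrow> boxmor A m k g"
proof (induction rule: epi.induct)
  case (epi_elem m s k g)
  then show ?case using boxmor_comp[OF elementary_boxmor[OF epi_elem.hyps(1)]] by simp
qed (rule boxmor_id)

lemma epi_le: "epi A m k g \<Longrightarrow> k \<le> m"
  by (induction rule: epi.induct) auto

lemma epi_comp:
  "epi A l m h \<Longrightarrow> epi A m k g \<Longrightarrow> epi A l k (cmp l g h)"
proof (induction rule: epi.induct)
  case (epi_id n)
  then show ?case using boxmor_id_right[OF epi_boxmor] by simp
next
  case (epi_elem l s m h)
  have "cmp (Suc l) g (cmp (Suc l) h s) = cmp (Suc l) (cmp l g h) s"
    using boxmor_cmp_assoc[OF elementary_boxmor[OF epi_elem.hyps(1)]] by simp
  then show ?case using epi.epi_elem[OF epi_elem.hyps(1) epi_elem.IH[OF epi_elem.prems]] by simp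
qed

text \<open>Moves a quotient to the right past a composite of faces. At each face it either cancels
  or leaves one face and one quotient in lower dimension.\<close>

lemma elementary_mon:
  "monic k n d \<Longrightarrow> elementary A 0 n s \<Longrightarrow> \<exists>l d' g. monic l (n - 1) d' \<and> epi A k l g \<and> cmp k s d = cmp k d' g"
proof (induction arbitrary: s rule: monic.induct)
  case (monic_id n)
  have "epi A n (n - 1) s"
    using epi.epi_elem[OF _ epi_id, of A "n - 1" s] monic_id elementary_less[OF monic_id]
      boxmor_id_left[OF elementary_boxmor[OF monic_id]] by simp
  then show ?case
    using monic.monic_id boxmor_id_left boxmor_id_right[OF elementary_boxmor[OF monic_id]]
    by (metis epi_boxmor)
next
  case (monic_face k n d j c)
  note d = monic_boxmor[OF monic_face.hyps(1), of A]
  have eq: "cmp k s (cmp k (face (Suc n) j c) d) = cmp k (cmp n s (face (Suc n) j c)) d"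
    using boxmor_cmp_assoc[OF d] by simp
  from elementary_face[OF monic_face.prems, of j c] monic_face.hyps
  consider "cmp n s (face (Suc n) j c) = idbox n"
    | t' c' s' where "0 < t'" "t' \<le> n" "elementary A 0 n s'"
        "cmp n s (face (Suc n) j c) = cmp n (face n t' c') s'" by auto
  then show ?case
  proof cases
    case 1
    then have "cmp k s (cmp k (face (Suc n) j c) d) = cmp k d (idbox k)"
      using eq boxmor_id_left[OF d] boxmor_id_right[OF d] by simp
    then show ?thesis using monic_face.hyps(1) epi_id by fastforce
  next
    case 2
    obtain l d' g where *: "monic l (n - 1) d'" "epi A k l g" "cmp k s' d = cmp k d' g"
      using monic_face.IH[OF 2(3)] by auto
    have "cmp k (cmp n (face n t' c') s') d = cmp k (cmp l (face n t' c') d') g"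
      using boxmor_cmp_assoc[OF d] boxmor_cmp_assoc[OF epi_boxmor[OF *(2)]] *(3) by simp
    moreover have "monic l n (cmp l (face n t' c') d')"
      using monic.monic_face[OF *(1), of t' c'] 2 by simp
    ultimately show ?thesis using * eq 2 by auto
  qed
qed

lemma epi_mon:
  "epi A n n' e \<Longrightarrow> monic k n d \<Longrightarrow> \<exists>l d' g. monic l n' d' \<and> epi A k l g \<and> cmp k e d = cmp k d' g"
proof (induction arbitrary: k d rule: epi.induct)
  case (epi_id n)
  have "cmp k (idbox n) d = cmp k d (idbox k)"
    using boxmor_id_left boxmor_id_right monic_boxmor[OF epi_id] by metis
  then show ?case using epi_id epi.epi_id by blast
next
  case (epi_elem n s n' e)
  obtain l d' g where *: "monic l n d'" "epi A k l g" "cmp k s d = cmp k d' g"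
    using elementary_mon[OF epi_elem.prems epi_elem.hyps(1)] by auto
  obtain l' d'' g' where **: "monic l' n' d''" "epi A l l' g'" "cmp l e d' = cmp l d'' g'"
    using epi_elem.IH[OF *(1)] by auto
  have "cmp k (cmp (Suc n) e s) d = cmp k e (cmp k s d)"
    using boxmor_cmp_assoc[OF monic_boxmor[OF epi_elem.prems]] by simp
  also have "\<dots> = cmp k (cmp l e d') g"
    using boxmor_cmp_assoc[OF epi_boxmor[OF *(2)]] *(3) by simp
  also have "\<dots> = cmp k d'' (cmp k g' g)"
    using boxmor_cmp_assoc[OF epi_boxmor[OF *(2)]] **(3) by simp
  finally show ?case using ** epi_comp[OF *(2) **(2)] by blast
qed

lemma monic_comp: "monic m n d \<Longrightarrow> monic k m d' \<Longrightarrow> monic k n (cmp k d d')"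
proof (induction rule: monic.induct)
  case (monic_id n)
  then show ?case using boxmor_id_left[OF monic_boxmor] by simp
next
  case (monic_face m n d j c)
  then show ?case
    using monic.monic_face[of k n "cmp k d d'" j c] boxmor_cmp_assoc[OF monic_boxmor[OF monic_face.prems]]
    by simp
qed

text \<open>Only composition has content: the quotient part of the outer factor is moved past the
  faces of the inner one by \<open>epi_mon\<close>.\<close>

theorem boxmor_normal_form:
  "boxmor A m n f \<Longrightarrow> \<exists>k d g. monic k n d \<and> epi A m k g \<and> f = cmp m d g"
proof (induction rule: boxmor.induct)
  case (boxmor_id n)
  then show ?case using monic_id epi_id boxmor_id_left[OF boxmor.boxmor_id] by metis
next
  case (boxmor_face i n e)
  then have "monic (n - 1) n (cmp (n - 1) (face n i e) (idbox (n - 1)))"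
    using monic_face[OF monic_id, of i "n - 1" e] by simp
  moreover have "cmp (n - 1) (face n i e) (idbox (n - 1)) = face n i e"
    by (rule boxmor_id_right[OF boxmor.boxmor_face[OF boxmor_face]])
  ultimately show ?case using epi_id by metis
next
  case (boxmor_degen i n)
  then have s: "elementary A 0 n (degen n i)" unfolding elementary_def by (intro disjI1 exI[of _ i]) auto
  then show ?case using elementary_mon[OF monic_id s] boxmor_id_right[OF elementary_boxmor[OF s]] by simp
next
  case (boxmor_conn e i n)
  then have s: "elementary A 0 n (conn n i e)" unfolding elementary_def by (intro disjI2 exI[of _ i] exI[of _ e]) auto
  then show ?case using elementary_mon[OF monic_id s] boxmor_id_right[OF elementary_boxmor[OF s]] by simp
next
  case (boxmor_comp k m f n g)
  then obtain l d e l' d' e' where *: "monic l m d" "epi A k l e" "f = cmp k d e"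
    "monic l' n d'" "epi A m l' e'" "g = cmp m d' e'" by auto
  obtain l'' d'' e'' where **: "monic l'' l' d''" "epi A l l'' e''" "cmp l e' d = cmp l d'' e''"
    using epi_mon[OF *(5) *(1)] by auto
  have e: "boxmor A k l e" and f: "boxmor A k m f" and e'': "boxmor A l l'' e''"
    using * ** epi_boxmor boxmor_comp by auto
  have "cmp k g f = cmp k d' (cmp k e' f)"
    using * boxmor_cmp_assoc[OF f] by simp
  also have "cmp k e' f = cmp k (cmp l e' d) e"
    using * boxmor_cmp_assoc[OF e] by simp
  also have "\<dots> = cmp k d'' (cmp k e'' e)"
    using ** boxmor_cmp_assoc[OF e] by simp
  also have "cmp k d' \<dots> = cmp k (cmp l'' d' d'') (cmp k e'' e)"
    using boxmor_cmp_assoc[OF boxmor.boxmor_comp[OF e e'']] by simp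
  finally show ?case using monic_comp[OF *(4) **(1)] epi_comp[OF *(2) **(2)] by blast
qed

text \<open>The trichotomy behind the construction of \<open>x T\<close>: it comes from a proper
  face of \<open>x\<close>, is \<open>x\<close> itself, or is degenerate.\<close>

theorem boxmor_cases_degenerate:
  assumes "boxmor A m n f"
  obtains (const) "const_coord m n f" | (id) "m = n" "f = idbox n"
    | (degen) s where "elementary A 0 m s" "factors m s f"
proof -
  obtain k d g where *: "monic k n d" "epi A m k g" "f = cmp m d g"
    using boxmor_normal_form[OF assms] by auto
  from *(1) show thesis
  proof cases
    case monic_id
    then have f: "f = g" using * boxmor_id_left[OF epi_boxmor[OF *(2)]] by simp
    from *(2) show thesis
    proof cases
      case epi_id then show ?thesis using id f monic_id by simp
    next
      case (epi_elem m s g')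
      then show ?thesis using degen[of s] f factors_cmp by simp
    qed
  next
    case (monic_face n' d' j c)
    then have "f = cmp m (face n j c) (cmp m d' g)"
      using * boxmor_cmp_assoc[OF epi_boxmor[OF *(2)]] by simp
    moreover have "boxmor A m (n - 1) (cmp m d' g)"
      using boxmor_comp[OF epi_boxmor[OF *(2)] monic_boxmor[OF monic_face(3)]] monic_face by simp
    ultimately show ?thesis using const const_coord_face[of j n] monic_face by simp
  qed
qed

section \<open>Split epimorphisms and their sections\<close>

lemma epi_section: "epi A m k g \<Longrightarrow> \<exists>d. monic k m d \<and> cmp k g d = idbox k"
proof (induction rule: epi.induct)
  case (epi_id n)
  then show ?case using monic_id boxmor_id_left[OF boxmor_id] by metis
next
  case (epi_elem m s k g)
  obtain d where d: "monic k m d" "cmp k g d = idbox k" using epi_elem.IH by auto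
  obtain t e where t: "0 < t" "t \<le> Suc m" "cmp m s (face (Suc m) t e) = idbox m"
    using elementary_section[OF epi_elem.hyps(1)] by auto
  have dd: "monic k (Suc m) (cmp k (face (Suc m) t e) d)"
    using monic_face[OF d(1), of t e] t by simp
  have "cmp k (cmp (Suc m) g s) (cmp k (face (Suc m) t e) d) =
        cmp k g (cmp k s (cmp k (face (Suc m) t e) d))"
    using boxmor_cmp_assoc[OF monic_boxmor[OF dd]] by simp
  also have "cmp k s (cmp k (face (Suc m) t e) d) = cmp k (idbox m) d"
    using boxmor_cmp_assoc[OF monic_boxmor[OF d(1)]] t by metis
  also have "\<dots> = d" using boxmor_id_left[OF monic_boxmor[OF d(1)]] .
  finally show ?case using d dd by auto
qed

text \<open>A monic part other than the identity ends in a face, which makes a coordinate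
  constant.\<close>

lemma not_const_epi:
  assumes "boxmor A m n f" "\<not> const_coord m n f"
  shows "epi A m n f"
proof -
  obtain k d g where *: "monic k n d" "epi A m k g" "f = cmp m d g"
    using boxmor_normal_form[OF assms(1)] by auto
  from *(1) show ?thesis
  proof cases
    case monic_id
    then show ?thesis using * boxmor_id_left[OF epi_boxmor[OF *(2)]] by simp
  next
    case (monic_face n' d' j c)
    then have "f = cmp m (face n j c) (cmp m d' g)"
      using * boxmor_cmp_assoc[OF epi_boxmor[OF *(2)]] by simp
    moreover have "boxmor A m (n - 1) (cmp m d' g)"
      using boxmor_comp[OF epi_boxmor[OF *(2)] monic_boxmor[OF monic_face(3)]] monic_face by simp
    ultimately show ?thesis using assms(2) const_coord_face[of j n] monic_face by simp
  qed
qed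

lemma not_const_section:
  assumes "boxmor A m n f" "\<not> const_coord m n f"
  obtains d where "monic n m d" "cmp n f d = idbox n"
  using epi_section[OF not_const_epi[OF assms]] by auto

lemma not_const_le:
  assumes "boxmor A m n f" "\<not> const_coord m n f" shows "n \<le> m"
  using epi_le[OF not_const_epi[OF assms]] .

lemma not_const_eq:
  assumes "boxmor A n n f" "\<not> const_coord n n f" shows "f = idbox n"
  using not_const_epi[OF assms]
proof cases
  case epi_id then show ?thesis .
next
  case (epi_elem m s g) then show ?thesis using epi_le by fastforce
qed

lemma idbox_not_const: "\<not> const_coord n n (idbox n)"
proof
  assume "const_coord n n (idbox n)"
  then obtain j c where *: "1 \<le> j" "j \<le> n"
    and "\<forall>xs. length xs = n \<longrightarrow> idbox n xs ! (j - 1) = c"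
    unfolding const_coord_def by blast
  then have *: "1 \<le> j" "j \<le> n" "\<And>xs. length xs = n \<Longrightarrow> xs ! (j - 1) = c"
    by simp_all
  have "replicate n (\<not> c) ! (j - 1) = c" using *(3)[of "replicate n (\<not> c)"] by simp
  then show False using *(1,2) by simp
qed

lemma section_not_const: "boxmor A n m d \<Longrightarrow> cmp n f d = idbox n \<Longrightarrow> \<not> const_coord m n f"
  using idbox_not_const const_coord_cmp by metis

lemma elementary_degen: "p < i \<Longrightarrow> i \<le> m \<Longrightarrow> elementary A p m (degen m i)"
  unfolding elementary_def by blast

lemma elementary_conn: "e \<in> A \<Longrightarrow> p < i \<Longrightarrow> i < m \<Longrightarrow> elementary A p m (conn m i e)"
  unfolding elementary_def by blast

lemma elementary_0_iff: "elementary A 0 m s \<longleftrightarrow> (\<exists>i. 1 \<le> i \<and> i \<le> m \<and> s = degen m i) \<or>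
    (\<exists>i e. e \<in> A \<and> 1 \<le> i \<and> i < m \<and> s = conn m i e)"
  by (simp add: elementary_def Suc_le_eq)

lemma face_degen_update: "length xs = m \<Longrightarrow> 1 \<le> i \<Longrightarrow> i \<le> m \<Longrightarrow> face m i c (degen m i xs) = xs[i - 1 := c]"
  by (rule nth_equalityI) (auto simp: face_nth degen_nth nth_list_update)

lemma face_conn_update:
  "length xs = m \<Longrightarrow> 1 \<le> i \<Longrightarrow> i < m \<Longrightarrow>
   face m i c (conn m i e xs) = xs[i - 1 := c, i := bin e (xs ! (i - 1)) (xs ! i)]"
  by (cases i, simp, rule nth_equalityI, simp)
    (simp add: face_nth conn_nth nth_list_update less_Suc_eq_le, intro conjI impI; linarith?)

lemma face_conn_update':
  "length xs = m \<Longrightarrow> 1 \<le> i \<Longrightarrow> i < m \<Longrightarrow>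
   face m (Suc i) c (conn m i e xs) = xs[i - 1 := bin e (xs ! (i - 1)) (xs ! i), i := c]"
  by (cases i, simp, rule nth_equalityI, simp)
    (simp add: face_nth conn_nth nth_list_update less_Suc_eq_le, intro conjI impI; linarith?)

text \<open>One absorbing entry already fixes the merged value, so the other one may be reset to the
  neutral value.\<close>

lemma conn_update_absorbing:
  assumes "length xs = m" "1 \<le> i" "i < m" "xs ! (i - 1) = (\<not> e)" "xs ! i = (\<not> e)" "q = i - 1 \<or> q = i"
  shows "conn m i e (xs[q := e]) = conn m i e xs"
  using assms(6)
proof
  assume q: "q = i - 1"
  show ?thesis unfolding q
    by (rule nth_equalityI) (use assms(1-5) in \<open>simp_all add: conn_nth nth_list_update\<close>)
next
  assume q: "q = i"
  show ?thesis unfolding q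
    by (rule nth_equalityI) (use assms(1-5) in \<open>simp_all add: conn_nth nth_list_update\<close>)
qed

text \<open>Induction on the source dimension. Each map factors through a quotient that has a face
  as a section; restriction to this face preserves all hypotheses, so the two maps agree on that
  hyperplane. For a degeneracy such hyperplanes cover the cube. For two connections the points left
  over are moved onto these hyperplanes by changes that the maps do not notice.\<close>

theorem sections_determine:
  assumes "boxmor B m k f" "boxmor B m k g" "\<not> const_coord m k f" "\<not> const_coord m k g"
    and "\<And>d. monic k m d \<Longrightarrow> cmp k f d = idbox k \<longleftrightarrow> cmp k g d = idbox k"
  shows "f = g"
  using assms
proof (induction m arbitrary: f g)
  case 0
  then have "k = 0" using not_const_le by fastforce
  then show ?case using not_const_eq 0 by metis
next
  case (Suc m)
  \<comment> \<open>The restriction of \<open>f'\<close> is not constant in a coordinate because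
    \<open>f'\<close> is recovered from it through \<open>s\<close>. For \<open>g'\<close> this
    follows from a section of the restricted \<open>f'\<close>, which is also one of the restricted
    \<open>g'\<close>.\<close>
  have agree: "cmp m f' (face (Suc m) t c) = cmp m g' (face (Suc m) t c)"
    if t: "1 \<le> t" "t \<le> Suc m" and s: "elementary B 0 (Suc m) s" "factors (Suc m) s f'" "cmp m s (face (Suc m) t c) = idbox m"
      and f': "boxmor B (Suc m) k f'" "\<not> const_coord (Suc m) k f'" and g': "boxmor B (Suc m) k g'"
      and sec: "\<And>d. monic k (Suc m) d \<Longrightarrow> cmp k f' d = idbox k \<longleftrightarrow> cmp k g' d = idbox k" for f' g' t c s
  proof (rule Suc.IH)
    have face: "boxmor B m (Suc m) (face (Suc m) t c)" using boxmor_face[OF t, of B c] by simp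
    have eq: "f' = cmp (Suc m) (cmp m f' (face (Suc m) t c)) s"
      using factors_factor[OF s(2) f'(1) elementary_boxmor[OF s(1)], of B "face (Suc m) t c"] face s(3) by simp
    show bf: "boxmor B m k (cmp m f' (face (Suc m) t c))" using face f'(1) boxmor_comp by blast
    show bg: "boxmor B m k (cmp m g' (face (Suc m) t c))" using face g' boxmor_comp by blast
    show nf: "\<not> const_coord m k (cmp m f' (face (Suc m) t c))"
      using const_coord_cmp[OF _ elementary_boxmor[OF s(1)]] eq f'(2) by fastforce
    show sec': "cmp k (cmp m f' (face (Suc m) t c)) d = idbox k \<longleftrightarrow> cmp k (cmp m g' (face (Suc m) t c)) d = idbox k"
      if d: "monic k m d" for d
      using sec[OF monic_face[OF d t]] boxmor_cmp_assoc[OF monic_boxmor[OF d]] by simp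
    obtain d where "monic k m d" "cmp k (cmp m f' (face (Suc m) t c)) d = idbox k"
      using not_const_section[OF bf nf] by blast
    then show "\<not> const_coord m k (cmp m g' (face (Suc m) t c))"
      using sec' section_not_const monic_boxmor by blast
  qed
  have agree': "f' xs = g' xs"
    if "1 \<le> t" "t \<le> Suc m" "elementary B 0 (Suc m) s" "factors (Suc m) s f'" "cmp m s (face (Suc m) t c) = idbox m"
      "boxmor B (Suc m) k f'" "\<not> const_coord (Suc m) k f'" "boxmor B (Suc m) k g'"
      "\<And>d. monic k (Suc m) d \<Longrightarrow> cmp k f' d = idbox k \<longleftrightarrow> cmp k g' d = idbox k"
      and xs: "length xs = Suc m" "xs ! (t - 1) = c" for f' g' t c s xs
  proof -
    have "face (Suc m) t c (degen (Suc m) t xs) = xs"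
      using face_degen_update[OF xs(1) that(1,2)] xs(2) list_update_id[of xs "t - 1"] by simp
    moreover have "length (degen (Suc m) t xs) = m" using that by simp
    ultimately show ?thesis
      using fun_cong[OF agree[OF that(1-9)], of "degen (Suc m) t xs"] by simp
  qed
  have degen: "f' = g'"
    if "1 \<le> i" "i \<le> Suc m" "factors (Suc m) (degen (Suc m) i) f'"
      "boxmor B (Suc m) k f'" "\<not> const_coord (Suc m) k f'" "boxmor B (Suc m) k g'"
      "\<And>d. monic k (Suc m) d \<Longrightarrow> cmp k f' d = idbox k \<longleftrightarrow> cmp k g' d = idbox k" for f' g' i
  proof (rule boxmor_eqI[OF that(4,6)])
    fix xs :: "bool list" assume xs: "length xs = Suc m"
    have "elementary B 0 (Suc m) (degen (Suc m) i)" using that by (intro elementary_degen) auto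
    then show "f' xs = g' xs"
      using agree'[OF that(1,2) _ that(3) _ that(4-7) xs, of "xs ! (i - 1)"]
        degen_face_same[OF that(1,2)] by simp
  qed
  have conn: "f' xs = g' xs"
    if "1 \<le> i" "i < Suc m" "e \<in> B" "factors (Suc m) (conn (Suc m) i e) f'"
      "boxmor B (Suc m) k f'" "\<not> const_coord (Suc m) k f'" "boxmor B (Suc m) k g'"
      "\<And>d. monic k (Suc m) d \<Longrightarrow> cmp k f' d = idbox k \<longleftrightarrow> cmp k g' d = idbox k"
      and xs: "length xs = Suc m" "xs ! (i - 1) = e \<or> xs ! i = e" for f' g' i e xs
  proof -
    have s: "elementary B 0 (Suc m) (conn (Suc m) i e)" using that by (intro elementary_conn) auto
    from xs(2) obtain t where t: "t = i \<or> t = i + 1" "xs ! (t - 1) = e"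
      by (metis add_diff_cancel_right')
    then show ?thesis
      using agree'[OF _ _ s that(4) _ that(5-8) xs(1), of t e]
        conn_face_same[OF that(1,2) t(1)] that by auto
  qed
  have sec: "cmp k g d = idbox k \<longleftrightarrow> cmp k f d = idbox k" if "monic k (Suc m) d" for d
    using Suc.prems(5)[OF that] by simp
  show ?case
  using Suc.prems(1)
  proof (cases rule: boxmor_cases_degenerate)
    case const then show ?thesis using Suc.prems by simp
  next
    case id then show ?thesis using not_const_eq Suc.prems by metis
  next
    case fd: (degen s)
    show ?thesis
    using Suc.prems(2)
  proof (cases rule: boxmor_cases_degenerate)
      case const then show ?thesis using Suc.prems by simp
    next
      case id then show ?thesis using not_const_eq Suc.prems by metis
    next
      case gd: (degen s')
      consider i where "1 \<le> i" "i \<le> Suc m" "s = degen (Suc m) i"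
        | i where "1 \<le> i" "i \<le> Suc m" "s' = degen (Suc m) i"
        | i e j e' where "1 \<le> i" "i < Suc m" "s = conn (Suc m) i e" "e \<in> B"
            "1 \<le> j" "j < Suc m" "s' = conn (Suc m) j e'" "e' \<in> B"
        using fd(1) gd(1) unfolding elementary_0_iff by blast
      then show ?thesis
      proof cases
        case 1
        show ?thesis by (rule degen[OF 1(1,2) fd(2)[unfolded 1(3)] Suc.prems(1,3,2,5)])
      next
        case 2
        show ?thesis by (rule degen[OF 2(1,2) gd(2)[unfolded 2(3)] Suc.prems(2,4,1) sec, symmetric])
      next
        case 3
        show ?thesis
        proof (rule boxmor_eqI[OF Suc.prems(1,2)])
          fix xs :: "bool list" assume xs: "length xs = Suc m"
          note fc = fd(2)[unfolded 3(3)] and gc = gd(2)[unfolded 3(7)]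
          have A: "f ys = g ys" if "length ys = Suc m" "ys ! (i - 1) = e \<or> ys ! i = e" for ys
            using conn[OF 3(1,2,4) fc Suc.prems(1,3,2,5) that] by simp
          have B: "f ys = g ys" if "length ys = Suc m" "ys ! (j - 1) = e' \<or> ys ! j = e'" for ys
            using conn[OF 3(5,6,8) gc Suc.prems(2,4,1) sec that] by simp
          have F: "f (ys[q := e]) = f ys"
            if "length ys = Suc m" "ys ! (i - 1) = (\<not> e)" "ys ! i = (\<not> e)" "q = i - 1 \<or> q = i" for ys q
            using conn_update_absorbing[OF that(1) 3(1,2) that(2-4)] fc that(1)
            unfolding factors_def by (metis length_list_update)
          have G: "g (ys[q := e']) = g ys"
            if "length ys = Suc m" "ys ! (j - 1) = (\<not> e')" "ys ! j = (\<not> e')" "q = j - 1 \<or> q = j" for ys q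
            using conn_update_absorbing[OF that(1) 3(5,6) that(2-4)] gc that(1)
            unfolding factors_def by (metis length_list_update)
          show "f xs = g xs"
          proof (cases "xs ! (i - 1) = e \<or> xs ! i = e \<or> xs ! (j - 1) = e' \<or> xs ! j = e'")
            case True then show ?thesis using A[OF xs] B[OF xs] by blast
          next
            case False
            show ?thesis
            proof (cases "\<exists>q. (q = i - 1 \<or> q = i) \<and> (q = j - 1 \<or> q = j)")
              case True
              then obtain q where q: "q = i - 1 \<or> q = i" "q = j - 1 \<or> q = j" by blast
              \<comment> \<open>The entry at the shared coordinate is both \<open>\<not> e\<close>
                and \<open>\<not> e'\<close>.\<close>
              then have ee: "e' = e" using False by auto
              have "f xs = f (xs[q := e])" using F[OF xs _ _ q(1)] False by auto
              also have "\<dots> = g (xs[q := e])" using q xs 3 by (intro A) auto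
              also have "\<dots> = g xs" using G[OF xs _ _ q(2)] False ee by auto
              finally show ?thesis .
            next
              case disj: False
              \<comment> \<open>The merged pairs are disjoint, so one entry of each pair is changed
                to its neutral value. The route from \<open>xs\<close> through \<open>w\<close>, the
                doubly changed point and \<open>y\<close> back to \<open>xs\<close> alternates
                changes invisible to one of the maps with points where both maps agree.\<close>
              define y w where "y = xs[i := e]" and "w = xs[j := e']"
              have ne: "i \<noteq> j" "i \<noteq> j - 1" "i - 1 \<noteq> j" "i - 1 \<noteq> j - 1" using disj by blast+
              have z: "y[j := e'] = w[i := e]"
                using ne by (simp add: y_def w_def list_update_swap)
              have "g xs = g w" using G[OF xs, of j] False by (auto simp: w_def)
              also have "\<dots> = f w" using B[of w] xs 3 by (simp add: w_def)
              also have "\<dots> = f (w[i := e])"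
                using F[of w i] False ne xs 3 by (auto simp: w_def nth_list_update)
              also have "\<dots> = g (w[i := e])" using A[of "w[i := e]"] xs 3 by (simp add: w_def)
              also have "\<dots> = g y" unfolding z[symmetric]
                using G[of y j] False ne xs 3 by (auto simp: y_def nth_list_update)
              also have "\<dots> = f y" using A[of y] xs 3 by (simp add: y_def)
              also have "\<dots> = f xs" using F[OF xs, of i] False by (auto simp: y_def)
              finally show ?thesis by simp
            qed
          qed
        qed
      qed
    qed
  qed
qed

section \<open>Commuting idempotents\<close>

definition retracted :: "nat \<Rightarrow> nat \<Rightarrow> cubemap \<Rightarrow> nat \<Rightarrow> bool \<Rightarrow> bool" where
  "retracted p m s t c \<longleftrightarrow> p < t \<and> t \<le> m \<and> cmp (m - 1) s (face m t c) = idbox (m - 1)"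

text \<open>Sections are chosen to suit the pair: beside a connection, a degeneracy is split at the
  absorbing value \<open>\<not> a\<close>, and a connection is split so that its merged value lands
  in the coordinate nearest to the other quotient. An overlap is then settled by absorption or by
  associativity.\<close>

lemma elementary_idempotents_commute:
  assumes "elementary A p m s" "elementary A p m s'" "A \<subseteq> {a}" "s \<noteq> s'"
  shows "\<exists>t c t' c'. retracted p m s t c \<and> retracted p m s' t' c' \<and>
    (\<forall>xs. length xs = m \<longrightarrow>
      face m t c (s (face m t' c' (s' xs))) = face m t' c' (s' (face m t c (s xs))))"
    (is "?P s s'")
proof -
  have sym: "?P r r' \<Longrightarrow> ?P r' r" for r r' by metis
  have degen_degen: "?P (degen m i) (degen m j)" if "p < i" "i \<le> m" "p < j" "j \<le> m" "i \<noteq> j" for i j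
    using that degen_face_same[of i m True] degen_face_same[of j m True]
    by (intro exI[of _ i] exI[of _ True] exI[of _ j])
      (auto simp: face_degen_update retracted_def list_update_swap)
  have degen_conn_le: "?P (degen m i) (conn m j a)" if "p < i" "i \<le> m" "p < j" "j < m" "i \<le> j" for i j
  proof -
    have "face m i (\<not> a) (degen m i (face m (Suc j) a (conn m j a xs))) =
          face m (Suc j) a (conn m j a (face m i (\<not> a) (degen m i xs)))" if "length xs = m" for xs
      using that \<open>p < i\<close> \<open>i \<le> m\<close> \<open>p < j\<close> \<open>j < m\<close> \<open>i \<le> j\<close>
      by (simp add: face_degen_update face_conn_update', intro nth_equalityI)
        (auto simp: nth_list_update)
    then show ?thesis
      using that degen_face_same[of i m "\<not> a"] conn_face_same[of j m "Suc j" a] unfolding retracted_def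
      by (intro exI[of _ i] exI[of _ "\<not> a"] exI[of _ "Suc j"] exI[of _ a]) auto
  qed
  have degen_conn_gt: "?P (degen m i) (conn m j a)" if "p < i" "i \<le> m" "p < j" "j < m" "j < i" for i j
  proof -
    have "face m i (\<not> a) (degen m i (face m j a (conn m j a xs))) =
          face m j a (conn m j a (face m i (\<not> a) (degen m i xs)))" if "length xs = m" for xs
      using that \<open>p < i\<close> \<open>i \<le> m\<close> \<open>p < j\<close> \<open>j < m\<close> \<open>j < i\<close>
      by (simp add: face_degen_update face_conn_update, intro nth_equalityI)
        (auto simp: nth_list_update)
    then show ?thesis
      using that degen_face_same[of i m "\<not> a"] conn_face_same[of j m j a] unfolding retracted_def
      by (intro exI[of _ i] exI[of _ "\<not> a"] exI[of _ j] exI[of _ a]) auto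
  qed
  have conn_conn: "?P (conn m i a) (conn m j a)" if "p < i" "i < m" "p < j" "j < m" "i < j" for i j
  proof -
    have "face m i a (conn m i a (face m (Suc j) a (conn m j a xs))) =
          face m (Suc j) a (conn m j a (face m i a (conn m i a xs)))" if "length xs = m" for xs
      using that \<open>p < i\<close> \<open>i < m\<close> \<open>p < j\<close> \<open>j < m\<close> \<open>i < j\<close>
      by (simp add: face_conn_update face_conn_update', intro nth_equalityI)
        (auto simp: nth_list_update bin_assoc)
    then show ?thesis
      using that conn_face_same[of i m i a] conn_face_same[of j m "Suc j" a] unfolding retracted_def
      by (intro exI[of _ i] exI[of _ a] exI[of _ "Suc j"]) auto
  qed
  have degen_conn: "?P (degen m i) (conn m j a)" if "p < i" "i \<le> m" "p < j" "j < m" for i j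
    using degen_conn_le[OF that] degen_conn_gt[OF that] by (cases "i \<le> j") auto
  from assms(1-3) consider
      (dd) i j where "p < i" "i \<le> m" "p < j" "j \<le> m" "s = degen m i" "s' = degen m j"
    | (dc) i j where "p < i" "i \<le> m" "p < j" "j < m" "s = degen m i" "s' = conn m j a"
    | (cd) i j where "p < i" "i \<le> m" "p < j" "j < m" "s' = degen m i" "s = conn m j a"
    | (cc) i j where "p < i" "i < m" "p < j" "j < m" "s = conn m i a" "s' = conn m j a"
    unfolding elementary_def by (elim disjE exE conjE) (metis singletonD subsetD)+
  then show ?thesis
  proof cases
    case dd then show ?thesis using \<open>s \<noteq> s'\<close> degen_degen by blast
  next
    case dc then show ?thesis using degen_conn by blast
  next
    case cd
    have "?P s' s" unfolding cd(5,6) by (rule degen_conn[OF cd(1-4)])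
    then show ?thesis by (rule sym)
  next
    case cc
    consider "i < j" | "j < i" using \<open>s \<noteq> s'\<close> cc by force
    then show ?thesis
    proof cases
      case 1 show ?thesis unfolding cc(5,6) by (rule conn_conn[OF cc(1-4) 1])
    next
      case 2
      have "?P s' s" unfolding cc(5,6) by (rule conn_conn[OF cc(3,4,1,2) 2])
      then show ?thesis by (rule sym)
    qed
  qed
qed

section \<open>Degeneracies below a special coordinate\<close>

definition low :: "bool set \<Rightarrow> bool \<Rightarrow> nat \<Rightarrow> nat \<Rightarrow> cubemap \<Rightarrow> bool" where
  "low B e p m s \<longleftrightarrow> p \<le> m \<and> ((\<exists>i. 1 \<le> i \<and> i \<le> p \<and> s = degen m i) \<or>
     (\<exists>i e'. e' \<in> B \<and> 1 \<le> i \<and> i + 1 < p \<and> s = conn m i e') \<or>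
     (2 \<le> p \<and> s = conn m (p - 1) e))"

lemma low_face:
  assumes "low B e p m s" "p < t" "t \<le> m"
  obtains s' where "low B e p (m - 1) s'" "cmp (m - 1) s (face m t c) = cmp (m - 1) (face (m - 1) (t - 1) c) s'"
  using assms(1) unfolding low_def[of B e p m]
proof (elim conjE disjE exE)
  fix i assume "p \<le> m" "1 \<le> i" "i \<le> p" "s = degen m i"
  then show thesis using assms degen_face_greater[of i t m c]
    by (intro that[of "degen (m - 1) i"]) (auto simp: low_def)
next
  fix i e' assume "p \<le> m" "e' \<in> B" "1 \<le> i" "i + 1 < p" "s = conn m i e'"
  then show thesis using assms conn_face_greater[of i t m e' c]
    by (intro that[of "conn (m - 1) i e'"]) (auto simp: low_def)
next
  assume "p \<le> m" "2 \<le> p" "s = conn m (p - 1) e"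
  then show thesis using assms conn_face_greater[of "p - 1" t m e c]
    by (intro that[of "conn (m - 1) (p - 1) e"]) (auto simp: low_def)
qed

text \<open>Used contrapositively: if the composite of \<open>S\<close> with the connection at
  \<open>p\<close> factors through no low quotient, then neither does \<open>S\<close>.\<close>

lemma low_conn:
  assumes "low B e p m s" "1 \<le> p"
  obtains s' b where "low B e p (m + 1) s'" "cmp (m + 1) s (conn (m + 1) p e) = cmp (m + 1) b s'"
  using assms(1) unfolding low_def[of B e p m]
proof (elim conjE disjE exE)
  fix i assume i: "p \<le> m" "1 \<le> i" "i \<le> p" "s = degen m i"
  then have "low B e p (m + 1) (degen (m + 1) i)" by (auto simp: low_def)
  moreover have "\<exists>b. cmp (m + 1) s (conn (m + 1) p e) = cmp (m + 1) b (degen (m + 1) i)"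
    using i degen_conn_less[of i p m e] degen_conn_same[of p m e] by (cases "i = p") auto
  ultimately show thesis using that by blast
next
  fix i e' assume i: "p \<le> m" "e' \<in> B" "1 \<le> i" "i + 1 < p" "s = conn m i e'"
  then have "low B e p (m + 1) (conn (m + 1) i e')" unfolding low_def by (metis le_add1 order.trans)
  then show thesis using that conn_conn_less[of i p m e' e] i by blast
next
  assume p: "p \<le> m" "2 \<le> p" "s = conn m (p - 1) e"
  then have "low B e p (m + 1) (conn (m + 1) (p - 1) e)" by (auto simp: low_def)
  then show thesis using that conn_conn_assoc[of "p - 1" m e] p by auto
qed

lemma elementary_conn_right:
  assumes "elementary A p m s" "1 \<le> p"
  obtains s' where "elementary A p (m + 1) s'" "cmp (m + 1) s (conn (m + 1) p e) = cmp (m + 1) (conn m p e) s'"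
  using assms(1) unfolding elementary_def[of A p m]
proof (elim disjE exE conjE)
  fix i assume i: "p < i" "i \<le> m" "s = degen m i"
  then show thesis using degen_conn_greater[of p i m e] assms
    by (intro that[of "degen (m + 1) (i + 1)"] elementary_degen) auto
next
  fix i e' assume i: "e' \<in> A" "p < i" "i < m" "s = conn m i e'"
  then show thesis using conn_conn_greater[of p i m e' e] assms
    by (intro that[of "conn (m + 1) (i + 1) e'"] elementary_conn) auto
qed

section \<open>Clashes between connections at equal or adjacent positions\<close>

lemma factors_update: "factors m s T \<Longrightarrow> length xs = m \<Longrightarrow> length ys = m \<Longrightarrow> s xs = s ys \<Longrightarrow> T xs = T ys"
  unfolding factors_def by blast

lemma conn_swap:
  assumes "length xs = m" "length ys = m" "1 \<le> i" "i < m"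
    "\<And>k. k < m \<Longrightarrow> k \<noteq> i - 1 \<Longrightarrow> k \<noteq> i \<Longrightarrow> xs ! k = ys ! k"
    "bin e (xs ! (i - 1)) (xs ! i) = bin e (ys ! (i - 1)) (ys ! i)"
  shows "conn m i e xs = conn m i e ys"
  by (rule nth_equalityI) (use assms in \<open>simp_all add: conn_nth\<close>)

lemma factors_degenI:
  assumes "\<And>xs. length xs = m \<Longrightarrow> T (xs[i - 1 := True]) = T (xs[i - 1 := False])" "1 \<le> i" "i \<le> m"
  shows "factors m (degen m i) T"
  unfolding factors_def
proof (intro allI impI)
  fix xs ys :: "bool list"
  assume *: "length xs = m" "length ys = m" "degen m i xs = degen m i ys"
  have T: "T zs = T (zs[i - 1 := True])" if "length zs = m" for zs
    using assms(1)[OF that] by (cases "zs ! (i - 1)") (metis list_update_id)+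
  have "xs[i - 1 := True] = ys[i - 1 := True]"
    using * face_degen_update[of _ m i True] assms(2,3) by metis
  then show "T xs = T ys" using T * by metis
qed

text \<open>Whatever the entry at the second merged coordinate is, it is absorbing for one of the
  two kinds, and through that kind the first coordinate has no influence.\<close>

lemma factors_conn_both:
  assumes "factors m (conn m i e) T" "factors m (conn m i (\<not> e)) T" "1 \<le> i" "i < m"
  shows "factors m (degen m i) T"
proof (rule factors_degenI)
  fix xs :: "bool list" assume xs: "length xs = m"
  have "conn m i (\<not> (xs ! i)) (xs[i - 1 := True]) = conn m i (\<not> (xs ! i)) (xs[i - 1 := False])"
    using assms xs by (intro conn_swap) (auto simp: nth_list_update bin_def)
  moreover have "factors m (conn m i (\<not> (xs ! i))) T"
    using assms by (cases "xs ! i"; cases e) auto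
  ultimately show "T (xs[i - 1 := True]) = T (xs[i - 1 := False])"
    using factors_update xs length_list_update by metis
qed (use assms in auto)

text \<open>The connection at \<open>i + 1\<close> allows a middle entry \<open>\<not> e\<close> to
  be exchanged for \<open>e\<close>, at the cost of changing the third. But \<open>e\<close> is
  absorbing for kind \<open>\<not> e\<close>, so the first coordinate has no influence.\<close>

lemma factors_conn_adjacent:
  assumes "factors m (conn m i (\<not> e)) T" "factors m (conn m (i + 1) e) T" "1 \<le> i" "i + 1 < m"
  shows "factors m (degen m i) T"
proof (rule factors_degenI)
  fix xs :: "bool list" assume xs: "length xs = m"
  define S where "S a b c = T (xs[i - 1 := a, i := b, i + 1 := c])" for a b c
  have ne: "i - 1 \<noteq> i" "i - 1 \<noteq> i + 1" "i \<noteq> i + 1" using assms by auto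
  have 1: "S a b c = S a' b' c" if "bin (\<not> e) a b = bin (\<not> e) a' b'" for a b c a' b'
    unfolding S_def using assms xs that ne
    by (intro factors_update[OF assms(1)] conn_swap) (auto simp: nth_list_update)
  have 2: "S a b c = S a b' c'" if "bin e b c = bin e b' c'" for a b c b' c'
    unfolding S_def using assms xs that ne
    by (intro factors_update[OF assms(2)] conn_swap) (auto simp: nth_list_update)
  have "S a (\<not> e) c = S a e (\<not> e)" for a c by (rule 2) simp
  moreover have "S True e c = S False e c" for c by (rule 1) (simp add: bin_def)
  ultimately have S: "S True b c = S False b c" for b c
    by (cases "b = e") (simp, metis (full_types))
  have "xs[i - 1 := a] = xs[i - 1 := a, i := xs ! i, i + 1 := xs ! (i + 1)]" for a
    using ne by (metis list_update_id nth_list_update_neq)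
  then show "T (xs[i - 1 := True]) = T (xs[i - 1 := False])"
    using S[of "xs ! i" "xs ! (i + 1)"] unfolding S_def by metis
qed (use assms in auto)

text \<open>An old connection at \<open>p\<close> or \<open>p - 1\<close> would clash with the new
  one at \<open>p\<close> and produce a degeneracy at \<open>p\<close> or \<open>p - 1\<close>,
  which is low. All remaining candidates are low or lie above \<open>p\<close>. Hence
  \<open>T\<close> is not degenerate over \<open>A\<close>, and \<open>p\<close> is its first new
  connection.\<close>

lemma first_conn:
  assumes "factors m (conn m p e) T" "1 \<le> p" "p < m" "A \<subseteq> {\<not> e}" "insert e A \<subseteq> B"
    and "\<nexists>s. low B e p m s \<and> factors m s T" "\<nexists>s. elementary A p m s \<and> factors m s T"
  shows "\<nexists>s. elementary A 0 m s \<and> factors m s T" and "\<And>i. 1 \<le> i \<Longrightarrow> i < p \<Longrightarrow> \<not> factors m (conn m i e) T"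
proof -
  have D: "\<not> factors m (degen m i) T" if "1 \<le> i" "i \<le> p" for i
    using assms(3,6) that unfolding low_def by (metis less_imp_le)
  have C: "\<not> factors m (conn m i e') T" if "1 \<le> i" "i + 1 < p" "e' \<in> B" for i e'
    using assms(3,6) that unfolding low_def by (metis less_imp_le)
  have C': "\<not> factors m (conn m (p - 1) e) T" if "2 \<le> p"
    using assms(3,6) that unfolding low_def by (metis less_imp_le)
  show "\<not> factors m (conn m i e) T" if "1 \<le> i" "i < p" for i
  proof (cases "i + 1 < p")
    case True then show ?thesis using C[of i e] that assms(5) by simp
  next
    case False
    then have "i = p - 1" "2 \<le> p" using that by auto
    then show ?thesis using C' by simp
  qed
  show "\<nexists>s. elementary A 0 m s \<and> factors m s T"
  proof
    assume "\<exists>s. elementary A 0 m s \<and> factors m s T"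
    then obtain s where s: "elementary A 0 m s" "factors m s T" by blast
    from s(1) consider i where "1 \<le> i" "i \<le> m" "s = degen m i"
      | i e' where "e' \<in> A" "1 \<le> i" "i < m" "s = conn m i e'"
      unfolding elementary_0_iff by blast
    then show False
    proof cases
      case 1 then show ?thesis using D[of i] s(2) assms(7) elementary_degen[of p i m A] by (cases "i \<le> p") auto
    next
      case 2
      then have e': "e' = (\<not> e)" using assms(4) by auto
      consider "p < i" | "i = p" | "i + 1 = p" | "i + 1 < p" by linarith
      then show ?thesis
      proof cases
        case 1 then show ?thesis using elementary_conn[of e' A p i m] assms(7) s(2) 2 by auto
      next
        case same: 2 then show ?thesis using factors_conn_both[OF assms(1)] s(2) D 2 e' by auto
      next
        case 3 then show ?thesis using factors_conn_adjacent[of m i e T] assms s(2) D[of i] 2 e' by auto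
      next
        case 4 then show ?thesis using C s(2) 2 assms(5) by auto
      qed
    qed
  qed
qed

section \<open>Filling conditions\<close>

abbreviation bd :: "'a mcset \<Rightarrow> nat \<Rightarrow> nat \<Rightarrow> bool \<Rightarrow> 'a \<Rightarrow> 'a" where
  "bd X n j c \<equiv> act X (n - 1) n (face n j c)"

lemma act_closed: "cset A X \<Longrightarrow> boxmor A m n f \<Longrightarrow> x \<in> cubes X n \<Longrightarrow> act X m n f x \<in> cubes X m"
  unfolding cset_def by (meson PiE_mem)

lemma act_id: "cset A X \<Longrightarrow> x \<in> cubes X n \<Longrightarrow> act X n n (idbox n) x = x"
  unfolding cset_def by simp

lemma act_cmp:
  "cset A X \<Longrightarrow> boxmor A k m f \<Longrightarrow> boxmor A m n g \<Longrightarrow> x \<in> cubes X n \<Longrightarrow>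
   act X k n (cmp k g f) x = act X k m f (act X m n g x)"
  unfolding cset_def by (simp add: compose_eq)

lemma bd_closed: "cset A X \<Longrightarrow> x \<in> cubes X n \<Longrightarrow> 1 \<le> j \<Longrightarrow> j \<le> n \<Longrightarrow> bd X n j c x \<in> cubes X (n - 1)"
  by (rule act_closed[OF _ boxmor_face])

lemma bd_bd:
  assumes "cset A X" "x \<in> cubes X n" "1 \<le> j" "j < k" "k \<le> n"
  shows "bd X (n - 1) j c (bd X n k c' x) = bd X (n - 1) (k - 1) c' (bd X n j c x)"
proof -
  have 1: "boxmor A (n - 1) n (face n k c')" "boxmor A (n - 1) n (face n j c)"
    using assms by (auto intro!: boxmor_face simp del: One_nat_def)
  have 2: "boxmor A (n - 2) (n - 1) (face (n - 1) j c)" "boxmor A (n - 2) (n - 1) (face (n - 1) (k - 1) c')"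
    using boxmor_face[of j "n - 1" A c] boxmor_face[of "k - 1" "n - 1" A c'] assms
    by (simp_all add: numeral_2_eq_2)
  have "n - 1 - 1 = n - 2" by simp
  then show ?thesis
    using act_cmp[OF assms(1) 2(1) 1(1) assms(2)] act_cmp[OF assms(1) 2(2) 1(2) assms(2)]
      face_face[OF assms(3-5), of c' c] by simp
qed

lemma act_degenerate_marked:
  assumes "mcset A X" "elementary A p m s" "x \<in> cubes X (m - 1)"
  shows "act X m (m - 1) s x \<in> marked X m"
proof -
  have "elementary A 0 m s" using elementary_le[OF assms(2)] by simp
  then have "degenerate A X m (act X m (m - 1) s x)"
    unfolding elementary_0_iff
  proof (elim disjE exE conjE)
    fix i assume "1 \<le> i" "i \<le> m" "s = degen m i"
    then show ?thesis using assms(3) unfolding degenerate_def by blast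
  next
    fix i e assume "e \<in> A" "1 \<le> i" "i < m" "s = conn m i e"
    moreover from this have "i \<le> m - 1" by simp
    ultimately show ?thesis using assms(3) unfolding degenerate_def by blast
  qed
  then show ?thesis using assms(1) unfolding mcset_def by blast
qed

lemma act_marked_degenerate:
  assumes "mcset A X" "elementary A 0 m s" "factors m s g" "boxmor A m n g" "x \<in> cubes X n"
  shows "act X m n g x \<in> marked X m"
proof -
  have X: "cset A X" using assms(1) by (simp add: mcset_def)
  obtain g' where g': "boxmor A (m - 1) n g'" "g = cmp m g' s" using elementary_factor[OF assms(2-4)] .
  show ?thesis
    using act_cmp[OF X elementary_boxmor[OF assms(2)] g'(1) assms(5)] g'(2)
      act_degenerate_marked[OF assms(1,2) act_closed[OF X g'(1) assms(5)]] by simp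
qed

text \<open>The condition on critical faces as a property of a given word, so that inductions can
  run over the word.\<close>

definition crit_word :: "nat \<Rightarrow> bool \<Rightarrow> (nat \<times> bool) list \<Rightarrow> bool" where
  "crit_word i e cs \<longleftrightarrow> \<not> ((i, e) \<in> set cs \<or> (i, \<not> e) \<in> set cs) \<and>
     \<not> (\<exists>j>i. (j, e) \<in> set cs \<and> (\<forall>k. i < k \<and> k < j \<longrightarrow> (k, \<not> e) \<in> set cs)) \<and>
     \<not> (\<exists>j<i. (j, e) \<in> set cs \<and> (\<forall>k. j < k \<and> k < i \<longrightarrow> (k, \<not> e) \<in> set cs))"

text \<open>For a coordinate adjacent to \<open>i\<close> the range of intermediate coordinates in
  the definition is empty. With \<open>q\<close> and \<open>q + 1\<close> the coordinates merged by
  a connection and \<open>i\<close> one of them, this is the information extracted from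
  criticality.\<close>

lemma crit_word_free:
  assumes "crit_word i e cs" "i = q \<or> i = q + 1"
  shows "i \<notin> fst ` set cs" "(q, e) \<notin> set cs" "(q + 1, e) \<notin> set cs"
proof -
  note * = assms(1)[unfolded crit_word_def]
  show "i \<notin> fst ` set cs"
  proof
    assume "i \<in> fst ` set cs"
    then obtain c where "(i, c) \<in> set cs" by auto
    then show False using * by (cases "c = e") auto
  qed
  show "(q, e) \<notin> set cs"
  proof
    assume h: "(q, e) \<in> set cs"
    then have "i = q + 1" using assms(2) * by auto
    then have "\<exists>j<i. (j, e) \<in> set cs \<and> (\<forall>k. j < k \<and> k < i \<longrightarrow> (k, \<not> e) \<in> set cs)"
      using h by (intro exI[of _ q]) auto
    then show False using * by blast
  qed
  show "(q + 1, e) \<notin> set cs"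
  proof
    assume h: "(q + 1, e) \<in> set cs"
    then have "i = q" using assms(2) * by auto
    then have "\<exists>j>i. (j, e) \<in> set cs \<and> (\<forall>k. i < k \<and> k < j \<longrightarrow> (k, \<not> e) \<in> set cs)"
      using h by (intro exI[of _ "q + 1"]) auto
    then show False using * by blast
  qed
qed

lemma critical_face_iff:
  "critical_face n i e m d \<longleftrightarrow>
     (\<exists>cs. face_word n cs \<and> m + length cs = n \<and> d = face_composite n cs \<and> crit_word i e cs)"
  unfolding critical_face_def crit_word_def by blast

lemma face_word_Cons:
  "face_word n ((c, d) # cs) \<longleftrightarrow> 1 \<le> c \<and> c \<le> n \<and> face_word (n - 1) cs \<and> (\<forall>t\<in>fst ` set cs. t < c)"
  unfolding face_word_def by fastforce

lemma face_composite_mon: "face_word n cs \<Longrightarrow> length cs \<le> n \<and> monic (n - length cs) n (face_composite n cs)"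
proof (induction cs arbitrary: n)
  case Nil
  then show ?case by (simp add: monic_id)
next
  case (Cons cd cs)
  obtain c d where cd: "cd = (c, d)" by force
  then have *: "1 \<le> c" "c \<le> n" "face_word (n - 1) cs" using Cons.prems face_word_Cons by auto
  then obtain n' where n: "n = Suc n'" by (cases n) auto
  show ?case using Cons.IH[OF *(3)] monic_face[of "n' - length cs" n' _ c d] * n cd by simp
qed

lemma face_composite_boxmor: "face_word n cs \<Longrightarrow> boxmor A (n - length cs) n (face_composite n cs)"
  using face_composite_mon monic_boxmor by blast

lemma act_face_composite_Cons:
  assumes "cset A X" "face_word n ((c, d) # cs)" "x \<in> cubes X n"
  shows "act X (n - length ((c, d) # cs)) n (face_composite n ((c, d) # cs)) x =
    act X (n - 1 - length cs) (n - 1) (face_composite (n - 1) cs) (bd X n c d x)"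
proof -
  have *: "1 \<le> c" "c \<le> n" "face_word (n - 1) cs" using assms(2) face_word_Cons by auto
  show ?thesis
    using act_cmp[OF assms(1) face_composite_boxmor[OF *(3)] boxmor_face[OF *(1,2)] assms(3)] by simp
qed

text \<open>
  The lifting properties against the two families of generators, expressed through faces only:
  \<open>a\<close> is a matching family of faces of an open box in \<open>X\<close> over the cube \<open>y\<close> of \<open>Y\<close>.
\<close>

definition fillable :: "'a mcset \<Rightarrow> 'b mcset \<Rightarrow> ('a, 'b) mcfun \<Rightarrow> bool" where
  "fillable X Y f \<longleftrightarrow> (\<forall>n i e y a.
     1 \<le> i \<longrightarrow> i \<le> n \<longrightarrow> y \<in> cubes Y n \<longrightarrow>
     (\<forall>j c. 1 \<le> j \<longrightarrow> j \<le> n \<longrightarrow> (j, c) \<noteq> (i, e) \<longrightarrow>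
        a j c \<in> cubes X (n - 1) \<and> f (n - 1) (a j c) = bd Y n j c y) \<longrightarrow>
     (\<forall>j k c c'. 1 \<le> j \<longrightarrow> j < k \<longrightarrow> k \<le> n \<longrightarrow> (j, c) \<noteq> (i, e) \<longrightarrow> (k, c') \<noteq> (i, e) \<longrightarrow>
        bd X (n - 1) j c (a k c') = bd X (n - 1) (k - 1) c' (a j c)) \<longrightarrow>
     (\<forall>cs. face_word n cs \<longrightarrow> crit_word i e cs \<longrightarrow>
        act Y (n - length cs) n (face_composite n cs) y \<in> marked Y (n - length cs)) \<longrightarrow>
     (\<forall>j c cs. face_word n ((j, c) # cs) \<longrightarrow> crit_word i e ((j, c) # cs) \<longrightarrow>
        act X (n - 1 - length cs) (n - 1) (face_composite (n - 1) cs) (a j c) \<in> marked X (n - 1 - length cs)) \<longrightarrow>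
     (\<exists>z \<in> marked X n. f n z = y \<and>
        (\<forall>j c. 1 \<le> j \<longrightarrow> j \<le> n \<longrightarrow> (j, c) \<noteq> (i, e) \<longrightarrow> bd X n j c z = a j c)))"

definition saturated :: "'a mcset \<Rightarrow> 'b mcset \<Rightarrow> ('a, 'b) mcfun \<Rightarrow> bool" where
  "saturated X Y f \<longleftrightarrow> (\<forall>n i e z.
     2 \<le> n \<longrightarrow> 1 \<le> i \<longrightarrow> i \<le> n \<longrightarrow> z \<in> cubes X n \<longrightarrow>
     (\<forall>cs. face_word n cs \<longrightarrow> crit_word i e cs \<longrightarrow>
        act X (n - length cs) n (face_composite n cs) z \<in> marked X (n - length cs)) \<longrightarrow>
     (\<forall>j c. 1 \<le> j \<longrightarrow> j \<le> n \<longrightarrow> (j, c) \<noteq> (i, e) \<longrightarrow> bd X n j c z \<in> marked X (n - 1)) \<longrightarrow>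
     bd Y n i e (f n z) \<in> marked Y (n - 1) \<longrightarrow> bd X n i e z \<in> marked X (n - 1))"

section \<open>Systems of cells\<close>

text \<open>The cells that must be marked. True cubes, with \<open>p = 0\<close>, are marked
  whenever they are degenerate over \<open>B\<close>; auxiliary ones for degeneracies and for the
  connection at \<open>p\<close> itself, which is what occurs among the critical faces of the boxes
  to be filled.\<close>

definition thin :: "bool set \<Rightarrow> bool \<Rightarrow> nat \<Rightarrow> nat \<Rightarrow> cubemap \<Rightarrow> bool" where
  "thin B e p m T \<longleftrightarrow> (\<exists>i. 1 \<le> i \<and> i \<le> m \<and> factors m (degen m i) T) \<or>
     (p = 0 \<and> (\<exists>s. elementary B 0 m s \<and> factors m s T)) \<or> (1 \<le> p \<and> p < m \<and> factors m (conn m p e) T)"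

lemma conn_face_cases:
  assumes T: "boxmor B m n T" and q: "1 \<le> q" "q < m" and factors: "factors m (conn m q e) T" and t: "1 \<le> t" "t \<le> m"
  shows "t < q \<Longrightarrow> factors (m - 1) (conn (m - 1) (q - 1) e) (cmp (m - 1) T (face m t c))"
    and "t = q \<or> t = q + 1 \<Longrightarrow> c = (\<not> e) \<Longrightarrow> factors (m - 1) (degen (m - 1) q) (cmp (m - 1) T (face m t c))"
    and "q + 1 < t \<Longrightarrow> factors (m - 1) (conn (m - 1) q e) (cmp (m - 1) T (face m t c))"
  using factors_square[OF factors boxmor_face[OF t]] conn_face_less[OF t(1) _ q(2)] conn_face_opp[OF q]
    conn_face_greater[OF q(1) _ t(2)] by blast+

text \<open>Covers the cells in \<open>X\<close> and their images in \<open>Y\<close>, so that the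
  markings of critical faces are verified once for both. \<open>good\<close> delimits the cells
  already available. A face in a direction at most \<open>p\<close> is a true cube, whence the reset
  of the parameter to 0.\<close>

locale cell_system =
  fixes A B :: "bool set" and e :: bool and n :: nat and Z :: "'a mcset"
    and G :: "nat \<Rightarrow> cubemap \<Rightarrow> nat \<Rightarrow> 'a" and good :: "nat \<Rightarrow> cubemap \<Rightarrow> nat \<Rightarrow> bool"
  assumes Z: "cset A Z"
    and eB: "e \<in> B"
    and good_boxmor: "good k S p \<Longrightarrow> boxmor B k n S"
    and good_face: "good k S p \<Longrightarrow> 1 \<le> t \<Longrightarrow> t \<le> k \<Longrightarrow>
      good (k - 1) (cmp (k - 1) S (face k t c)) (if t \<le> p then 0 else p)"
    and G_cube: "good k S p \<Longrightarrow> G k S p \<in> cubes Z k"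
    and G_face: "good k S p \<Longrightarrow> 1 \<le> t \<Longrightarrow> t \<le> k \<Longrightarrow>
      bd Z k t c (G k S p) = G (k - 1) (cmp (k - 1) S (face k t c)) (if t \<le> p then 0 else p)"
    and G_marked: "good k S p \<Longrightarrow> thin B e p k S \<Longrightarrow> G k S p \<in> marked Z k"
begin

abbreviation word_marked where
  "word_marked k cs S p \<equiv> act Z (k - length cs) k (face_composite k cs) (G k S p) \<in> marked Z (k - length cs)"

lemma word_marked_Nil: "good k S p \<Longrightarrow> thin B e p k S \<Longrightarrow> word_marked k [] S p"
  using act_id[OF Z G_cube] G_marked by simp

lemma word_marked_Cons:
  assumes "good k S p" "face_word k ((t, c) # cs)"
  shows "word_marked k ((t, c) # cs) S p \<longleftrightarrow>
    word_marked (k - 1) cs (cmp (k - 1) S (face k t c)) (if t \<le> p then 0 else p)"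
  using act_face_composite_Cons[OF Z assms(2) G_cube[OF assms(1)]] G_face[OF assms(1), of t c]
    assms(2) face_word_Cons by auto

text \<open>The directions of a word decrease. A face below \<open>s\<close> only lowers the index
  of the degeneracy by one, and that index stays above the rest of the word.\<close>

lemma word_marked_degen:
  assumes "good k S p" "factors k (degen k s) S" "1 \<le> s" "s \<le> k" "face_word k cs" "\<forall>t\<in>fst ` set cs. t < s"
  shows "word_marked k cs S p"
  using assms
proof (induction cs arbitrary: k S p s)
  case Nil
  then show ?case by (intro word_marked_Nil) (auto simp: thin_def)
next
  case (Cons tc cs)
  obtain t c where tc: "tc = (t, c)" by force
  have t: "1 \<le> t" "t < s" "t \<le> k" "face_word (k - 1) cs" "\<forall>u\<in>fst ` set cs. u < t"
    using Cons.prems(5,6) face_word_Cons tc by auto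
  have f: "factors (k - 1) (degen (k - 1) (s - 1)) (cmp (k - 1) S (face k t c))"
    using factors_square[OF Cons.prems(2) boxmor_face[OF t(1,3)] degen_face_less[OF t(1,2) Cons.prems(4)]] .
  have "word_marked (k - 1) cs (cmp (k - 1) S (face k t c)) (if t \<le> p then 0 else p)"
    using t Cons.prems(3,4) by (intro Cons.IH[OF good_face[OF Cons.prems(1) t(1,3)] f]) auto
  then show ?case using word_marked_Cons[OF Cons.prems(1)] Cons.prems(5) tc by simp
qed

text \<open>As for degeneracies; in addition, if \<open>p = s\<close> then the first face lies below
  \<open>p\<close> and resets the parameter to 0, where every connection of kind \<open>e\<close> is
  thin.\<close>

lemma word_marked_conn:
  assumes "good k S p" "factors k (conn k s e) S" "1 \<le> s" "s < k" "p = 0 \<or> p = s" "face_word k cs"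
    "\<forall>t\<in>fst ` set cs. t < s"
  shows "word_marked k cs S p"
  using assms
proof (induction cs arbitrary: k S p s)
  case Nil
  then show ?case using elementary_conn[OF eB, of 0 s k] by (intro word_marked_Nil) (auto simp: thin_def)
next
  case (Cons tc cs)
  obtain t c where tc: "tc = (t, c)" by force
  have t: "1 \<le> t" "t < s" "t \<le> k" "face_word (k - 1) cs" "\<forall>u\<in>fst ` set cs. u < t"
    using Cons.prems(6,7) face_word_Cons tc by auto
  have f: "factors (k - 1) (conn (k - 1) (s - 1) e) (cmp (k - 1) S (face k t c))"
    using factors_square[OF Cons.prems(2) boxmor_face[OF t(1,3)] conn_face_less[OF t(1,2) Cons.prems(4)]] .
  have "word_marked (k - 1) cs (cmp (k - 1) S (face k t c)) (if t \<le> p then 0 else p)"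
    using t Cons.prems(3-5) by (intro Cons.IH[OF good_face[OF Cons.prems(1) t(1,3)] f]) auto
  then show ?case using word_marked_Cons[OF Cons.prems(1)] Cons.prems(6) tc by simp
qed

text \<open>The word is read from its largest direction. Above \<open>q + 1\<close> the face still
  factors through the connection at \<open>q\<close>, and the induction goes on; at \<open>q\<close>
  or \<open>q + 1\<close> criticality forces the absorbing value, so the face is degenerate; below
  \<open>q\<close> the connection merely shifts. Goodness is assumed of the first face rather than
  of \<open>U\<close>, so that \<open>U\<close> may belong to a box that is about to be
  filled.\<close>

lemma word_marked_critical_Cons:
  assumes "boxmor B k n U" "good (k - 1) (cmp (k - 1) U (face k t c)) (if t \<le> p then 0 else p)"
    "factors k (conn k q e) U" "1 \<le> q" "q < k" "p = 0 \<or> p = q" "face_word k ((t, c) # cs)"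
    "i = q \<or> i = q + 1" "i \<notin> fst ` set ((t, c) # cs)" "(q, e) \<notin> set ((t, c) # cs)" "(q + 1, e) \<notin> set ((t, c) # cs)"
  shows "word_marked (k - 1) cs (cmp (k - 1) U (face k t c)) (if t \<le> p then 0 else p)"
  using assms
proof (induction cs arbitrary: k U p t c)
  case (Nil k U p t c)
  then have t: "1 \<le> t" "t \<le> k" using face_word_Cons by auto
  note cases = conn_face_cases[OF Nil.prems(1,4,5,3) t, of c]
  consider "t < q" | "t = q \<or> t = q + 1" | "q + 1 < t" by linarith
  then show ?case
  proof cases
    case 1
    then show ?thesis using cases(1) elementary_conn[OF eB, of 0 "q - 1" "k - 1"] Nil.prems(4-6) t
      by (intro word_marked_Nil Nil.prems(2)) (auto simp: thin_def)
  next
    case 2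
    then have "c = (\<not> e)" using Nil.prems(10,11) by (cases "c = e") auto
    then have "\<exists>i. 1 \<le> i \<and> i \<le> k - 1 \<and> factors (k - 1) (degen (k - 1) i) (cmp (k - 1) U (face k t c))"
      using cases(2)[OF 2] Nil.prems(4,5) by (intro exI[of _ q]) auto
    then show ?thesis by (intro word_marked_Nil Nil.prems(2)) (simp add: thin_def)
  next
    case 3
    then show ?thesis using cases(3) elementary_conn[OF eB, of 0 q "k - 1"] Nil.prems(4-6) t
      by (intro word_marked_Nil Nil.prems(2)) (auto simp: thin_def)
  qed
next
  case (Cons tc cs k U p t c)
  obtain t' c' where tc: "tc = (t', c')" by force
  have t: "1 \<le> t" "t \<le> k" "face_word (k - 1) (tc # cs)" "\<forall>u\<in>fst ` set (tc # cs). u < t"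
    using Cons.prems(7) face_word_Cons by auto
  note cases = conn_face_cases[OF Cons.prems(1,4,5,3) t(1,2), of c]
  let ?S = "cmp (k - 1) U (face k t c)"
  have i: "\<forall>u\<in>fst ` set (tc # cs). u \<noteq> i" using Cons.prems(9) by auto
  consider "t < q" | "t = q \<or> t = q + 1" | "q + 1 < t" by linarith
  then show ?case
  proof cases
    case 1
    then show ?thesis using t Cons.prems(4-6)
      by (intro word_marked_conn[OF Cons.prems(2) cases(1)[OF 1] _ _ _ t(3)]) auto
  next
    case 2
    then have "c = (\<not> e)" using Cons.prems(10,11) by (cases "c = e") auto
    \<comment> \<open>One of \<open>q\<close> and \<open>q + 1\<close> is \<open>i\<close>, which
      the word avoids; \<open>t\<close> is the other one, so the smaller directions that follow lie
      below \<open>q\<close>.\<close>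
    moreover have "\<forall>u\<in>fst ` set (tc # cs). u < q"
    proof
      fix u assume "u \<in> fst ` set (tc # cs)"
      then have "u < t" "u \<noteq> i" using t(4) i by auto
      moreover have "t \<noteq> i" using Cons.prems(9) by auto
      ultimately show "u < q" using 2 Cons.prems(8) by auto
    qed
    ultimately show ?thesis using Cons.prems(4,5)
      by (intro word_marked_degen[OF Cons.prems(2) cases(2)[OF 2] _ _ t(3)]) auto
  next
    case 3
    have p: "(if t \<le> p then 0 else p) = p" using 3 Cons.prems(6) by auto
    have t': "1 \<le> t'" "t' \<le> k - 1" using t(3) face_word_Cons tc by auto
    have g: "good (k - 1) ?S p" using Cons.prems(2) p by simp
    have "word_marked (k - 1 - 1) cs (cmp (k - 1 - 1) ?S (face (k - 1) t' c')) (if t' \<le> p then 0 else p)"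
      using 3 t Cons.prems(4-) tc
      by (intro Cons.IH[OF good_boxmor[OF g] good_face[OF g t'] cases(3)[OF 3]]) auto
    then show ?thesis using word_marked_Cons[OF g, of t' c' cs] t(3) tc p by simp
  qed
qed

lemma word_marked_critical:
  assumes "good k S p" "factors k (conn k q e) S" "1 \<le> q" "q < k" "p = 0 \<or> p = q" "face_word k cs"
    "i = q \<or> i = q + 1" "crit_word i e cs"
  shows "word_marked k cs S p"
proof (cases cs)
  case Nil
  have "thin B e p k S" using assms elementary_conn[OF eB, of 0 q k] by (auto simp: thin_def)
  then show ?thesis using word_marked_Nil[OF assms(1)] Nil by simp
next
  case (Cons tc cs')
  obtain t c where tc: "tc = (t, c)" by force
  have t: "1 \<le> t" "t \<le> k" using assms(6) face_word_Cons Cons tc by auto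
  have "word_marked (k - 1) cs' (cmp (k - 1) S (face k t c)) (if t \<le> p then 0 else p)"
    using crit_word_free[OF assms(8,7)] assms(6) Cons tc
    by (intro word_marked_critical_Cons[OF good_boxmor[OF assms(1)] good_face[OF assms(1) t] assms(2-5) _ assms(7)]) auto
  then show ?thesis using word_marked_Cons[OF assms(1)] assms(6) Cons tc by simp
qed

end

section \<open>Extending a cube along the new connections\<close>

abbreviation fc :: "nat \<Rightarrow> cubemap \<Rightarrow> nat \<Rightarrow> bool \<Rightarrow> cubemap" where
  "fc m T t d \<equiv> cmp (m - 1) T (face m t d)"

lemma fc_boxmor: "boxmor B m n T \<Longrightarrow> 1 \<le> t \<Longrightarrow> t \<le> m \<Longrightarrow> boxmor B (m - 1) n (fc m T t d)"
  by (rule boxmor_comp[OF boxmor_face])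

lemma fc_fc:
  assumes "boxmor B m n T" "1 \<le> j" "j < k" "k \<le> m"
  shows "fc (m - 1) (fc m T k c') j c = fc (m - 1) (fc m T j c) (k - 1) c'"
proof -
  have 2: "boxmor B (m - 2) (m - 1) (face (m - 1) j c)" "boxmor B (m - 2) (m - 1) (face (m - 1) (k - 1) c')"
    using boxmor_face[of j "m - 1" B c] boxmor_face[of "k - 1" "m - 1" B c'] assms
    by (simp_all add: numeral_2_eq_2)
  show ?thesis
    using boxmor_cmp_assoc[OF 2(1), of T "face m k c'"] boxmor_cmp_assoc[OF 2(2), of T "face m j c"]
      face_face[OF assms(2-4), of c' c] by (simp add: numeral_2_eq_2)
qed

lemma fc_elem:
  assumes "elementary A p m s" "cmp (m - 1) s (face m t d) = idbox (m - 1)" "boxmor B (m - 1) n T'" "1 \<le> t" "t \<le> m"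
  shows "fc m (cmp m T' s) t d = T'"
  using boxmor_cmp_assoc[OF boxmor_face[OF assms(4,5)], of T' s] assms(2) boxmor_id_right[OF assms(3)] by metis

lemma idbox_not_fac: "elementary B 0 m s \<Longrightarrow> \<not> factors m s (idbox m)"
proof
  assume s: "elementary B 0 m s" "factors m s (idbox m)"
  obtain t d where t: "0 < t" "t \<le> m" "cmp (m - 1) s (face m t d) = idbox (m - 1)"
    using elementary_section[OF s(1)] .
  have f: "boxmor B (m - 1) m (face m t d)" using t by (intro boxmor_face) auto
  have "idbox m = cmp m (cmp (m - 1) (idbox m) (face m t d)) s"
    by (rule factors_factor[OF s(2) boxmor_id elementary_boxmor[OF s(1)] f t(3)])
  then have "cmp m (face m t d) s = idbox m"
    using boxmor_id_left[OF f] by simp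
  moreover have "const_coord (m - 1) m (face m t d)"
    using const_coord_face[of t m B "m - 1" "idbox (m - 1)" d] boxmor_id boxmor_id_right[OF f] t by simp
  ultimately show False
    using const_coord_cmp[OF _ elementary_boxmor[OF s(1)]] idbox_not_const by metis
qed

text \<open>For one \<open>n\<close>-cube \<open>x\<close>, \<open>v m T\<close> stands for the cube
  \<open>T\<close> induces from the image of \<open>x\<close>, which exists already over
  \<open>B\<close>, and \<open>b m T\<close> for the value of \<open>x T\<close> when
  \<open>T\<close> lands in a proper face, known from lower dimensions. On \<open>X\<close> itself
  only the structure over \<open>A\<close> is available.\<close>

locale connection_extension =
  fixes A B :: "bool set" and e :: bool and n :: nat
    and X :: "'a mcset" and Y :: "'b mcset" and \<phi> :: "('a, 'b) mcfun"
    and v :: "nat \<Rightarrow> cubemap \<Rightarrow> 'b" and x :: 'a and b :: "nat \<Rightarrow> cubemap \<Rightarrow> 'a"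
  assumes B_eq: "B = insert e A" and e_notin: "e \<notin> A"
    and map: "mcmap A X Y \<phi>"
    and fillable: "fillable X Y \<phi>" and saturated: "saturated X Y \<phi>"
    and v_cube: "\<And>m T. boxmor B m n T \<Longrightarrow> v m T \<in> cubes Y m"
    and v_act: "\<And>k m T a. boxmor B m n T \<Longrightarrow> boxmor A k m a \<Longrightarrow> act Y k m a (v m T) = v k (cmp k T a)"
    and v_marked: "\<And>m T s. boxmor B m n T \<Longrightarrow> elementary B 0 m s \<Longrightarrow> factors m s T \<Longrightarrow> v m T \<in> marked Y m"
    and x_cube: "x \<in> cubes X n" and x_v: "\<phi> n x = v n (idbox n)"
    and b_cube: "\<And>m T. boxmor B m n T \<Longrightarrow> const_coord m n T \<Longrightarrow> b m T \<in> cubes X m"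
    and b_v: "\<And>m T. boxmor B m n T \<Longrightarrow> const_coord m n T \<Longrightarrow> \<phi> m (b m T) = v m T"
    and b_act: "\<And>k m T a. boxmor B m n T \<Longrightarrow> const_coord m n T \<Longrightarrow> boxmor A k m a \<Longrightarrow>
      act X k m a (b m T) = b k (cmp k T a)"
    and b_marked: "\<And>m T s. boxmor B m n T \<Longrightarrow> const_coord m n T \<Longrightarrow> elementary B 0 m s \<Longrightarrow> factors m s T \<Longrightarrow>
      b m T \<in> marked X m"
    and b_face: "\<And>j c. 1 \<le> j \<Longrightarrow> j \<le> n \<Longrightarrow> b (n - 1) (face n j c) = bd X n j c x"
begin

lemma AB: "A \<subseteq> B" and eB: "e \<in> B"
  using B_eq by auto

text \<open>There are only two kinds of connection, so at most one is old. This is the hypothesis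
  behind the commuting idempotents and \<open>first_conn\<close>.\<close>

lemma A_le: "A \<subseteq> {\<not> e}"
proof
  fix a assume "a \<in> A"
  then have "a \<noteq> e" using e_notin by blast
  then show "a \<in> {\<not> e}" by auto
qed

lemma mcX: "mcset A X" and mcY: "mcset A Y" and X: "cset A X" and Y: "cset A Y"
  using map unfolding mcmap_def mcset_def by auto

lemma map_act: "boxmor A m k g \<Longrightarrow> z \<in> cubes X k \<Longrightarrow> \<phi> m (act X m k g z) = act Y m k g (\<phi> k z)"
  using map unfolding mcmap_def by blast

lemma marked_cube: "z \<in> marked X m \<Longrightarrow> z \<in> cubes X m"
  using mcX unfolding mcset_def by blast

text \<open>
  A cell \<open>(m, T, p)\<close> with \<open>p = 0\<close> is the cube \<open>x T\<close> to be constructed; for \<open>p > 0\<close> it is an auxiliary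
  \<open>m\<close>-cube with the same image in \<open>Y\<close> and the same faces \<open>\<partial>\<^sub>t\<close> for \<open>t \<le> p\<close>, whose faces \<open>\<partial>\<^sub>t\<close> for
  \<open>t > p\<close> are again auxiliary.  The two occurrences of \<open>x T\<close> as a face of \<open>x T \<gamma>\<^sub>p\<close> prevent the latter from
  being obtained as the filler of an open box; in the auxiliary version of \<open>x T \<gamma>\<^sub>p\<close> they are distinct.
\<close>

definition free0 :: "nat \<Rightarrow> cubemap \<Rightarrow> bool" where
  "free0 m T \<longleftrightarrow> \<not> const_coord m n T \<and> (\<nexists>s. elementary A 0 m s \<and> factors m s T) \<and>
     (\<exists>i. 1 \<le> i \<and> i < m \<and> factors m (conn m i e) T)"

definition pos :: "nat \<Rightarrow> cubemap \<Rightarrow> nat" where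
  "pos m T = (if free0 m T then LEAST i. 1 \<le> i \<and> i < m \<and> factors m (conn m i e) T else 0)"

text \<open>The cases in which the auxiliary cell is taken to be the true cube.\<close>

definition collapsed :: "nat \<Rightarrow> cubemap \<Rightarrow> nat \<Rightarrow> bool" where
  "collapsed m T p \<longleftrightarrow> const_coord m n T \<or> (\<exists>s. low B e p m s \<and> factors m s T)"

definition reducible :: "nat \<Rightarrow> cubemap \<Rightarrow> nat \<Rightarrow> bool" where
  "reducible m T p \<longleftrightarrow> (\<exists>s. elementary A p m s \<and> factors m s T)"

text \<open>Unless collapsed or reducible, such an auxiliary cell will be the filler that produced a
  free cell one dimension lower.\<close>

definition upper :: "nat \<Rightarrow> cubemap \<Rightarrow> nat \<Rightarrow> bool" where
  "upper m T p \<longleftrightarrow> p < m \<and> factors m (conn m p e) T"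

definition free :: "nat \<Rightarrow> cubemap \<Rightarrow> nat \<Rightarrow> bool" where
  "free m T p \<longleftrightarrow> (if p = 0 then free0 m T
     else \<not> collapsed m T p \<and> \<not> reducible m T p \<and> \<not> upper m T p)"

text \<open>The order within one dimension. True cubes are sorted by their first new connection; a
  collapsed cell follows immediately after its true cube, hence the \<open>+ 1\<close>; the other
  reducible or upper auxiliary cells refer to lower dimensions only; free auxiliary cells come last,
  as \<open>2 * m + 3\<close> exceeds \<open>2 * pos m T + 1\<close>.\<close>

definition rank :: "nat \<Rightarrow> cubemap \<Rightarrow> nat \<Rightarrow> nat" where
  "rank m T p = (if p = 0 then 2 * pos m T else if collapsed m T p then 2 * pos m T + 1
     else if reducible m T p \<or> upper m T p then 1 else 2 * m + 3)"

definition cell_order :: "((nat \<times> cubemap \<times> nat) \<times> (nat \<times> cubemap \<times> nat)) set" where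
  "cell_order = inv_image (less_than <*lex*> less_than) (\<lambda>(m, T, p). (m, rank m T p))"

lemma wf_cell_order: "wf cell_order"
  unfolding cell_order_def by (intro wf_inv_image wf_lex_prod wf_less_than)

lemma cell_order_iff: "((k, S, p'), (m, T, p)) \<in> cell_order \<longleftrightarrow> k < m \<or> k = m \<and> rank k S p' < rank m T p"
  by (simp add: cell_order_def)

text \<open>A free cell is determined by a filler \<open>h\<close> of the auxiliary version of \<open>x T \<gamma>\<^sub>d\<close> with \<open>d = dir m T p\<close>,
  as the missing face.\<close>

definition dir :: "nat \<Rightarrow> cubemap \<Rightarrow> nat \<Rightarrow> nat" where
  "dir m T p = (if p = 0 then pos m T else p)"

text \<open>In the box for \<open>apex\<close> the face in direction \<open>dir\<close> at
  \<open>e\<close> is the true cube belonging to \<open>T\<close> and the next one its auxiliary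
  version. The hole is the one under construction; the other precedes it in the order.\<close>

definition hole :: "nat \<Rightarrow> cubemap \<Rightarrow> nat \<Rightarrow> nat" where
  "hole m T p = (if p = 0 then pos m T else p + 1)"

definition apex :: "nat \<Rightarrow> cubemap \<Rightarrow> nat \<Rightarrow> cubemap" where
  "apex m T p = cmp (m + 1) T (conn (m + 1) (dir m T p) e)"

text \<open>A conjunction in the form of one introduction rule. \<open>F\<close> returns a pair: the
  cell and the filler that defined it. The filler is kept because it becomes a cell of the next
  dimension; it is meaningful for free cells only.\<close>

inductive spec :: "(nat \<times> cubemap \<times> nat \<Rightarrow> 'a \<times> 'a) \<Rightarrow> nat \<Rightarrow> cubemap \<Rightarrow> nat \<Rightarrow> 'a \<Rightarrow> 'a \<Rightarrow> bool"
  for F m T p c h where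
  specI: "\<lbrakk>c \<in> cubes X m;
    \<phi> m c = v m T;
    (\<And>t d. 1 \<le> t \<Longrightarrow> t \<le> m \<Longrightarrow> bd X m t d c = fst (F (m - 1, fc m T t d, if t \<le> p then 0 else p)));
    (thin B e p m T \<Longrightarrow> c \<in> marked X m);
    (\<And>s T'. elementary A p m s \<Longrightarrow> boxmor B (m - 1) n T' \<Longrightarrow> T = cmp m T' s \<Longrightarrow>
        c = act X m (m - 1) s (fst (F (m - 1, T', p))));
    (p = 0 \<Longrightarrow> const_coord m n T \<Longrightarrow> c = b m T);
    (p = 0 \<Longrightarrow> m = n \<Longrightarrow> T = idbox n \<Longrightarrow> c = x);
    (1 \<le> p \<Longrightarrow> collapsed m T p \<Longrightarrow> c = fst (F (m, T, 0)));
    (free m T p \<Longrightarrow> h \<in> marked X (m + 1));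
    (free m T p \<Longrightarrow> \<phi> (m + 1) h = v (m + 1) (apex m T p));
    (\<And>t d. free m T p \<Longrightarrow> 1 \<le> t \<Longrightarrow> t \<le> m + 1 \<Longrightarrow> bd X (m + 1) t d h = (if (t, d) = (hole m T p, e) then c
            else fst (F (m, fc (m + 1) (apex m T p) t d, if t \<le> dir m T p then 0 else dir m T p))))\<rbrakk>
    \<Longrightarrow> spec F m T p c h"

lemma specD:
  assumes "spec F m T p c h"
  shows "c \<in> cubes X m" and "\<phi> m c = v m T"
    and "\<And>t d. 1 \<le> t \<Longrightarrow> t \<le> m \<Longrightarrow> bd X m t d c = fst (F (m - 1, fc m T t d, if t \<le> p then 0 else p))"
    and "thin B e p m T \<Longrightarrow> c \<in> marked X m"
    and "\<And>s T'. elementary A p m s \<Longrightarrow> boxmor B (m - 1) n T' \<Longrightarrow> T = cmp m T' s \<Longrightarrow>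
        c = act X m (m - 1) s (fst (F (m - 1, T', p)))"
    and "p = 0 \<Longrightarrow> const_coord m n T \<Longrightarrow> c = b m T"
    and "p = 0 \<Longrightarrow> m = n \<Longrightarrow> T = idbox n \<Longrightarrow> c = x"
    and "1 \<le> p \<Longrightarrow> collapsed m T p \<Longrightarrow> c = fst (F (m, T, 0))"
    and "free m T p \<Longrightarrow> h \<in> marked X (m + 1)"
    and "free m T p \<Longrightarrow> \<phi> (m + 1) h = v (m + 1) (apex m T p)"
    and "\<And>t d. free m T p \<Longrightarrow> 1 \<le> t \<Longrightarrow> t \<le> m + 1 \<Longrightarrow> bd X (m + 1) t d h = (if (t, d) = (hole m T p, e) then c
            else fst (F (m, fc (m + 1) (apex m T p) t d, if t \<le> dir m T p then 0 else dir m T p)))"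
  using assms by (cases, blast)+

definition cell_spec :: "(nat \<times> cubemap \<times> nat \<Rightarrow> 'a \<times> 'a) \<Rightarrow> nat \<times> cubemap \<times> nat \<Rightarrow> 'a \<times> 'a \<Rightarrow> bool" where
  "cell_spec F z r = (case z of (m, T, p) \<Rightarrow> boxmor B m n T \<longrightarrow> p \<le> m \<longrightarrow> spec F m T p (fst r) (snd r))"

section \<open>Position of the first new connection and decrease of the rank\<close>

lemma pos_props:
  assumes "free0 m T"
  shows "1 \<le> pos m T" "pos m T < m" "factors m (conn m (pos m T) e) T"
  using LeastI_ex[of "\<lambda>i. 1 \<le> i \<and> i < m \<and> factors m (conn m i e) T"] assms
  unfolding pos_def free0_def by auto

lemma pos_le: "1 \<le> i \<Longrightarrow> i < m \<Longrightarrow> factors m (conn m i e) T \<Longrightarrow> pos m T \<le> i"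
  unfolding pos_def by (auto intro: Least_le)

lemma pos_le_dim: "pos m T \<le> m"
  using pos_props(2)[of m T] by (cases "free0 m T") (auto simp: pos_def)

lemma pos_0: "elementary A 0 m s \<Longrightarrow> factors m s T \<Longrightarrow> pos m T = 0" "const_coord m n T \<Longrightarrow> pos m T = 0"
  unfolding pos_def free0_def by auto

text \<open>A low quotient is either one over \<open>A\<close>, which forces position 0, or a
  connection of kind \<open>e\<close> at an index below \<open>p\<close>. A constant coordinate also
  forces position 0.\<close>

lemma pos_collapsed: "collapsed m T p \<Longrightarrow> 1 \<le> p \<Longrightarrow> pos m T < p"
  unfolding collapsed_def
proof (elim disjE exE conjE)
  fix s assume s: "low B e p m s" "factors m s T" and p: "1 \<le> p"
  from s(1) have pm: "p \<le> m" by (simp add: low_def)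
  have e: "pos m T < p" if "1 \<le> i" "i < p" "s = conn m i e" for i
    using pos_le[of i m T] s(2) pm that by auto
  from s(1) show "pos m T < p"
    unfolding low_def
  proof (elim conjE disjE exE)
    fix i assume "1 \<le> i" "i \<le> p" "s = degen m i"
    then have "elementary A 0 m s" using pm by (auto intro: elementary_degen)
    then show ?thesis using pos_0(1) s(2) p by simp
  next
    fix i e' assume i: "e' \<in> B" "1 \<le> i" "i + 1 < p" "s = conn m i e'"
    show ?thesis
    proof (cases "e' = e")
      case True then show ?thesis using e i by auto
    next
      case False
      then have "e' \<in> A" using i(1) B_eq by blast
      then have "elementary A 0 m s" using i pm by (auto intro: elementary_conn)
      then show ?thesis using pos_0(1) s(2) p by simp
    qed
  next
    assume "2 \<le> p" "s = conn m (p - 1) e"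
    then show ?thesis using e[of "p - 1"] by simp
  qed
qed (auto simp: pos_0)

lemma collapsed_degen: "1 \<le> p \<Longrightarrow> p \<le> m \<Longrightarrow> factors m (degen m p) T \<Longrightarrow> collapsed m T p"
  unfolding collapsed_def low_def by blast

lemma collapsed_face:
  assumes T: "boxmor B m n T" and "collapsed m T p" "1 \<le> p" "p < t" "t \<le> m"
  shows "collapsed (m - 1) (fc m T t d) p"
proof -
  have f: "boxmor B (m - 1) m (face m t d)" using assms by (intro boxmor_face) auto
  show ?thesis
    using assms(2) unfolding collapsed_def[of m]
  proof (elim disjE exE conjE)
    assume "const_coord m n T" then show ?thesis
      using const_coord_cmp[OF _ f] by (simp add: collapsed_def)
  next
    fix s assume s: "low B e p m s" "factors m s T"
    obtain s' where "low B e p (m - 1) s'" "cmp (m - 1) s (face m t d) = cmp (m - 1) (face (m - 1) (t - 1) d) s'"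
      using low_face[OF s(1) assms(4,5)] .
    then show ?thesis using factors_square[OF s(2) f] unfolding collapsed_def by blast
  qed
qed

lemma dir_props:
  assumes "free m T p" "p \<le> m"
  shows "1 \<le> dir m T p" "dir m T p \<le> m" "hole m T p = dir m T p \<or> hole m T p = dir m T p + 1"
    "1 \<le> hole m T p" "hole m T p \<le> m + 1"
  using assms pos_props[of m T] unfolding free_def dir_def hole_def by (auto split: if_splits)

lemma apex_boxmor:
  assumes "boxmor B m n T" "free m T p" "p \<le> m"
  shows "boxmor B (m + 1) n (apex m T p)"
proof -
  have "boxmor B (m + 1) m (conn (m + 1) (dir m T p) e)"
    using boxmor_conn[of e B "dir m T p" "m + 1"] dir_props[OF assms(2,3)] eB by simp
  then show ?thesis unfolding apex_def using assms(1) by (rule boxmor_comp)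
qed

lemma apex_fac: "factors (m + 1) (conn (m + 1) (dir m T p) e) (apex m T p)"
  unfolding apex_def by (rule factors_cmp)

lemma apex_face_same:
  assumes "boxmor B m n T" "free m T p" "p \<le> m" "t = dir m T p \<or> t = dir m T p + 1"
  shows "fc (m + 1) (apex m T p) t e = T"
proof -
  have "elementary B 0 (m + 1) (conn (m + 1) (dir m T p) e)"
    using dir_props[OF assms(2,3)] eB by (intro elementary_conn) auto
  then show ?thesis
    using fc_elem[of B 0 "m + 1" "conn (m + 1) (dir m T p) e" t e B n T]
      conn_face_same[of "dir m T p" "m + 1" t e] dir_props[OF assms(2,3)] assms
    unfolding apex_def by auto
qed

lemma apex_face_cases:
  fixes c :: bool
  assumes "boxmor B m n T" "free m T p" "p \<le> m" "1 \<le> t" "t \<le> m + 1"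
  defines "S \<equiv> fc (m + 1) (apex m T p) t c"
  shows "t < dir m T p \<Longrightarrow> factors m (conn m (dir m T p - 1) e) S"
    and "t = dir m T p \<or> t = dir m T p + 1 \<Longrightarrow> c = (\<not> e) \<Longrightarrow> factors m (degen m (dir m T p)) S"
    and "dir m T p + 1 < t \<Longrightarrow> factors m (conn m (dir m T p) e) S"
  using conn_face_cases[OF apex_boxmor[OF assms(1-3)] dir_props(1)[OF assms(2,3)] _ apex_fac assms(4,5), of c]
    dir_props[OF assms(2,3)] unfolding S_def by auto

text \<open>For \<open>p = 0\<close> and \<open>q = pos m T\<close>, the true faces have a first new
  connection before \<open>q\<close>, and the auxiliary ones are collapsed, again with position
  below \<open>q\<close>, or upper. For \<open>p > 0\<close> all other faces are true, collapsed or
  upper, and a free auxiliary cell ranks above all of these.\<close>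

lemma hole_rank:
  assumes "boxmor B m n T" "free m T p" "p \<le> m" "1 \<le> t" "t \<le> m + 1" "(t, d) \<noteq> (hole m T p, e)"
  shows "rank m (fc (m + 1) (apex m T p) t d) (if t \<le> dir m T p then 0 else dir m T p) < rank m T p"
proof -
  define q where "q = dir m T p"
  define S where "S = fc (m + 1) (apex m T p) t d"
  note q = dir_props[OF assms(2,3), folded q_def]
  note cases = apex_face_cases[OF assms(1-5), of d, folded q_def S_def]
  have low_pos: "pos m S < q" if "t < q \<or> (t = q \<and> d = (\<not> e))"
  proof (cases "t < q")
    case True
    have "pos m S \<le> q - 1"
      using pos_le[OF _ _ cases(1)[OF True]] True assms(4) q by auto
    then show ?thesis using True by simp
  next
    case False
    then have "factors m (degen m q) S" using cases(2) that by auto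
    then have "pos m S = 0" using pos_0(1)[of m "degen m q" S] elementary_degen[of 0 q m A] q by auto
    then show ?thesis using q by simp
  qed
  have high: "rank m S q \<le> 2 * pos m S + 1 \<and> pos m S < q \<and> collapsed m S q \<or> rank m S q = 1"
    if "q < t" "(t, d) \<noteq> (q + 1, e) \<or> factors m (conn m q e) S \<and> q < m"
  proof (cases "collapsed m S q")
    case True
    then show ?thesis using q pos_collapsed unfolding rank_def by auto
  next
    case False
    have "upper m S q"
    proof (cases "t = q + 1")
      case True
      show ?thesis
      proof (cases "d = e")
        case True then show ?thesis using that \<open>t = q + 1\<close> unfolding upper_def by auto
      next
        case d: False
        then have "collapsed m S q" using collapsed_degen[OF q(1,2)] cases(2) True by auto
        then show ?thesis using False by simp
      qed
    next
      case False then show ?thesis using cases(3) that assms(5) unfolding upper_def by auto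
    qed
    then show ?thesis using False q unfolding rank_def by auto
  qed
  show ?thesis
  proof (cases "p = 0")
    case True
    then have f0: "free0 m T" using assms(2) by (simp add: free_def)
    have qp: "q = pos m T" "hole m T p = q" using True by (simp_all add: q_def dir_def hole_def)
    have r: "rank m T p = 2 * q" using True by (simp add: rank_def qp)
    show ?thesis
    proof (cases "t \<le> q")
      case True
      then have "t < q \<or> (t = q \<and> d = (\<not> e))" using assms(6) qp by (cases "t = q"; cases "d = e") auto
      then show ?thesis using low_pos r True unfolding q_def[symmetric] S_def[symmetric] by (simp add: rank_def)
    next
      case False
      \<comment> \<open>The second occurrence of \<open>T\<close>, next to the hole, is harmless:
        \<open>T\<close> factors through the connection at \<open>q\<close>, so its auxiliary cell
        is upper.\<close>
      have "(t, d) \<noteq> (q + 1, e) \<or> factors m (conn m q e) S \<and> q < m"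
      proof (cases "t = q + 1 \<and> d = e")
        case True
        then have "S = T" using apex_face_same[OF assms(1-3), of t] unfolding S_def q_def by simp
        then show ?thesis using pos_props[OF f0] qp by simp
      qed simp
      then have "rank m S q < 2 * q" using high False q by fastforce
      then show ?thesis using r False unfolding q_def[symmetric] S_def[symmetric] by simp
    qed
  next
    case False
    then have qp: "q = p" "hole m T p = q + 1" by (simp_all add: q_def dir_def hole_def)
    have r: "rank m T p = 2 * m + 3" using False assms(2) by (auto simp: rank_def free_def)
    have ps: "2 * pos m S + 1 < 2 * m + 3" using pos_le_dim[of m S] by simp
    show ?thesis
    proof (cases "t \<le> q")
      case True
      then show ?thesis using ps r unfolding q_def[symmetric] S_def[symmetric] by (simp add: rank_def)
    next
      case False
      then have "rank m S q < 2 * m + 3" using high assms(6) qp ps by fastforce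
      then show ?thesis using r False unfolding q_def[symmetric] S_def[symmetric] by simp
    qed
  qed
qed

text \<open>Well-founded choice requires that a specification reads \<open>F\<close> at smaller
  cells only. The faces of the filler live in the same dimension as the cell; for them this is
  \<open>hole_rank\<close>. The clause for collapsed cells uses the odd ranks.\<close>

lemma cell_spec_cong_imp:
  assumes "\<And>z. (z, y) \<in> cell_order \<Longrightarrow> F z = G z" "cell_spec F y r"
  shows "cell_spec G y r"
proof -
  obtain m T p where y: "y = (m, T, p)" by (cases y)
  have eq: "F (k, S, p') = G (k, S, p')" if "k < m \<or> k = m \<and> rank k S p' < rank m T p" for k S p'
    using assms(1) that unfolding y by (simp add: cell_order_iff)
  have eq1: "F (m - 1, S, p') = G (m - 1, S, p')" if "0 < m" for S p'
    using eq[of "m - 1"] that by auto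
  show ?thesis
    unfolding cell_spec_def y prod.case
  proof (intro impI)
    assume T: "boxmor B m n T" "p \<le> m"
    then have "spec F m T p (fst r) (snd r)" using assms(2) by (simp add: cell_spec_def y)
    note s = specD[OF this]
    show "spec G m T p (fst r) (snd r)"
    proof (rule specI)
      fix t d assume t: "1 \<le> t" "t \<le> m"
      then show "bd X m t d (fst r) = fst (G (m - 1, fc m T t d, if t \<le> p then 0 else p))"
        using s(3)[OF t] eq1 by simp
    next
      fix u T' assume u: "elementary A p m u" "boxmor B (m - 1) n T'" "T = cmp m T' u"
      then show "fst r = act X m (m - 1) u (fst (G (m - 1, T', p)))"
        using s(5)[OF u] eq1 elementary_less[OF u(1)] by simp
    next
      assume p: "1 \<le> p" "collapsed m T p"
      then have "rank m T 0 < rank m T p" by (simp add: rank_def)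
      then show "fst r = fst (G (m, T, 0))"
        using s(8)[OF p] eq by simp
    next
      fix t d assume t: "free m T p" "1 \<le> t" "t \<le> m + 1"
      show "bd X (m + 1) t d (snd r) = (if (t, d) = (hole m T p, e) then fst r
            else fst (G (m, fc (m + 1) (apex m T p) t d, if t \<le> dir m T p then 0 else dir m T p)))"
      proof (cases "(t, d) = (hole m T p, e)")
        case True then show ?thesis using s(11)[OF t, of d] by simp
      next
        case False
        show ?thesis
          using s(11)[OF t, of d] False eq[OF disjI2[OF conjI[OF refl hole_rank[OF T(1) t(1) T(2) t(2,3) False]]]]
          by (simp only: if_False)
      qed
    qed (use s in blast)+
  qed
qed

lemma cell_spec_cong: "(\<And>z. (z, y) \<in> cell_order \<Longrightarrow> F z = G z) \<Longrightarrow> cell_spec F y r = cell_spec G y r"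
  using cell_spec_cong_imp[of y F G r] cell_spec_cong_imp[of y G F r] by metis

end

section \<open>One step of the recursion over cells\<close>

locale extension_step = connection_extension +
  fixes F :: "nat \<times> cubemap \<times> nat \<Rightarrow> 'a \<times> 'a" and m :: nat and T :: cubemap and p :: nat
  assumes T: "boxmor B m n T" and pm: "p \<le> m"
    and IH: "\<And>z. (z, (m, T, p)) \<in> cell_order \<Longrightarrow> cell_spec F z (F z)"
begin

abbreviation C :: "nat \<Rightarrow> cubemap \<Rightarrow> nat \<Rightarrow> 'a" where
  "C k S p' \<equiv> fst (F (k, S, p'))"

definition small :: "nat \<Rightarrow> cubemap \<Rightarrow> nat \<Rightarrow> bool" where
  "small k S p' \<longleftrightarrow> boxmor B k n S \<and> p' \<le> k \<and> (k < m \<or> k = m \<and> rank k S p' < rank m T p)"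

lemma small_spec: "small k S p' \<Longrightarrow> spec F k S p' (C k S p') (snd (F (k, S, p')))"
  using IH[of "(k, S, p')"] by (simp add: small_def cell_order_iff cell_spec_def)

lemmas small_specD = specD[OF small_spec]

lemma small_lower: "boxmor B (m - 1) n S \<Longrightarrow> 0 < m \<Longrightarrow> p' \<le> m - 1 \<Longrightarrow> small (m - 1) S p'"
  by (simp add: small_def)

lemma small_face:
  assumes "small k S p'" "1 \<le> t" "t \<le> k"
  shows "small (k - 1) (fc k S t d) (if t \<le> p' then 0 else p')"
  using assms fc_boxmor[of B k n S t d] unfolding small_def by auto

lemma small_faces:
  assumes "1 \<le> t" "t \<le> m"
  shows "small (m - 1) (fc m T t d) (if t \<le> p then 0 else p)"
  using assms fc_boxmor[OF T assms] pm unfolding small_def by auto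

text \<open>The faces above \<open>p\<close> of the quotient of a cell are as required. By
  \<open>elementary_face\<close> the face either cancels against \<open>s\<close> or passes it, and
  then the specification of the cell in dimension \<open>m - 1\<close> applies.\<close>

lemma elementary_face_C:
  assumes s: "elementary A p m s" and S: "boxmor B (m - 1) n S" and t: "p < t" "t \<le> m"
  shows "C (m - 1) (fc m (cmp m S s) t d) p = act X (m - 1) (m - 1) (cmp (m - 1) s (face m t d)) (C (m - 1) S p)"
proof -
  have pm': "0 < m" "p \<le> m - 1" using elementary_less[OF s] by auto
  have f: "boxmor B (m - 1) m (face m t d)" using t by (intro boxmor_face) auto
  note sm = small_lower[OF S pm']
  note cube = small_specD(1)[OF sm]
  have eq: "fc m (cmp m S s) t d = cmp (m - 1) S (cmp (m - 1) s (face m t d))"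
    by (rule boxmor_cmp_assoc[OF f])
  from elementary_face[OF s t, of d] show ?thesis
  proof (elim disjE exE conjE)
    assume i: "cmp (m - 1) s (face m t d) = idbox (m - 1)"
    then show ?thesis using eq boxmor_id_right[OF S] act_id[OF X cube] by simp
  next
    fix t' c' s' assume h: "p < t'" "t' \<le> m - 1" "elementary A p (m - 1) s'"
      "cmp (m - 1) s (face m t d) = cmp (m - 1) (face (m - 1) t' c') s'"
    have t': "1 \<le> t'" using h by simp
    have s': "boxmor A (m - 1) (m - 1 - 1) s'" using elementary_boxmor[OF h(3)] .
    define S' where "S' = fc (m - 1) S t' c'"
    have S': "boxmor B (m - 1 - 1) n S'" unfolding S'_def by (rule fc_boxmor[OF S t' h(2)])
    have e1: "fc m (cmp m S s) t d = cmp (m - 1) S' s'"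
      unfolding eq h(4) S'_def using boxmor_cmp_assoc[OF s'] by simp
    have sm': "small (m - 1) (cmp (m - 1) S' s') p"
      using boxmor_comp[OF boxmor_mono[OF s' AB] S'] pm' by (intro small_lower) auto
    have "C (m - 1) (cmp (m - 1) S' s') p = act X (m - 1) (m - 1 - 1) s' (C (m - 1 - 1) S' p)"
      using small_specD(5)[OF sm' h(3) S' refl] .
    also have "C (m - 1 - 1) S' p = bd X (m - 1) t' c' (C (m - 1) S p)"
      using small_specD(3)[OF sm t' h(2), of c'] h(1) unfolding S'_def by simp
    also have "act X (m - 1) (m - 1 - 1) s' \<dots> = act X (m - 1) (m - 1) (cmp (m - 1) (face (m - 1) t' c') s') (C (m - 1) S p)"
      using act_cmp[OF X s' boxmor_face[OF t' h(2)] cube] by simp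
    finally show ?thesis using e1 h(4) by simp
  qed
qed

text \<open>Restricting along a section of \<open>s\<close> recovers \<open>S\<close> from
  \<open>S'\<close> and \<open>s'\<close>. Thus the candidate built from \<open>s\<close> is the
  image of the candidate built from \<open>s'\<close> under the idempotent that splits through
  \<open>s\<close>.\<close>

lemma elementary_act_cycle:
  assumes s: "elementary A p m s" "elementary A p m s'" and S: "boxmor B (m - 1) n S" "boxmor B (m - 1) n S'"
    and eq: "cmp m S s = cmp m S' s'" and r: "retracted p m s t d"
  shows "act X m (m - 1) s (C (m - 1) S p) = act X m m (cmp m (face m t d) s) (act X m (m - 1) s' (C (m - 1) S' p))"
proof -
  have pm': "0 < m" "p \<le> m - 1" using elementary_less[OF s(1)] by auto
  have t: "p < t" "1 \<le> t" "t \<le> m" "cmp (m - 1) s (face m t d) = idbox (m - 1)" using r by (auto simp: retracted_def)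
  have f: "boxmor A (m - 1) m (face m t d)" using t by (intro boxmor_face) auto
  note cube' = small_specD(1)[OF small_lower[OF S(2) pm']]
  note sb = elementary_boxmor[OF s(1)] and sb' = elementary_boxmor[OF s(2)]
  have "C (m - 1) S p = C (m - 1) (fc m (cmp m S' s') t d) p"
    using fc_elem[OF s(1) t(4) S(1) t(2,3)] eq by simp
  also have "\<dots> = act X (m - 1) m (face m t d) (act X m (m - 1) s' (C (m - 1) S' p))"
    using elementary_face_C[OF s(2) S(2) t(1,3)] act_cmp[OF X f sb' cube'] by simp
  finally show ?thesis
    using act_cmp[OF X sb f act_closed[OF X sb' cube']] by simp
qed

text \<open>Makes the value of a reducible cell independent of the chosen quotient. With
  \<open>E\<close> and \<open>E'\<close> the idempotents, \<open>w\<close> is \<open>E\<close>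
  applied to \<open>w'\<close> and \<open>w'\<close> is \<open>E'\<close> applied to
  \<open>w\<close>; since \<open>w\<close> is fixed by \<open>E\<close> and the two commute, both
  candidates are equal.\<close>

lemma elementary_act_agree:
  assumes s: "elementary A p m s" "elementary A p m s'" and S: "boxmor B (m - 1) n S" "boxmor B (m - 1) n S'"
    and eq: "cmp m S s = cmp m S' s'"
  shows "act X m (m - 1) s (C (m - 1) S p) = act X m (m - 1) s' (C (m - 1) S' p)"
proof (cases "s = s'")
  case True
  obtain t d where t: "p < t" "t \<le> m" "cmp (m - 1) s (face m t d) = idbox (m - 1)" using elementary_section[OF s(1)] .
  have t': "1 \<le> t" using t by simp
  have "S = fc m (cmp m S s) t d" by (rule fc_elem[OF s(1) t(3) S(1) t' t(2), symmetric])
  also have "\<dots> = fc m (cmp m S' s) t d" by (simp only: eq[unfolded True] True)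
  also have "\<dots> = S'" by (rule fc_elem[OF s(1) t(3) S(2) t' t(2)])
  finally have "S = S'" .
  then show ?thesis using True by simp
next
  case False
  obtain t d t' d' where r: "retracted p m s t d" "retracted p m s' t' d'"
    and comm: "\<And>xs. length xs = m \<Longrightarrow>
      face m t d (s (face m t' d' (s' xs))) = face m t' d' (s' (face m t d (s xs)))"
    using elementary_idempotents_commute[OF s A_le False] by blast
  have pm': "0 < m" "p \<le> m - 1" using elementary_less[OF s(1)] by auto
  note sb = elementary_boxmor[OF s(1)] and sb' = elementary_boxmor[OF s(2)]
  have f: "boxmor A (m - 1) m (face m t d)" and f': "boxmor A (m - 1) m (face m t' d')"
    using r by (auto intro!: boxmor_face simp: retracted_def simp del: One_nat_def)
  define E E' where "E = cmp m (face m t d) s" and "E' = cmp m (face m t' d') s'"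
  have E: "boxmor A m m E" "boxmor A m m E'" unfolding E_def E'_def using sb sb' f f' boxmor_comp by blast+
  have EE: "cmp m E E' = cmp m E' E"
    using comm boxmor_length[OF sb] boxmor_length[OF sb'] boxmor_length[OF f] boxmor_length[OF f']
    by (intro boxmor_eqI[OF boxmor_comp[OF E(2,1)] boxmor_comp[OF E]]) (simp add: E_def E'_def)
  define w w' where "w = act X m (m - 1) s (C (m - 1) S p)" and "w' = act X m (m - 1) s' (C (m - 1) S' p)"
  have w: "w \<in> cubes X m" "w' \<in> cubes X m"
    unfolding w_def w'_def using act_closed[OF X] sb sb' small_specD(1)[OF small_lower] S pm' by blast+
  have 1: "w = act X m m E w'" unfolding w_def w'_def E_def by (rule elementary_act_cycle[OF s S eq r(1)])
  have 2: "w' = act X m m E' w" unfolding w_def w'_def E'_def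
    by (rule elementary_act_cycle[OF s(2,1) S(2,1) eq[symmetric] r(2)])
  have "act X m m E w = w"
    using elementary_act_cycle[OF s(1,1) S(1,1) refl r(1)] unfolding w_def E_def by simp
  have "w = act X m m E (act X m m E' w)" using 1 2 by simp
  also have "\<dots> = act X m m (cmp m E E') w" using act_cmp[OF X E(1,2) w(1)] EE by simp
  also have "\<dots> = act X m m E' (act X m m E w)" unfolding EE[symmetric]
    using act_cmp[OF X E(2,1) w(1)] EE by simp
  also have "\<dots> = w'" using \<open>act X m m E w = w\<close> 2 by simp
  finally show ?thesis unfolding w_def w'_def .
qed

lemma step_const:
  assumes "const_coord m n T" "p = 0"
  shows "\<exists>c h. spec F m T p c h"
proof (intro exI specI)
  show "b m T \<in> cubes X m" "\<phi> m (b m T) = v m T" using b_cube[OF T] b_v[OF T] assms by auto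
  show "bd X m t d (b m T) = C (m - 1) (fc m T t d) (if t \<le> p then 0 else p)" if t: "1 \<le> t" "t \<le> m" for t d
  proof -
    have "const_coord (m - 1) n (fc m T t d)" using const_coord_cmp[OF assms(1) boxmor_face[OF t]] .
    then have "C (m - 1) (fc m T t d) 0 = b (m - 1) (fc m T t d)"
      using small_specD(6)[OF small_faces[OF t, of d]] assms(2) by simp
    then show ?thesis using b_act[OF T assms(1) boxmor_face[OF t], of d] t assms(2) by simp
  qed
  show "b m T \<in> marked X m" if "thin B e p m T"
    using that assms b_marked[OF T] elementary_degen[of 0 _ m B] unfolding thin_def by (auto simp: Suc_le_eq)
  show "b m T = act X m (m - 1) s (C (m - 1) T' p)" if s: "elementary A p m s" "boxmor B (m - 1) n T'" "T = cmp m T' s" for s T'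
  proof -
    obtain t d where t: "p < t" "t \<le> m" "cmp (m - 1) s (face m t d) = idbox (m - 1)" using elementary_section[OF s(1)] .
    have c: "const_coord (m - 1) n T'"
      using fc_elem[OF s(1) t(3) s(2)] s(3) t const_coord_cmp[OF assms(1) boxmor_face[of t m B d]] by simp
    have "C (m - 1) T' 0 = b (m - 1) T'"
      using small_specD(6)[OF small_lower[OF s(2), of 0]] elementary_less[OF s(1)] c by simp
    then show ?thesis using b_act[OF s(2) c elementary_boxmor[OF s(1)]] s(3) assms(2) by simp
  qed
  show "b m T = x" if "m = n" "T = idbox n" using idbox_not_const assms(1) that by simp
qed (use assms in \<open>auto simp: free_def free0_def\<close>)

lemma step_id:
  assumes "m = n" "T = idbox n" "p = 0"
  shows "\<exists>c h. spec F m T p c h"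
proof (intro exI specI)
  have nf: "\<not> factors m s T" if "elementary B 0 m s" for s using idbox_not_fac[OF that] assms by simp
  show "x \<in> cubes X m" "\<phi> m x = v m T" using x_cube x_v assms by auto
  show "bd X m t d x = C (m - 1) (fc m T t d) (if t \<le> p then 0 else p)" if t: "1 \<le> t" "t \<le> m" for t d
  proof -
    have f: "boxmor B (n - 1) n (face n t d)" using t assms by (intro boxmor_face) auto
    have eq: "fc m T t d = face n t d" using boxmor_id_left[OF f] assms by simp
    have "const_coord (m - 1) n (fc m T t d)"
      using const_coord_face[of t n B "n - 1" "idbox (n - 1)" d] boxmor_id boxmor_id_right[OF f] eq assms t by simp
    then have "C (m - 1) (fc m T t d) 0 = b (m - 1) (fc m T t d)"
      using small_specD(6)[OF small_faces[OF t, of d]] assms(3) by simp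
    then show ?thesis using b_face[of t d] assms t eq by auto
  qed
  show "x \<in> marked X m" if "thin B e p m T"
    using that nf assms elementary_degen[of 0 _ m B] unfolding thin_def by (auto simp: Suc_le_eq)
  show "x = act X m (m - 1) s (C (m - 1) T' p)" if s: "elementary A p m s" "boxmor B (m - 1) n T'" "T = cmp m T' s" for s T'
    using nf[of s] elementary_mono[OF elementary_le[OF s(1)] AB] factors_cmp s(3) by simp
  show "x = b m T" if "const_coord m n T" using that idbox_not_const assms by simp
  have "\<not> free m T p" using nf[OF elementary_conn[OF eB]] assms(3) unfolding free_def free0_def by auto
  then show "free m T p \<Longrightarrow> x \<in> marked X (m + 1)" "free m T p \<Longrightarrow> \<phi> (m + 1) x = v (m + 1) (apex m T p)"
    "free m T p \<Longrightarrow> bd X (m + 1) t d x = (if (t, d) = (hole m T p, e) then x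
            else C m (fc (m + 1) (apex m T p) t d) (if t \<le> dir m T p then 0 else dir m T p))" for t d by auto
qed (use assms in auto)

text \<open>Taking the true cube is consistent: the faces above \<open>p\<close> are collapsed
  again, so there auxiliary and true faces coincide.\<close>

lemma step_collapsed:
  assumes "1 \<le> p" "collapsed m T p"
  shows "\<exists>c h. spec F m T p c h"
proof (intro exI specI)
  have sm: "small m T 0" using T assms unfolding small_def by (simp add: rank_def)
  note s = small_specD[OF sm]
  show "C m T 0 \<in> cubes X m" "\<phi> m (C m T 0) = v m T" by (fact s(1,2))+
  show "bd X m t d (C m T 0) = C (m - 1) (fc m T t d) (if t \<le> p then 0 else p)" if t: "1 \<le> t" "t \<le> m" for t d
  proof (cases "t \<le> p")
    case True then show ?thesis using s(3)[OF t, of d] by simp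
  next
    case False
    have "C (m - 1) (fc m T t d) p = C (m - 1) (fc m T t d) 0"
      using small_specD(8)[OF small_faces[OF t, of d]] collapsed_face[OF T assms(2,1) _ t(2), of d] False assms(1) by simp
    then show ?thesis using s(3)[OF t, of d] False by simp
  qed
  show "C m T 0 \<in> marked X m" if "thin B e p m T"
  proof (rule s(4))
    show "thin B e 0 m T"
      using that assms(1) elementary_conn[OF eB, of 0 p m] unfolding thin_def by auto
  qed
  show "C m T 0 = act X m (m - 1) u (C (m - 1) T' p)" if u: "elementary A p m u" "boxmor B (m - 1) n T'" "T = cmp m T' u" for u T'
  proof -
    obtain t d where t: "p < t" "t \<le> m" "cmp (m - 1) u (face m t d) = idbox (m - 1)" using elementary_section[OF u(1)] .
    have "collapsed (m - 1) T' p"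
      using fc_elem[OF u(1) t(3) u(2)] collapsed_face[OF T assms(2,1) t(1,2), of d] u(3) t assms by simp
    then have "C (m - 1) T' p = C (m - 1) T' 0"
      using small_specD(8)[OF small_lower[OF u(2)]] elementary_less[OF u(1)] assms(1) by simp
    then show ?thesis using s(5)[OF elementary_le[OF u(1)] u(2,3)] by simp
  qed
qed (use assms in \<open>auto simp: free_def\<close>)

text \<open>The value is forced by any one quotient and does not depend on it by
  \<open>elementary_act_agree\<close>. Faces in directions at most \<open>p\<close> commute with the
  quotient and turn both sides into true cubes.\<close>

lemma step_reducible:
  assumes "p = 0 \<Longrightarrow> \<not> const_coord m n T" "1 \<le> p \<Longrightarrow> \<not> collapsed m T p" "reducible m T p"
  shows "\<exists>c h. spec F m T p c h"
proof -
  obtain s where s: "elementary A p m s" "factors m s T" using assms(3) by (auto simp: reducible_def)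
  obtain t0 d0 where t0: "p < t0" "t0 \<le> m" "cmp (m - 1) s (face m t0 d0) = idbox (m - 1)" using elementary_section[OF s(1)] .
  define S where "S = fc m T t0 d0"
  have S: "boxmor B (m - 1) n S" unfolding S_def using t0 by (intro fc_boxmor[OF T]) auto
  have TS: "T = cmp m S s" unfolding S_def
    using t0 by (intro factors_factor[OF s(2) T elementary_boxmor[OF s(1)] boxmor_face t0(3)]) auto
  have pm': "0 < m" "p \<le> m - 1" using elementary_less[OF s(1)] by auto
  note sm = small_lower[OF S pm']
  note sb = elementary_boxmor[OF s(1)]
  note cube = small_specD(1)[OF sm]
  let ?c = "act X m (m - 1) s (C (m - 1) S p)"
  \<comment> \<open>A cell of this type is not free, so the filler component takes a default
    value.\<close>
  have "spec F m T p ?c undefined"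
  proof (rule specI)
    show "?c \<in> cubes X m" using act_closed[OF X sb cube] .
    show "\<phi> m ?c = v m T" using map_act[OF sb cube] v_act[OF S sb] small_specD(2)[OF sm] TS by simp
    show "bd X m t d ?c = C (m - 1) (fc m T t d) (if t \<le> p then 0 else p)" if t: "1 \<le> t" "t \<le> m" for t d
    proof (cases "t \<le> p")
      case False
      then show ?thesis
        using elementary_face_C[OF s(1) S _ t(2), of d] act_cmp[OF X boxmor_face[OF t, of A d] sb cube] TS by simp
    next
      case True
      obtain s' where s': "elementary A (p - 1) (m - 1) s'"
        "cmp (m - 1) s (face m t d) = cmp (m - 1) (face (m - 1) t d) s'" using elementary_face_low[OF s(1) t(1) True] .
      have t': "t \<le> m - 1" using True pm' by simp
      note sb' = elementary_boxmor[OF s'(1)]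
      define S' where "S' = fc (m - 1) S t d"
      have S': "boxmor B (m - 1 - 1) n S'" unfolding S'_def by (rule fc_boxmor[OF S t(1) t'])
      have eq: "fc m T t d = cmp (m - 1) S' s'"
        unfolding TS S'_def using boxmor_cmp_assoc[OF boxmor_face[OF t], of S s] s'(2) boxmor_cmp_assoc[OF sb'] by simp
      have sm': "small (m - 1) (cmp (m - 1) S' s') 0"
        using boxmor_comp[OF boxmor_mono[OF sb' AB] S'] pm' by (intro small_lower) auto
      have "bd X m t d ?c = act X (m - 1) (m - 1) (cmp (m - 1) (face (m - 1) t d) s') (C (m - 1) S p)"
        using act_cmp[OF X boxmor_face[OF t, of A d] sb cube] s'(2) by simp
      also have "\<dots> = act X (m - 1) (m - 1 - 1) s' (bd X (m - 1) t d (C (m - 1) S p))"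
        using act_cmp[OF X sb' boxmor_face[OF t(1) t'] cube] by simp
      also have "bd X (m - 1) t d (C (m - 1) S p) = C (m - 1 - 1) S' 0"
        using small_specD(3)[OF sm t(1) t', of d] True unfolding S'_def by simp
      also have "act X (m - 1) (m - 1 - 1) s' \<dots> = C (m - 1) (cmp (m - 1) S' s') 0"
        using small_specD(5)[OF sm' elementary_le[OF s'(1)] S' refl] by simp
      finally show ?thesis using eq True by simp
    qed
    show "?c \<in> marked X m" using act_degenerate_marked[OF mcX s(1) cube] .
    show "?c = act X m (m - 1) u (C (m - 1) T' p)" if u: "elementary A p m u" "boxmor B (m - 1) n T'" "T = cmp m T' u" for u T'
      using elementary_act_agree[OF s(1) u(1) S u(2)] u(3) TS by simp
    show "?c = x" if "p = 0" "m = n" "T = idbox n"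
      using idbox_not_fac[of B n s] elementary_mono[OF elementary_le[OF s(1)] AB, of 0] s(2) that by simp
    have "\<not> free m T p" using assms s unfolding free_def free0_def by auto
    then show "free m T p \<Longrightarrow> undefined \<in> marked X (m + 1)" "free m T p \<Longrightarrow> \<phi> (m + 1) undefined = v (m + 1) (apex m T p)"
      "free m T p \<Longrightarrow> bd X (m + 1) t d undefined = (if (t, d) = (hole m T p, e) then ?c
            else C m (fc (m + 1) (apex m T p) t d) (if t \<le> dir m T p then 0 else dir m T p))" for t d by auto
  qed (use assms in auto)
  then show ?thesis by blast
qed

end

context extension_step
begin

text \<open>All faces of this cell are already prescribed, and a full boundary need not have a
  filler. Here it has one, because one of its faces was obtained by filling the box with the others:
  the cell is the filler stored with the free cell at \<open>S\<close>.\<close>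

lemma step_upper:
  assumes p: "1 \<le> p" and "\<not> collapsed m T p" "\<not> reducible m T p" "upper m T p"
  shows "\<exists>c h. spec F m T p c h"
proof -
  have up: "p < m" "factors m (conn m p e) T" using assms(4) by (auto simp: upper_def)
  then obtain k where k: "m = Suc k" by (cases m) auto
  define S where "S = fc m T p e"
  have sec: "cmp k (conn m p e) (face m p e) = idbox k" using conn_face_same[of p m p e] up p k by simp
  have f: "boxmor B k m (face m p e)" using boxmor_face[of p m B e] up p k by simp
  have g: "boxmor B m k (conn m p e)" using boxmor_conn[of e B p m] eB up p k by simp
  have S: "boxmor B k n S" unfolding S_def using f T boxmor_comp k by simp
  have TS: "T = cmp m S (conn m p e)" unfolding S_def
    using factors_factor[OF up(2) T g f sec] k by simp
  have pk: "p \<le> k" using up k by simp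
  have nc: "\<not> const_coord k n S"
    using const_coord_cmp[OF _ g, of n S] assms(2) TS unfolding collapsed_def by auto
  have ncol: "\<not> collapsed k S p"
  proof
    assume "collapsed k S p"
    then obtain s where s: "low B e p k s" "factors k s S" using nc unfolding collapsed_def by blast
    obtain s' b' where s': "low B e p (k + 1) s'" "cmp (k + 1) s (conn (k + 1) p e) = cmp (k + 1) b' s'"
      using low_conn[OF s(1) p] .
    have "factors m s' T" unfolding TS using factors_square[OF s(2) g, of b' s'] s'(2) k by simp
    then show False using assms(2) s'(1) k unfolding collapsed_def by auto
  qed
  have nred: "\<not> reducible k S p"
  proof
    assume "reducible k S p"
    then obtain s where s: "elementary A p k s" "factors k s S" unfolding reducible_def by blast
    obtain s' where s': "elementary A p (k + 1) s'" "cmp (k + 1) s (conn (k + 1) p e) = cmp (k + 1) (conn k p e) s'"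
      using elementary_conn_right[OF s(1) p] .
    have "factors m s' T" unfolding TS using factors_square[OF s(2) g, of "conn k p e" s'] s'(2) k by simp
    then show False using assms(3) s'(1) k unfolding reducible_def by auto
  qed
  \<comment> \<open>If \<open>S\<close> factors through the connection at \<open>p\<close> once
    more, its auxiliary cell is upper itself; then \<open>p\<close> is the first new connection of
    \<open>S\<close> by \<open>first_conn\<close>, and the box was filled to find the true cube at
    \<open>S\<close>. Otherwise it was filled to find the auxiliary one.\<close>
  define p0 where "p0 = (if upper k S p then 0 else p)"
  have free: "free k S p0" and dir: "dir k S p0 = p" and hole: "hole k S p0 = (if upper k S p then p else p + 1)"
  proof -
    have "free k S p0 \<and> dir k S p0 = p \<and> hole k S p0 = (if upper k S p then p else p + 1)"
    proof (cases "upper k S p")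
      case True
      then have u: "p < k" "factors k (conn k p e) S" by (auto simp: upper_def)
      have 1: "\<nexists>s. low B e p k s \<and> factors k s S" using ncol nc by (auto simp: collapsed_def)
      have 2: "\<nexists>s. elementary A p k s \<and> factors k s S" using nred by (auto simp: reducible_def)
      have AB': "insert e A \<subseteq> B" using B_eq by simp
      note first = first_conn[OF u(2) p u(1) A_le AB' 1 2]
      have f0: "free0 k S" unfolding free0_def using nc first(1) u p by auto
      have "pos k S = p"
        using pos_le[OF p u] pos_props[OF f0] first(2)[of "pos k S"] by fastforce
      then show ?thesis using True f0 by (simp add: p0_def free_def dir_def hole_def)
    next
      case False
      then show ?thesis using ncol nred p by (auto simp: p0_def free_def dir_def hole_def)
    qed
    then show "free k S p0" "dir k S p0 = p" "hole k S p0 = (if upper k S p then p else p + 1)" by auto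
  qed
  have ap: "apex k S p0 = T" unfolding apex_def dir using TS k by simp
  have "k < m" using k by simp
  then have sm: "small k S p0" using S pk unfolding small_def p0_def by simp
  note s = small_specD[OF sm]
  let ?h = "snd (F (k, S, p0))"
  have h: "?h \<in> marked X m" using s(9)[OF free] k by simp
  have "spec F m T p ?h undefined"
  proof (rule specI)
    show "?h \<in> cubes X m" by (rule marked_cube[OF h])
    show "\<phi> m ?h = v m T" using s(10)[OF free] k ap by simp
    show "bd X m t d ?h = C (m - 1) (fc m T t d) (if t \<le> p then 0 else p)" if t: "1 \<le> t" "t \<le> m" for t d
    proof -
      have tk: "t \<le> k + 1" using t k by simp
      show ?thesis
    proof (cases "(t, d) = (hole k S p0, e)")
      case False
      have "bd X (k + 1) t d ?h = C k (fc (k + 1) (apex k S p0) t d) (if t \<le> dir k S p0 then 0 else dir k S p0)"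
        using s(11)[OF free t(1) tk, of d] unfolding if_not_P[OF False] .
      then show ?thesis using k ap dir by simp
    next
      case True
      have "bd X (k + 1) t d ?h = C k S p0"
        using s(11)[OF free t(1) tk, of d] unfolding if_P[OF True] .
      moreover have "fc (k + 1) (apex k S p0) t d = S"
        using apex_face_same[OF S free, of t] True hole dir pk by (auto simp: p0_def split: if_splits)
      ultimately show ?thesis using k ap hole True by (auto simp: p0_def split: if_splits)
    qed
    qed
    show "?h \<in> marked X m" by (rule h)
    show "?h = act X m (m - 1) u (C (m - 1) T' p)" if "elementary A p m u" "boxmor B (m - 1) n T'" "T = cmp m T' u" for u T'
      using assms(3) that factors_cmp unfolding reducible_def by blast
    have "\<not> free m T p" using assms by (auto simp: free_def)
    then show "free m T p \<Longrightarrow> undefined \<in> marked X (m + 1)" "free m T p \<Longrightarrow> \<phi> (m + 1) undefined = v (m + 1) (apex m T p)"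
      "free m T p \<Longrightarrow> bd X (m + 1) t d undefined = (if (t, d) = (hole m T p, e) then ?h
            else C m (fc (m + 1) (apex m T p) t d) (if t \<le> dir m T p then 0 else dir m T p))" for t d by auto
  qed (use assms in auto)
  then show ?thesis by blast
qed

sublocale XS: cell_system A B e n X "\<lambda>k S p'. C k S p'" small
proof
  show "cset A X" "e \<in> B" using X eB by auto
  show "boxmor B k n S" if "small k S p'" for k S p' using that by (simp add: small_def)
qed (fact small_face small_specD(1) small_specD(3) small_specD(4))+

text \<open>Over \<open>Y\<close> the parameter is ignored, since a true cube and its auxiliary
  versions have the same image.\<close>

sublocale YS: cell_system A B e n Y "\<lambda>k S p'. v k S" "\<lambda>k S p'. boxmor B k n S"
proof
  show "cset A Y" "e \<in> B" using Y eB by auto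
  show "boxmor B (k - 1) n (fc k S t c)" if "boxmor B k n S" "1 \<le> t" "t \<le> k" for k S t c
    using fc_boxmor that by blast
  show "bd Y k t c (v k S) = v (k - 1) (fc k S t c)" if "boxmor B k n S" "1 \<le> t" "t \<le> k" for k S t c
    using v_act[OF that(1) boxmor_face[OF that(2,3)]] .
  show "v k S \<in> marked Y k" if S: "boxmor B k n S" and "thin B e p' k S" for k S p'
    using that(2) v_marked[OF S] elementary_degen[of 0 _ k B] elementary_conn[OF eB, of 0 _ k]
    unfolding thin_def by (auto simp: Suc_le_eq)
qed (use v_cube in auto)

text \<open>The open box around \<open>apex\<close> consists of earlier cells by
  \<open>hole_rank\<close>, its critical faces are marked because the hole lies in one of the two
  merged directions, and its image in \<open>Y\<close> is known. The filler and its missing face are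
  the required pair. Saturation marks the missing face when it is a true cube.\<close>

lemma step_free:
  assumes free: "free m T p"
  shows "\<exists>c h. spec F m T p c h"
proof -
  define q i U where "q = dir m T p" and "i = hole m T p" and "U = apex m T p"
  define \<kappa> where "\<kappa> t = (if t \<le> q then 0 else q)" for t
  define a where "a t d = C m (fc (m + 1) U t d) (\<kappa> t)" for t d
  note q = dir_props[OF free pm, folded q_def i_def]
  have U: "boxmor B (m + 1) n U" unfolding U_def by (rule apex_boxmor[OF T free pm])
  have Ufac: "factors (m + 1) (conn (m + 1) q e) U" unfolding U_def q_def by (rule apex_fac)
  have Uhole: "fc (m + 1) U i e = T"
    unfolding U_def using apex_face_same[OF T free pm] q(3) unfolding i_def q_def by blast
  have sm: "small m (fc (m + 1) U t d) (\<kappa> t)" if "1 \<le> t" "t \<le> m + 1" "(t, d) \<noteq> (i, e)" for t d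
    using hole_rank[OF T free pm that(1,2)] that fc_boxmor[OF U that(1,2)] q
    unfolding small_def \<kappa>_def U_def q_def i_def by simp
  \<comment> \<open>Taking two faces resets the parameter as soon as one of the directions is at
    most \<open>q\<close>. For \<open>j < k\<close> both orders of restriction do so exactly when
    \<open>j \<le> q\<close>, hence the faces of the box match.\<close>
  have face_a: "bd X m j d (a t d') = C (m - 1) (fc m (fc (m + 1) U t d') j d) (if j \<le> q \<or> t \<le> q then 0 else q)"
    if "1 \<le> t" "t \<le> m + 1" "(t, d') \<noteq> (i, e)" "1 \<le> j" "j \<le> m" for t d' j d
    using small_specD(3)[OF sm[OF that(1-3)] that(4,5), of d] that(4) unfolding a_def \<kappa>_def by auto
  have crit_a: "act X (m - length cs) m (face_composite m cs) (a t d) \<in> marked X (m - length cs)"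
    if w: "face_word (m + 1) ((t, d) # cs)" "crit_word i e ((t, d) # cs)" for t d cs
  proof -
    have t: "1 \<le> t" "t \<le> m + 1" using w(1) face_word_Cons by auto
    note cf = crit_word_free[OF w(2) q(3)]
    have "(t, d) \<noteq> (i, e)" using cf(1) by auto
    from XS.word_marked_critical_Cons[where k = "m + 1" and U = U and t = t and c = d
        and p = q and q = q and i = i and cs = cs] sm[OF t this] show ?thesis
      using U Ufac q w(1) cf unfolding a_def \<kappa>_def by simp
  qed
  have v_crit: "act Y (m + 1 - length cs) (m + 1) (face_composite (m + 1) cs) (v (m + 1) U) \<in> marked Y (m + 1 - length cs)"
    if "face_word (m + 1) cs" "crit_word i e cs" for cs
    using YS.word_marked_critical[OF U Ufac q(1) _ disjI2[OF refl] that(1) q(3) that(2)] q by simp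
  have "\<exists>z\<in>marked X (m + 1). \<phi> (m + 1) z = v (m + 1) U \<and>
      (\<forall>j c. 1 \<le> j \<longrightarrow> j \<le> m + 1 \<longrightarrow> (j, c) \<noteq> (i, e) \<longrightarrow> bd X (m + 1) j c z = a j c)"
  proof (rule fillable[unfolded fillable_def, rule_format])
    show "a j c \<in> cubes X (m + 1 - 1) \<and> \<phi> (m + 1 - 1) (a j c) = bd Y (m + 1) j c (v (m + 1) U)"
      if j: "1 \<le> j" "j \<le> m + 1" "(j, c) \<noteq> (i, e)" for j c
      using small_specD(1,2)[OF sm[OF j]] v_act[OF U boxmor_face[OF j(1,2)], of c] unfolding a_def by simp
    show "bd X (m + 1 - 1) j c (a k c') = bd X (m + 1 - 1) (k - 1) c' (a j c)"
      if "1 \<le> j" "j < k" "k \<le> m + 1" "(j, c) \<noteq> (i, e)" "(k, c') \<noteq> (i, e)" for j k c c'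
      using face_a[of k c' j c] face_a[of j c "k - 1" c'] that fc_fc[OF U that(1-3), of c' c] by auto
    show "act X (m + 1 - 1 - length cs) (m + 1 - 1) (face_composite (m + 1 - 1) cs) (a j c)
           \<in> marked X (m + 1 - 1 - length cs)"
      if "face_word (m + 1) ((j, c) # cs)" "crit_word i e ((j, c) # cs)" for j c cs
      using crit_a[OF that] by simp
  qed (use q v_cube[OF U] v_crit in auto)
  then obtain z where z: "z \<in> marked X (m + 1)" "\<phi> (m + 1) z = v (m + 1) U"
    and zf: "\<And>j c. 1 \<le> j \<Longrightarrow> j \<le> m + 1 \<Longrightarrow> (j, c) \<noteq> (i, e) \<Longrightarrow> bd X (m + 1) j c z = a j c" by blast
  note zc = marked_cube[OF z(1)]
  let ?c = "bd X (m + 1) i e z"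
  have v_hole: "bd Y (m + 1) i e (v (m + 1) U) = v m T"
    using v_act[OF U boxmor_face[OF q(4,5)], of e] Uhole by simp
  have nel: "\<not> (elementary A p m s \<and> factors m s T)" for s
    using free unfolding free_def free0_def reducible_def by (auto split: if_splits)
  have "spec F m T p ?c z"
  proof (rule specI)
    show "?c \<in> cubes X m" using bd_closed[OF X zc q(4,5)] by simp
    show "\<phi> m ?c = v m T"
      using map_act[OF boxmor_face[OF q(4,5)] zc, of e] z(2) v_hole by simp
    show "bd X m t d ?c = C (m - 1) (fc m T t d) (if t \<le> p then 0 else p)" if t: "1 \<le> t" "t \<le> m" for t d
    proof -
      have T': "fc m T t d = fc m (fc (m + 1) U i e) t d" using Uhole by simp
      show ?thesis
      proof (cases "t < i")
        case True
        have "bd X m t d ?c = bd X m (i - 1) e (a t d)"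
          using bd_bd[OF X zc t(1) True q(5), of d e] zf[of t d] t True by simp
        moreover have "fc m T t d = fc m (fc (m + 1) U t d) (i - 1) e"
          using fc_fc[OF U t(1) True q(5), of e d] T' by simp
        \<comment> \<open>For \<open>p = 0\<close> the hole lies in direction \<open>q\<close>, and
          both sides are 0. For \<open>p > 0\<close> it lies in direction \<open>p + 1\<close>, so
          \<open>t < i\<close> means \<open>t \<le> p\<close>, and again both sides are 0.\<close>
        moreover have "(if t \<le> p then 0 else p) = (if i - 1 \<le> q \<or> t \<le> q then 0 else q)"
          using True free unfolding i_def q_def hole_def dir_def by auto
        ultimately show ?thesis using face_a[of t d "i - 1" e] t True q(5) by auto
      next
        case False
        have ti: "i < t + 1" "t + 1 \<le> m + 1" using False t by auto
        have "bd X m t d ?c = bd X m i e (a (t + 1) d)"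
          using bd_bd[OF X zc q(4) ti, of e d] zf[of "t + 1" d] ti by simp
        moreover have "fc m T t d = fc m (fc (m + 1) U (t + 1) d) i e"
          using fc_fc[OF U q(4) ti, of d e] T' by simp
        moreover have "(if t \<le> p then 0 else p) = (if i \<le> q \<or> t + 1 \<le> q then 0 else q)"
          using False free unfolding i_def q_def hole_def dir_def by auto
        ultimately show ?thesis using face_a[of "t + 1" d i e] t q False by auto
      qed
    qed
    show "?c \<in> marked X m" if "thin B e p m T"
    proof (cases "p = 0")
      case False
      \<comment> \<open>A degeneracy at an index up to \<open>p\<close> would make the cell
        collapsed, one above \<open>p\<close> reducible, and the connection at \<open>p\<close>
        upper.\<close>
      have "\<not> thin B e p m T"
      proof
        assume "thin B e p m T"
        then consider j where "1 \<le> j" "j \<le> m" "factors m (degen m j) T" | "upper m T p"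
          using False unfolding thin_def upper_def by blast
        then show False
        proof cases
          case 1
          then show ?thesis
            using free False nel[of "degen m j"] elementary_degen[of p j m A] pm
            unfolding free_def collapsed_def low_def by (cases "j \<le> p") auto
        next
          case 2 then show ?thesis using free False by (simp add: free_def)
        qed
      qed
      then show ?thesis using that by simp
    next
      case True
      have f0: "free0 m T" using free True by (simp add: free_def)
      have qi: "q = pos m T" "i = q" using True by (simp_all add: q_def i_def dir_def hole_def)
      note qp = pos_props[OF f0, folded qi(1)]
      have "bd X (m + 1) i e z \<in> marked X (m + 1 - 1)"
      proof (rule saturated[unfolded saturated_def, rule_format])
        show "act X (m + 1 - length cs) (m + 1) (face_composite (m + 1) cs) z \<in> marked X (m + 1 - length cs)"
          if w: "face_word (m + 1) cs" "crit_word i e cs" for cs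
        proof (cases cs)
          case Nil then show ?thesis using act_id[OF X zc] z by simp
        next
          case (Cons td cs')
          obtain t d where td: "td = (t, d)" by force
          have t: "1 \<le> t" "t \<le> m + 1" using w(1) face_word_Cons Cons td by auto
          have ne: "(t, d) \<noteq> (i, e)" using crit_word_free(1)[OF w(2) q(3)] Cons td by auto
          show ?thesis
            using act_face_composite_Cons[OF X _ zc, of t d cs'] w Cons td crit_a[of t d cs'] zf[OF t ne] by simp
        qed
        show "bd X (m + 1) j c z \<in> marked X (m + 1 - 1)" if j: "1 \<le> j" "j \<le> m + 1" "(j, c) \<noteq> (i, e)" for j c
        proof -
          define S where "S = fc (m + 1) U j c"
          \<comment> \<open>All faces other than the hole are thin, including the second copy of
            \<open>T\<close>, whose auxiliary cell factors through the connection at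
            \<open>q\<close>. This is the situation of a marking extension.\<close>
          have "thin B e (\<kappa> j) m S"
          proof -
            note cases = apex_face_cases[OF T free pm j(1,2), of c, folded q_def U_def, folded S_def]
            consider "j < q" | "j = q \<or> j = q + 1" "c = (\<not> e)" | "j = q + 1" "c = e" | "q + 1 < j"
              using j(3) qi by (cases "c = e") (auto, linarith+)
            then show ?thesis
            proof cases
              case 1
              then have "elementary B 0 m (conn m (q - 1) e)" using j(1) q by (intro elementary_conn[OF eB]) auto
              then show ?thesis using cases(1)[OF 1] 1 by (auto simp: thin_def \<kappa>_def)
            next
              case 2 then show ?thesis using cases(2) q by (auto simp: thin_def)
            next
              case 3
              then have "S = T" unfolding S_def U_def
                using apex_face_same[OF T free pm, of j] by (simp add: q_def)
              then show ?thesis using qp 3 by (simp add: thin_def \<kappa>_def)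
            next
              case 4 then show ?thesis using cases(3)[OF 4] qp by (auto simp: thin_def \<kappa>_def)
            qed
          qed
          then show ?thesis using small_specD(4)[OF sm[OF j]] zf[OF j] by (simp add: S_def a_def)
        qed
        show "bd Y (m + 1) i e (\<phi> (m + 1) z) \<in> marked Y (m + 1 - 1)"
          using v_hole z(2) v_marked[OF T elementary_conn[OF eB], of q] qp by simp
      qed (use q zc qp in auto)
      then show ?thesis by simp
    qed
    show "?c = act X m (m - 1) u (C (m - 1) T' p)" if "elementary A p m u" "boxmor B (m - 1) n T'" "T = cmp m T' u" for u T'
      using nel[of u] that factors_cmp by blast
    show "?c = b m T" if "p = 0" "const_coord m n T" using free that by (simp add: free_def free0_def)
    show "?c = x" if "p = 0" "m = n" "T = idbox n"
      using free that idbox_not_fac[OF elementary_conn[OF eB]] by (auto simp: free_def free0_def)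
    show "?c = C m T 0" if "1 \<le> p" "collapsed m T p" using free that by (auto simp: free_def)
    show "z \<in> marked X (m + 1)" "\<phi> (m + 1) z = v (m + 1) (apex m T p)" using z by (simp_all add: U_def)
    show "bd X (m + 1) t d z = (if (t, d) = (hole m T p, e) then ?c
            else C m (fc (m + 1) (apex m T p) t d) (if t \<le> dir m T p then 0 else dir m T p))"
      if "1 \<le> t" "t \<le> m + 1" for t d
      using zf[OF that, of d] by (simp add: a_def \<kappa>_def U_def q_def i_def)
  qed
  then show ?thesis by blast
qed

lemma step: "\<exists>r. cell_spec F (m, T, p) r"
proof -
  consider (const) "p = 0" "const_coord m n T" | (collapsed) "1 \<le> p" "collapsed m T p"
    | (reducible) "p = 0 \<longrightarrow> \<not> const_coord m n T" "1 \<le> p \<longrightarrow> \<not> collapsed m T p" "reducible m T p"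
    | (free) "free m T p" | (upper) "1 \<le> p" "\<not> collapsed m T p" "\<not> reducible m T p" "upper m T p"
    | (rest) "p = 0" "\<not> const_coord m n T" "\<not> reducible m T 0" "\<not> free0 m T"
    unfolding free_def by (cases "p = 0") auto
  then have "\<exists>c h. spec F m T p c h"
  proof cases
    case const then show ?thesis by (intro step_const)
  next
    case collapsed then show ?thesis by (rule step_collapsed)
  next
    case reducible then show ?thesis by (intro step_reducible) auto
  next
    case free then show ?thesis by (rule step_free)
  next
    case upper then show ?thesis by (rule step_upper)
  next
    case rest
    \<comment> \<open>With every old quotient and every new connection excluded, the trichotomy for
      box morphisms leaves the identity, where the value is \<open>x\<close>.\<close>
    have no: "\<not> (1 \<le> i \<and> i < m \<and> factors m (conn m i e) T)" "\<not> (elementary A 0 m s \<and> factors m s T)" for i s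
      using rest unfolding free0_def reducible_def by blast+
    from T show ?thesis
    proof (cases rule: boxmor_cases_degenerate)
      case const then show ?thesis using rest by simp
    next
      case id then show ?thesis using rest(1) by (intro step_id)
    next
      case (degen s)
      from degen(1) have "elementary A 0 m s \<or> (\<exists>i. 1 \<le> i \<and> i < m \<and> s = conn m i e)"
        unfolding elementary_0_iff B_eq by blast
      then show ?thesis using no degen(2) by blast
    qed
  qed
  then show ?thesis by (auto simp: cell_spec_def)
qed

end

section \<open>The completed system of cells\<close>

context connection_extension
begin

text \<open>Cells are chosen by well-founded recursion and only the true cubes are kept. Their
  specification gives naturality for faces and elementary quotients; induction on generation extends
  it to all morphisms over \<open>A\<close>.\<close>

theorem extension_exists:
  "\<exists>r. (\<forall>m T. boxmor B m n T \<longrightarrow> r m T \<in> cubes X m) \<and>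
     (\<forall>m T. boxmor B m n T \<longrightarrow> \<phi> m (r m T) = v m T) \<and>
     (\<forall>m T. boxmor B m n T \<longrightarrow> const_coord m n T \<longrightarrow> r m T = b m T) \<and>
     r n (idbox n) = x \<and>
     (\<forall>m T s. boxmor B m n T \<longrightarrow> elementary B 0 m s \<longrightarrow> factors m s T \<longrightarrow> r m T \<in> marked X m) \<and>
     (\<forall>k m T a. boxmor B m n T \<longrightarrow> boxmor A k m a \<longrightarrow> act X k m a (r m T) = r k (cmp k T a))"
proof -
  have step': "\<exists>r. cell_spec F z r" if IH: "\<And>y. (y, z) \<in> cell_order \<Longrightarrow> cell_spec F y (F y)" for F z
  proof -
    obtain m T p where z: "z = (m, T, p)" by (cases z)
    show ?thesis
    proof (cases "boxmor B m n T \<and> p \<le> m")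
      case True
      interpret extension_step A B e n X Y \<phi> v x b F m T p
        by unfold_locales (use True IH z in auto)
      show ?thesis using step z by simp
    next
      case False then show ?thesis by (auto simp: cell_spec_def z)
    qed
  qed
  have "\<exists>F. \<forall>z. cell_spec F z (F z)"
    by (rule dependent_wf_choice[OF wf_cell_order cell_spec_cong step'])
  then obtain F where F: "\<And>z. cell_spec F z (F z)" by blast
  define r where "r m T = fst (F (m, T, 0))" for m T
  have sp: "spec F m T 0 (r m T) (snd (F (m, T, 0)))" if "boxmor B m n T" for m T
    using F[of "(m, T, 0)"] that by (simp add: cell_spec_def r_def)
  note s = specD[OF sp]
  have nat: "act X k m a (r m T) = r k (cmp k T a)" if "boxmor A k m a" "boxmor B m n T" for k m T a
    using that
  proof (induction arbitrary: T rule: boxmor.induct)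
    case (boxmor_id m)
    then show ?case using act_id[OF X s(1)] boxmor_id_right by metis
  next
    case (boxmor_face i m c)
    then show ?case using s(3)[OF boxmor_face(3,1,2), of c] by (simp add: r_def)
  next
    case (boxmor_degen i m)
    have u: "elementary A 0 m (degen m i)" using boxmor_degen by (intro elementary_degen) auto
    show ?case
      using s(5)[OF boxmor_comp[OF boxmor_mono[OF elementary_boxmor[OF u] AB] boxmor_degen(3)] u boxmor_degen(3) refl]
      by (simp add: r_def)
  next
    case (boxmor_conn c i m)
    have u: "elementary A 0 m (conn m i c)" using boxmor_conn by (intro elementary_conn) auto
    show ?case
      using s(5)[OF boxmor_comp[OF boxmor_mono[OF elementary_boxmor[OF u] AB] boxmor_conn(4)] u boxmor_conn(4) refl]
      by (simp add: r_def)
  next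
    case (boxmor_comp k m f l g)
    have "boxmor B m n (cmp m T g)" using boxmor.boxmor_comp[OF boxmor_mono[OF boxmor_comp(2) AB] boxmor_comp(5)] .
    then show ?case
      using act_cmp[OF X boxmor_comp(1,2) s(1)[OF boxmor_comp(5)]] boxmor_comp(3,4,5)
        boxmor_cmp_assoc[OF boxmor_comp(1)] by simp
  qed
  show ?thesis
  proof (intro exI[of _ r] conjI allI impI)
    show "r m T \<in> marked X m" if "boxmor B m n T" "elementary B 0 m s" "factors m s T" for m T s
      using s(4)[OF that(1)] that unfolding thin_def by blast
  qed (use s nat boxmor_id in auto)
qed

end

section \<open>The extended structure\<close>

lemma i_star_simps [simp]:
  "cubes (i_star A X) = cubes X" "marked (i_star A X) = marked X"
  "boxmor A m n f \<Longrightarrow> act (i_star A X) m n f = act X m n f"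
  by (simp_all add: i_star_def)

lemma face_retract: "1 \<le> i \<Longrightarrow> i \<le> n \<Longrightarrow> boxmor B m (n - 1) U \<Longrightarrow> cmp m (degen n i) (cmp m (face n i d) U) = U"
  using boxmor_cmp_assoc[of B m "n - 1" U "degen n i" "face n i d"] degen_face_same[of i n d]
    boxmor_id_left[of B m "n - 1" U] by simp

text \<open>If two composites with different faces coincide, each factor itself passes through the
  other face, so both lie in the common face of codimension two, where \<open>comm\<close> compares
  them. \<open>ok\<close> excludes the missing face of an open box; for a full boundary it is always
  true.\<close>

lemma faces_agree:
  fixes V :: "nat \<Rightarrow> bool \<Rightarrow> cubemap \<Rightarrow> 'a"
  assumes comm: "\<And>j k c c' U. 1 \<le> j \<Longrightarrow> j < k \<Longrightarrow> k \<le> n \<Longrightarrow> ok j c \<Longrightarrow> ok k c' \<Longrightarrow> boxmor B m (n - 1 - 1) U \<Longrightarrow>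
      V j c (cmp m (face (n - 1) (k - 1) c') U) = V k c' (cmp m (face (n - 1) j c) U)"
    and S: "1 \<le> j" "j \<le> n" "boxmor B m (n - 1) S" and "ok j c"
    and S': "1 \<le> k" "k \<le> n" "boxmor B m (n - 1) S'" and "ok k c'"
    and eq: "cmp m (face n j c) S = cmp m (face n k c') S'"
  shows "V j c S = V k c' S'"
proof -
  have less: "V j c S = V k c' S'"
    if S: "1 \<le> j" "j < k" "k \<le> n" "boxmor B m (n - 1) S" "boxmor B m (n - 1) S'" and ok: "ok j c" "ok k c'"
      and eq: "cmp m (face n j c) S = cmp m (face n k c') S'" for j k c c' S S'
  proof -
    have jn: "j \<le> n - 1" "k - 1 \<le> n - 1" "1 \<le> k - 1" "j \<le> n" "1 \<le> k" using S by auto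
    \<comment> \<open>The coordinate inserted by the first face is seen through the second one,
      which makes it a constant coordinate of \<open>S'\<close>.\<close>
    have nth: "S' xs ! (j - 1) = c" if "length xs = m" for xs
    proof -
      have l: "length (S xs) = n - 1" "length (S' xs) = n - 1"
        using boxmor_length[OF S(4) that] boxmor_length[OF S(5) that] by auto
      have idx: "j - 1 < n" "j - 1 < k - 1" using S(1-3) by arith+
      have "face n j c (S xs) ! (j - 1) = c" using face_nth[OF l(1) S(1) jn(4), of "j - 1" c] S jn by simp
      moreover have "face n k c' (S' xs) ! (j - 1) = S' xs ! (j - 1)"
        using face_nth[OF l(2) jn(5) S(3) idx(1), of c'] unfolding if_P[OF idx(2)] .
      moreover have "face n j c (S xs) = face n k c' (S' xs)" using fun_cong[OF eq, of xs] that by simp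
      ultimately show ?thesis by simp
    qed
    define U where "U = cmp m (degen (n - 1) j) S'"
    have U: "boxmor B m (n - 1 - 1) U" unfolding U_def by (rule boxmor_comp[OF S(5) boxmor_degen[OF S(1) jn(1)]])
    have S'U: "S' = cmp m (face (n - 1) j c) U"
      unfolding U_def by (rule const_coord_factor[OF S(5,1) jn(1) nth])
    have f: "boxmor B (n - 1 - 1) (n - 1) (face (n - 1) (k - 1) c')"
      using boxmor_face[OF jn(3,2)] .
    have "cmp m (face n k c') S' = cmp m (cmp (n - 1 - 1) (face n k c') (face (n - 1) j c)) U"
      using boxmor_cmp_assoc[OF U] S'U by simp
    also have "\<dots> = cmp m (face n j c) (cmp m (face (n - 1) (k - 1) c') U)"
      using boxmor_cmp_assoc[OF U] face_face[OF S(1-3), of c' c] by (simp add: numeral_2_eq_2)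
    finally have "S = cmp m (face (n - 1) (k - 1) c') U"
      using eq face_retract[OF S(1) jn(4) S(4), of c] face_retract[OF S(1) jn(4) boxmor_comp[OF U f], of c] by simp
    then show ?thesis using comm[OF S(1-3) ok U] S'U by simp
  qed
  consider "j < k" | "k < j" | "j = k" by linarith
  then show ?thesis
  proof cases
    case 1 then show ?thesis using less[OF S(1) 1 S'(2) S(3) S'(3) assms(5,9) eq] by simp
  next
    case 2 then show ?thesis using less[OF S'(1) 2 S(2) S'(3) S(3) assms(9,5) eq[symmetric]] by simp
  next
    case 3
    have "S = S'" using eq face_retract[OF S, of c] face_retract[OF S', of c'] 3 by simp
    \<comment> \<open>Evaluation at any vertex shows the inserted value; the constant list provides
      one.\<close>
    moreover have "c = c'"
      using fun_cong[OF eq, of "replicate m True"] 3 S boxmor_length[OF S(3), of "replicate m True"]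
        boxmor_length[OF S'(3), of "replicate m True"]
        face_nth[of "S (replicate m True)" n j "j - 1" c] face_nth[of "S' (replicate m True)" n j "j - 1" c'] by simp
    ultimately show ?thesis using 3 by simp
  qed
qed

locale structure_extension =
  fixes A B :: "bool set" and e :: bool
    and X :: "'a mcset" and Y :: "'b mcset" and \<phi> :: "('a, 'b) mcfun"
  assumes B_eq: "B = insert e A" and e_notin: "e \<notin> A"
    and Y: "mcset B Y" and map: "mcmap A X (i_star A Y) \<phi>"
    and fillable: "fillable X (i_star A Y) \<phi>" and saturated: "saturated X (i_star A Y) \<phi>"
begin

lemma AB: "A \<subseteq> B" using B_eq by auto

lemma mcX: "mcset A X" and X: "cset A X" and csY: "cset B Y"
  using map Y unfolding mcmap_def mcset_def by auto

lemma map_cube: "x \<in> cubes X n \<Longrightarrow> \<phi> n x \<in> cubes Y n"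
  using map unfolding mcmap_def by (auto simp: PiE_iff)

lemma map_act: "boxmor A m n g \<Longrightarrow> x \<in> cubes X n \<Longrightarrow> \<phi> m (act X m n g x) = act Y m n g (\<phi> n x)"
  using map unfolding mcmap_def by auto

text \<open>\<open>r\<close> is the system of all cubes \<open>x T\<close>. The last two clauses are
  functoriality in \<open>x\<close>, relative to the systems \<open>F\<close> in lower dimensions:
  for faces of \<open>x\<close>, and for presentations of \<open>x\<close> as
  \<open>y \<rho>\<close> with \<open>y\<close> of smaller dimension.\<close>

inductive ext :: "(nat \<times> 'a \<Rightarrow> nat \<Rightarrow> cubemap \<Rightarrow> 'a) \<Rightarrow> nat \<Rightarrow> 'a \<Rightarrow> (nat \<Rightarrow> cubemap \<Rightarrow> 'a) \<Rightarrow> bool"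
  for F n x r where
  extI: "\<lbrakk>(\<And>m T. boxmor B m n T \<Longrightarrow> r m T \<in> cubes X m);
    (\<And>m T. boxmor B m n T \<Longrightarrow> \<phi> m (r m T) = act Y m n T (\<phi> n x));
    r n (idbox n) = x;
    (\<And>m T s. boxmor B m n T \<Longrightarrow> elementary B 0 m s \<Longrightarrow> factors m s T \<Longrightarrow> r m T \<in> marked X m);
    (\<And>k m T a. boxmor B m n T \<Longrightarrow> boxmor A k m a \<Longrightarrow> act X k m a (r m T) = r k (cmp k T a));
    (\<And>j c m S. 1 \<le> j \<Longrightarrow> j \<le> n \<Longrightarrow> boxmor B m (n - 1) S \<Longrightarrow>
        r m (cmp m (face n j c) S) = F (n - 1, bd X n j c x) m S);
    (\<And>k y \<rho> m T. k < n \<Longrightarrow> y \<in> cubes X k \<Longrightarrow> boxmor B n k \<rho> \<Longrightarrow> F (k, y) n \<rho> = x \<Longrightarrow> boxmor B m n T \<Longrightarrow>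
        r m T = F (k, y) m (cmp m \<rho> T))\<rbrakk>
    \<Longrightarrow> ext F n x r"

lemma extD:
  assumes "ext F n x r"
  shows "\<And>m T. boxmor B m n T \<Longrightarrow> r m T \<in> cubes X m"
    and "\<And>m T. boxmor B m n T \<Longrightarrow> \<phi> m (r m T) = act Y m n T (\<phi> n x)"
    and "r n (idbox n) = x"
    and "\<And>m T s. boxmor B m n T \<Longrightarrow> elementary B 0 m s \<Longrightarrow> factors m s T \<Longrightarrow> r m T \<in> marked X m"
    and "\<And>k m T a. boxmor B m n T \<Longrightarrow> boxmor A k m a \<Longrightarrow> act X k m a (r m T) = r k (cmp k T a)"
    and "\<And>j c m S. 1 \<le> j \<Longrightarrow> j \<le> n \<Longrightarrow> boxmor B m (n - 1) S \<Longrightarrow>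
        r m (cmp m (face n j c) S) = F (n - 1, bd X n j c x) m S"
    and "\<And>k y \<rho> m T. k < n \<Longrightarrow> y \<in> cubes X k \<Longrightarrow> boxmor B n k \<rho> \<Longrightarrow> F (k, y) n \<rho> = x \<Longrightarrow> boxmor B m n T \<Longrightarrow>
        r m T = F (k, y) m (cmp m \<rho> T)"
  using assms by (cases, blast)+

definition ext_spec :: "(nat \<times> 'a \<Rightarrow> nat \<Rightarrow> cubemap \<Rightarrow> 'a) \<Rightarrow> nat \<times> 'a \<Rightarrow> (nat \<Rightarrow> cubemap \<Rightarrow> 'a) \<Rightarrow> bool" where
  "ext_spec F z r \<longleftrightarrow> snd z \<in> cubes X (fst z) \<longrightarrow> ext F (fst z) (snd z) r"

lemma ext_spec_cong_imp:
  assumes eq: "\<And>z. (z, y) \<in> measure fst \<Longrightarrow> F z = G z" and Q: "ext_spec F y r"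
  shows "ext_spec G y r"
  unfolding ext_spec_def
proof
  assume x: "snd y \<in> cubes X (fst y)"
  then have "ext F (fst y) (snd y) r" using Q by (simp add: ext_spec_def)
  note s = extD[OF this]
  have eq': "F (k, w) = G (k, w)" if "k < fst y" for k w using eq that by simp
  show "ext G (fst y) (snd y) r"
  proof (rule extI)
    show "r m (cmp m (face (fst y) j c) S) = G (fst y - 1, bd X (fst y) j c (snd y)) m S"
      if "1 \<le> j" "j \<le> fst y" "boxmor B m (fst y - 1) S" for j c m S
      using s(6)[OF that] eq'[of "fst y - 1"] that by simp
    show "r m T = G (k, w) m (cmp m \<rho> T)"
      if "k < fst y" "w \<in> cubes X k" "boxmor B (fst y) k \<rho>" "G (k, w) (fst y) \<rho> = snd y" "boxmor B m (fst y) T" for k w \<rho> m T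
      using s(7)[OF that(1-3) _ that(5)] eq'[OF that(1)] that(4) by simp
  qed (fact s(1-5))+
qed

lemma ext_spec_cong: "(\<And>z. (z, y) \<in> measure fst \<Longrightarrow> F z = G z) \<Longrightarrow> ext_spec F y r = ext_spec G y r"
  using ext_spec_cong_imp[of y F G r] ext_spec_cong_imp[of y G F r] by metis

text \<open>If the dimension rises along \<open>\<rho>\<close>, the last clause of
  \<open>ext\<close> applies. Otherwise \<open>\<rho>\<close> is the identity or has a constant
  coordinate, and in the latter case \<open>y\<close> is replaced by one of its faces.\<close>

lemma ext_functorial:
  assumes Q: "\<And>k y. k < N \<Longrightarrow> y \<in> cubes X k \<Longrightarrow> ext F k y (F (k, y))"
    and "k < N" "l < N" "y \<in> cubes X k" "boxmor B l k \<rho>" "boxmor B m l T"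
  shows "F (l, F (k, y) l \<rho>) m T = F (k, y) m (cmp m \<rho> T)"
  using assms(2-)
proof (induction k arbitrary: y \<rho> rule: less_induct)
  case (less k)
  note s = extD[OF Q[OF less.prems(1,3)]]
  show ?case
  proof (cases "k < l")
    case True
    then show ?thesis
      using extD(7)[OF Q[OF less.prems(2) s(1)[OF less.prems(4)]] True less.prems(3,4) refl less.prems(5)] by simp
  next
    case kl: False
    show ?thesis
    proof (cases "const_coord l k \<rho>")
      case True
      obtain j c S where S: "1 \<le> j" "j \<le> k" "boxmor B l (k - 1) S" "\<rho> = cmp l (face k j c) S"
        using const_coord_obtain[OF less.prems(4) True] .
      have d: "bd X k j c y \<in> cubes X (k - 1)" using bd_closed[OF X less.prems(3) S(1,2)] .
      have "F (k, y) l \<rho> = F (k - 1, bd X k j c y) l S" using s(6)[OF S(1-3)] S(4) by simp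
      moreover have "F (k, y) m (cmp m \<rho> T) = F (k - 1, bd X k j c y) m (cmp m S T)"
        using s(6)[OF S(1,2) boxmor_comp[OF less.prems(5) S(3)], of c] S(4) boxmor_cmp_assoc[OF less.prems(5)] by simp
      ultimately show ?thesis
        using less.IH[of "k - 1", OF _ _ less.prems(2) d S(3) less.prems(5)] S(1,2) less.prems(1) by simp
    next
      case False
      then have "k = l" using not_const_le[OF less.prems(4)] kl by simp
      then have "\<rho> = idbox k" using not_const_eq less.prems(4) False by blast
      then show ?thesis using s(3) boxmor_id_left[OF less.prems(5)] \<open>k = l\<close> by simp
    qed
  qed
qed

text \<open>An argument in the style of Eilenberg and Zilber. Among the presentations of
  \<open>x\<close> one of least dimension \<open>k0\<close> is chosen. Minimality prevents constant
  coordinates in \<open>\<rho>0\<close> and makes it the only such presentation over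
  \<open>y0\<close>; every other presentation of \<open>x\<close> is then compared with it.\<close>

lemma ext_degenerate:
  assumes Q: "\<And>k y. k < n \<Longrightarrow> y \<in> cubes X k \<Longrightarrow> ext F k y (F (k, y))"
    and x: "x \<in> cubes X n"
    and deg: "\<exists>k y \<rho>. k < n \<and> y \<in> cubes X k \<and> boxmor B n k \<rho> \<and> F (k, y) n \<rho> = x"
  shows "\<exists>r. ext F n x r"
proof -
  define k0 where "k0 = (LEAST k. \<exists>y \<rho>. k < n \<and> y \<in> cubes X k \<and> boxmor B n k \<rho> \<and> F (k, y) n \<rho> = x)"
  have "\<exists>y \<rho>. k0 < n \<and> y \<in> cubes X k0 \<and> boxmor B n k0 \<rho> \<and> F (k0, y) n \<rho> = x"
    unfolding k0_def using deg by (rule LeastI_ex)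
  then obtain y0 \<rho>0 where k0: "k0 < n" and y0: "y0 \<in> cubes X k0" and \<rho>0: "boxmor B n k0 \<rho>0" "F (k0, y0) n \<rho>0 = x"
    by blast
  have minimal: False if "k < k0" "y \<in> cubes X k" "boxmor B n k \<rho>" "F (k, y) n \<rho> = x" for k y \<rho>
  proof -
    have "k < n" using that(1) k0 by simp
    then show False using not_less_Least[OF that(1)[unfolded k0_def]] that(2-4) by blast
  qed
  note s = extD[OF Q[OF k0 y0]]
  have functorial: "F (l, F (k, y) l \<rho>) m T = F (k, y) m (cmp m \<rho> T)"
    if "k < n" "l < n" "y \<in> cubes X k" "boxmor B l k \<rho>" "boxmor B m l T" for k l y \<rho> m T
    by (rule ext_functorial[OF _ that]) (rule Q)
  have nc: "\<not> const_coord n k0 \<rho>" if \<rho>: "boxmor B n k0 \<rho>" "F (k0, y0) n \<rho> = x" for \<rho>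
  proof
    assume "const_coord n k0 \<rho>"
    then obtain j c S where S: "1 \<le> j" "j \<le> k0" "boxmor B n (k0 - 1) S" "\<rho> = cmp n (face k0 j c) S"
      using const_coord_obtain[OF \<rho>(1)] by blast
    have "F (k0 - 1, bd X k0 j c y0) n S = x" using s(6)[OF S(1-3), of c] S(4) \<rho>(2) by simp
    then show False using minimal[OF _ bd_closed[OF X y0 S(1,2)] S(3)] S(1,2) by simp
  qed
  \<comment> \<open>If \<open>\<rho>' d\<close> were not the identity, it would have a constant
    coordinate. As \<open>d\<close> is a composite of faces, restricting \<open>x\<close> along it
    gives \<open>y0\<close> in two ways, so \<open>y0\<close> would come from one of its own faces
    and \<open>x\<close> from a cube of dimension below \<open>k0\<close>.\<close>
  have sec: "cmp k0 \<rho>' d = idbox k0"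
    if \<rho>: "boxmor B n k0 \<rho>" "F (k0, y0) n \<rho> = x" "boxmor B n k0 \<rho>'" "F (k0, y0) n \<rho>' = x"
      and d: "monic k0 n d" "cmp k0 \<rho> d = idbox k0" for \<rho> \<rho>' d
  proof (rule ccontr)
    assume ne: "cmp k0 \<rho>' d \<noteq> idbox k0"
    have dB: "boxmor B k0 n d" and dA: "boxmor A k0 n d" using monic_boxmor[OF d(1)] by auto
    have b: "boxmor B k0 k0 (cmp k0 \<rho>' d)" using boxmor_comp[OF dB \<rho>(3)] .
    have y: "F (k0, y0) k0 (cmp k0 \<rho>' d) = y0"
      using s(5)[OF \<rho>(1) dA] s(5)[OF \<rho>(3) dA] \<rho>(2,4) d(2) s(3) by simp
    have "const_coord k0 k0 (cmp k0 \<rho>' d)" using not_const_eq[OF b] ne by blast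
    then obtain j c S where S: "1 \<le> j" "j \<le> k0" "boxmor B k0 (k0 - 1) S" "cmp k0 \<rho>' d = cmp k0 (face k0 j c) S"
      using const_coord_obtain[OF b] by blast
    define w where "w = bd X k0 j c y0"
    have w: "w \<in> cubes X (k0 - 1)" unfolding w_def using bd_closed[OF X y0 S(1,2)] .
    have "F (k0 - 1, w) k0 S = y0" using s(6)[OF S(1-3), of c] S(4) y by (simp add: w_def)
    then have "F (k0 - 1, w) n (cmp n S \<rho>0) = x"
      using functorial[of "k0 - 1" k0 w S n \<rho>0] k0 w S(3) \<rho>0 by simp
    then show False using minimal[OF _ w boxmor_comp[OF \<rho>0(1) S(3)]] S(1,2) by simp
  qed
  have unique: "\<rho> = \<rho>0" if \<rho>: "boxmor B n k0 \<rho>" "F (k0, y0) n \<rho> = x" for \<rho>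
    using sections_determine[OF \<rho>(1) \<rho>0(1) nc[OF \<rho>] nc[OF \<rho>0]] sec[OF \<rho> \<rho>0] sec[OF \<rho>0 \<rho>] by blast
  define r where "r m T = F (k0, y0) m (cmp m \<rho>0 T)" for m T
  have agree: "F (k, y) m (cmp m \<rho> T) = r m T"
    if "k < n" "y \<in> cubes X k" "boxmor B n k \<rho>" "F (k, y) n \<rho> = x" "boxmor B m n T" for k y \<rho> m T
    using that
  proof (induction k arbitrary: y \<rho> rule: less_induct)
    case (less k)
    note s' = extD[OF Q[OF less.prems(1,2)]]
    show ?case
    proof (cases "const_coord n k \<rho>")
      case True
      obtain j c S where S: "1 \<le> j" "j \<le> k" "boxmor B n (k - 1) S" "\<rho> = cmp n (face k j c) S"
        using const_coord_obtain[OF less.prems(3) True] .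
      have d: "bd X k j c y \<in> cubes X (k - 1)" using bd_closed[OF X less.prems(2) S(1,2)] .
      have "F (k - 1, bd X k j c y) n S = x" using s'(6)[OF S(1-3)] S(4) less.prems(4) by simp
      then have "F (k - 1, bd X k j c y) m (cmp m S T) = r m T"
        using less.IH[of "k - 1", OF _ _ d S(3) _ less.prems(5)] S(1,2) less.prems(1) by simp
      then show ?thesis
        using s'(6)[OF S(1,2) boxmor_comp[OF less.prems(5) S(3)], of c] S(4) boxmor_cmp_assoc[OF less.prems(5)] by simp
    next
      case False
      obtain d where d: "monic k n d" "cmp k \<rho> d = idbox k" using not_const_section[OF less.prems(3) False] .
      have dB: "boxmor B k n d" and dA: "boxmor A k n d" using monic_boxmor[OF d(1)] by auto
      have y: "F (k0, y0) k (cmp k \<rho>0 d) = y"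
        using s'(5)[OF less.prems(3) dA] s(5)[OF \<rho>0(1) dA] \<rho>0(2) less.prems(4) d(2) s'(3) by simp
      \<comment> \<open>The section \<open>d\<close> recovers \<open>y\<close> from
        \<open>x\<close>, hence from \<open>y0\<close> along \<open>\<rho>0 d\<close>. Substituted
        into the presentation of \<open>x\<close> over \<open>y\<close> this gives one over
        \<open>y0\<close>, and uniqueness identifies \<open>\<rho>1\<close> with
        \<open>\<rho>0\<close>.\<close>
      define \<rho>1 where "\<rho>1 = cmp n (cmp k \<rho>0 d) \<rho>"
      have b: "boxmor B k k0 (cmp k \<rho>0 d)" using boxmor_comp[OF dB \<rho>0(1)] .
      have b1: "boxmor B n k0 \<rho>1" unfolding \<rho>1_def using boxmor_comp[OF less.prems(3) b] .
      have *: "F (k, y) l (cmp l \<rho> U) = F (k0, y0) l (cmp l \<rho>1 U)" if "boxmor B l n U" for l U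
        using functorial[OF _ _ y0 b boxmor_comp[OF that less.prems(3)]] k0 less.prems(1) y
          boxmor_cmp_assoc[OF that] unfolding \<rho>1_def by simp
      have "F (k0, y0) n \<rho>1 = x"
        using *[OF boxmor_id] boxmor_id_right[OF b1] boxmor_id_right[OF less.prems(3)] less.prems(4) by simp
      then have "\<rho>1 = \<rho>0" using unique b1 by blast
      then show ?thesis using *[OF less.prems(5)] by (simp add: r_def)
    qed
  qed
  have comp: "boxmor B m k0 (cmp m \<rho>0 T)" if "boxmor B m n T" for m T
    using boxmor_comp[OF that \<rho>0(1)] .
  have "ext F n x r"
  proof (rule extI)
    show "r m T \<in> cubes X m" if "boxmor B m n T" for m T
      using s(1)[OF comp[OF that]] by (simp add: r_def)
    show "\<phi> m (r m T) = act Y m n T (\<phi> n x)" if "boxmor B m n T" for m T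
      using s(2)[OF comp[OF that]] s(2)[OF \<rho>0(1)] \<rho>0(2) act_cmp[OF csY that \<rho>0(1) map_cube[OF y0]]
      by (simp add: r_def)
    show "r n (idbox n) = x" using boxmor_id_right[OF \<rho>0(1)] \<rho>0(2) by (simp add: r_def)
    show "r m T \<in> marked X m" if "boxmor B m n T" "elementary B 0 m u" "factors m u T" for m T u
      using s(4)[OF comp[OF that(1)] that(2) factors_cmp_left[OF that(3)]] by (simp add: r_def)
    show "act X k m a (r m T) = r k (cmp k T a)" if "boxmor B m n T" "boxmor A k m a" for k m T a
      using s(5)[OF comp[OF that(1)] that(2)] boxmor_cmp_assoc[OF that(2)] by (simp add: r_def)
    show "r m (cmp m (face n j c) S) = F (n - 1, bd X n j c x) m S"
      if S: "1 \<le> j" "j \<le> n" "boxmor B m (n - 1) S" for j c m S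
    proof -
      have f: "boxmor C (n - 1) n (face n j c)" for C using boxmor_face[OF S(1,2)] .
      have "bd X n j c x = F (k0, y0) (n - 1) (cmp (n - 1) \<rho>0 (face n j c))"
        using s(5)[OF \<rho>0(1) f] \<rho>0(2) by simp
      then have "F (n - 1, bd X n j c x) m S = F (k0, y0) m (cmp m (cmp (n - 1) \<rho>0 (face n j c)) S)"
        using functorial[of k0 "n - 1" y0 "cmp (n - 1) \<rho>0 (face n j c)" m S]
          k0 y0 boxmor_comp[OF f \<rho>0(1)] S by simp
      then show ?thesis using boxmor_cmp_assoc[OF S(3)] by (simp add: r_def)
    qed
    show "r m T = F (k, y) m (cmp m \<rho> T)"
      if "k < n" "y \<in> cubes X k" "boxmor B n k \<rho>" "F (k, y) n \<rho> = x" "boxmor B m n T" for k y \<rho> m T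
      using agree[OF that] by simp
  qed
  then show ?thesis by blast
qed

lemma boundary_agree:
  assumes Q: "\<And>k y. k < n \<Longrightarrow> y \<in> cubes X k \<Longrightarrow> ext F k y (F (k, y))" and x: "x \<in> cubes X n"
    and S: "1 \<le> j" "j \<le> n" "boxmor B m (n - 1) S" and S': "1 \<le> k" "k \<le> n" "boxmor B m (n - 1) S'"
    and eq: "cmp m (face n j c) S = cmp m (face n k c') S'"
  shows "F (n - 1, bd X n j c x) m S = F (n - 1, bd X n k c' x) m S'"
proof (rule faces_agree[where ok = "\<lambda>_ _. True" and V = "\<lambda>j c S. F (n - 1, bd X n j c x) m S", OF _ S _ S' _ eq])
  fix j k c c' U
  assume jk: "1 \<le> j" "j < k" "k \<le> n" and U: "boxmor B m (n - 1 - 1) U"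
  have jn: "j \<le> n - 1" "k - 1 \<le> n - 1" "1 \<le> k - 1" "j \<le> n" "1 \<le> k" using jk by auto
  have "F (n - 1, bd X n j c x) m (cmp m (face (n - 1) (k - 1) c') U) =
      F (n - 1 - 1, bd X (n - 1) (k - 1) c' (bd X n j c x)) m U"
    using extD(6)[OF Q[OF _ bd_closed[OF X x jk(1) jn(4)]] jn(3,2) U] jk by simp
  moreover have "F (n - 1, bd X n k c' x) m (cmp m (face (n - 1) j c) U) =
      F (n - 1 - 1, bd X (n - 1) j c (bd X n k c' x)) m U"
    using extD(6)[OF Q[OF _ bd_closed[OF X x jn(5) jk(3)]] jk(1) jn(1) U] jk by simp
  ultimately show "F (n - 1, bd X n j c x) m (cmp m (face (n - 1) (k - 1) c') U) =
      F (n - 1, bd X n k c' x) m (cmp m (face (n - 1) j c) U)"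
    using bd_bd[OF X x jk, of c c'] by simp
qed auto

text \<open>The clause on presentations is vacuous, so values are prescribed only where
  \<open>T\<close> passes through a face of \<open>x\<close>. These form \<open>b\<close>, which is
  well defined by \<open>boundary_agree\<close>; the remaining values come from
  \<open>extension_exists\<close>.\<close>

lemma ext_nondegenerate:
  assumes Q: "\<And>k y. k < n \<Longrightarrow> y \<in> cubes X k \<Longrightarrow> ext F k y (F (k, y))"
    and x: "x \<in> cubes X n"
    and nondeg: "\<nexists>k y \<rho>. k < n \<and> y \<in> cubes X k \<and> boxmor B n k \<rho> \<and> F (k, y) n \<rho> = x"
  shows "\<exists>r. ext F n x r"
proof -
  define b where "b m T = (SOME w. \<exists>j c S. 1 \<le> j \<and> j \<le> n \<and> boxmor B m (n - 1) S \<and>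
    T = cmp m (face n j c) S \<and> w = F (n - 1, bd X n j c x) m S)" for m T
  have b: "b m (cmp m (face n j c) S) = F (n - 1, bd X n j c x) m S"
    if S: "1 \<le> j" "j \<le> n" "boxmor B m (n - 1) S" for m j c S
    unfolding b_def
  proof (rule some_equality)
    show "\<exists>j' c' S'. 1 \<le> j' \<and> j' \<le> n \<and> boxmor B m (n - 1) S' \<and> cmp m (face n j c) S = cmp m (face n j' c') S' \<and>
        F (n - 1, bd X n j c x) m S = F (n - 1, bd X n j' c' x) m S'" using S by blast
    fix w assume "\<exists>j' c' S'. 1 \<le> j' \<and> j' \<le> n \<and> boxmor B m (n - 1) S' \<and>
      cmp m (face n j c) S = cmp m (face n j' c') S' \<and> w = F (n - 1, bd X n j' c' x) m S'"
    then obtain j' c' S' where S': "1 \<le> j'" "j' \<le> n" "boxmor B m (n - 1) S'"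
      "cmp m (face n j c) S = cmp m (face n j' c') S'" "w = F (n - 1, bd X n j' c' x) m S'" by blast
    have "F (n - 1, bd X n j c x) m S = F (n - 1, bd X n j' c' x) m S'"
      by (rule boundary_agree[OF _ x S S'(1-4)]) (rule Q)
    then show "w = F (n - 1, bd X n j c x) m S" using S'(5) by simp
  qed
  have s: "ext F (n - 1) (bd X n j c x) (F (n - 1, bd X n j c x))" if "1 \<le> j" "j \<le> n" for j c
    using Q[of "n - 1"] bd_closed[OF X x that] that by simp
  interpret connection_extension A B e n X "i_star A Y" \<phi> "\<lambda>m T. act Y m n T (\<phi> n x)" x b
  proof
    show "act Y m n T (\<phi> n x) \<in> cubes (i_star A Y) m" if "boxmor B m n T" for m T
      using act_closed[OF csY that map_cube[OF x]] by simp
    show "act (i_star A Y) k m a (act Y m n T (\<phi> n x)) = act Y k n (cmp k T a) (\<phi> n x)"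
      if "boxmor B m n T" "boxmor A k m a" for k m T a
      using act_cmp[OF csY boxmor_mono[OF that(2) AB] that(1) map_cube[OF x]] that by simp
    show "act Y m n T (\<phi> n x) \<in> marked (i_star A Y) m"
      if "boxmor B m n T" "elementary B 0 m s" "factors m s T" for m T s
      using act_marked_degenerate[OF Y that(2,3,1) map_cube[OF x]] by simp
    show "\<phi> n x = act Y n n (idbox n) (\<phi> n x)" using act_id[OF csY map_cube[OF x]] by simp
    show "b m T \<in> cubes X m" "\<phi> m (b m T) = act Y m n T (\<phi> n x)"
      "\<And>s. elementary B 0 m s \<Longrightarrow> factors m s T \<Longrightarrow> b m T \<in> marked X m"
      "\<And>k a. boxmor A k m a \<Longrightarrow> act X k m a (b m T) = b k (cmp k T a)"
      if T: "boxmor B m n T" "const_coord m n T" for m T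
    proof -
      obtain j c S where S: "1 \<le> j" "j \<le> n" "boxmor B m (n - 1) S" "T = cmp m (face n j c) S"
        using const_coord_obtain[OF T] .
      note bT = b[OF S(1-3), of c, folded S(4)]
      note s' = extD[OF s[OF S(1,2), of c]]
      show "b m T \<in> cubes X m" using s'(1)[OF S(3)] bT by simp
      have "\<phi> (n - 1) (bd X n j c x) = bd Y n j c (\<phi> n x)" using map_act[OF boxmor_face[OF S(1,2)] x] .
      then show "\<phi> m (b m T) = act Y m n T (\<phi> n x)"
        using s'(2)[OF S(3)] bT S(4) act_cmp[OF csY S(3) boxmor_face[OF S(1,2)] map_cube[OF x], of c] by simp
      have ST: "S = cmp m (degen n j) T"
        unfolding S(4) using face_retract[OF S(1-3)] by simp
      show "b m T \<in> marked X m" if "elementary B 0 m u" "factors m u T" for u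
        using s'(4)[OF S(3) that(1)] factors_cmp_left[OF that(2)] ST bT by metis
      show "act X k m a (b m T) = b k (cmp k T a)" if a: "boxmor A k m a" for k a
        using s'(5)[OF S(3) a] bT b[OF S(1,2) boxmor_comp[OF boxmor_mono[OF a AB] S(3)], of c] S(4)
          boxmor_cmp_assoc[OF a] by simp
    qed
    show "b (n - 1) (face n j c) = bd X n j c x" if j: "1 \<le> j" "j \<le> n" for j c
      using b[OF j boxmor_id, of c] extD(3)[OF s[OF j, of c]] boxmor_id_right[OF boxmor_face[OF j, of B c]] by simp
  qed (fact B_eq e_notin map fillable saturated x)+
  obtain r where r: "\<And>m T. boxmor B m n T \<Longrightarrow> r m T \<in> cubes X m"
    "\<And>m T. boxmor B m n T \<Longrightarrow> \<phi> m (r m T) = act Y m n T (\<phi> n x)"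
    "\<And>m T. boxmor B m n T \<Longrightarrow> const_coord m n T \<Longrightarrow> r m T = b m T"
    "r n (idbox n) = x"
    "\<And>m T s. boxmor B m n T \<Longrightarrow> elementary B 0 m s \<Longrightarrow> factors m s T \<Longrightarrow> r m T \<in> marked X m"
    "\<And>k m T a. boxmor B m n T \<Longrightarrow> boxmor A k m a \<Longrightarrow> act X k m a (r m T) = r k (cmp k T a)"
    using extension_exists by blast
  have "ext F n x r"
  proof (rule extI)
    show "r m (cmp m (face n j c) S) = F (n - 1, bd X n j c x) m S"
      if S: "1 \<le> j" "j \<le> n" "boxmor B m (n - 1) S" for j c m S
      using r(3)[OF boxmor_comp[OF S(3) boxmor_face[OF S(1,2)]] const_coord_face[OF S]] b[OF S] by simp
  qed (use r nondeg in blast)+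
  then show ?thesis by blast
qed

text \<open>Recursion on dimension yields compatible systems. \<open>functorial\<close> is the
  composition law of the new structure, and naturality over \<open>A\<close>, evaluated at the
  identity, says that it restricts to the old one. Cubes and markings are unchanged.\<close>

theorem structure_exists:
  obtains X' where "mcmap B X' Y \<phi>" "i_star A X' = X"
proof -
  have step: "\<exists>r. ext_spec F z r" if IH: "\<And>y. (y, z) \<in> measure fst \<Longrightarrow> ext_spec F y (F y)" for F z
  proof (cases "snd z \<in> cubes X (fst z)")
    case True
    have Q: "ext F k y (F (k, y))" if "k < fst z" "y \<in> cubes X k" for k y
      using IH[of "(k, y)"] that by (simp add: ext_spec_def)
    show ?thesis
      using ext_degenerate[OF Q True] ext_nondegenerate[OF Q True] unfolding ext_spec_def by blast
  next
    case False then show ?thesis by (simp add: ext_spec_def)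
  qed
  have "\<exists>F. \<forall>z. ext_spec F z (F z)"
    by (rule dependent_wf_choice[OF wf_measure ext_spec_cong step])
  then obtain F where "\<And>z. ext_spec F z (F z)" by blast
  then have F: "ext F n x (F (n, x))" if "x \<in> cubes X n" for n x
    using that by (metis ext_spec_def fst_conv snd_conv)
  note s = extD[OF F]
  have functorial: "F (l, F (k, y) l \<rho>) m T = F (k, y) m (cmp m \<rho> T)"
    if "y \<in> cubes X k" "boxmor B l k \<rho>" "boxmor B m l T" for k l m y \<rho> T
    \<comment> \<open>The strict bound only has to exceed both dimensions, as the systems now exist
      everywhere.\<close>
    by (rule ext_functorial[of "Suc (max k l)", OF F _ _ that]) auto
  define X' where "X' = X\<lparr>act := \<lambda>m n f. if boxmor B m n f then (\<lambda>x\<in>cubes X n. F (n, x) m f) else (\<lambda>_. undefined)\<rparr>"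
  have X'_simps: "cubes X' = cubes X" "marked X' = marked X"
    "act X' m n f x = F (n, x) m f" if "boxmor B m n f" "x \<in> cubes X n" for m n f x
    using that by (simp_all add: X'_def)
  have cX': "cubes X' = cubes X" and mX': "marked X' = marked X" by (simp_all add: X'_def)
  have cs: "cset B X'"
    unfolding cset_def cX'
  proof (intro conjI allI impI)
    show "act X' m n f \<in> cubes X n \<rightarrow>\<^sub>E cubes X m" if "boxmor B m n f" for m n f
      using that s(1) by (auto simp: X'_def)
    show "act X' m n f = (\<lambda>_. undefined)" if "\<not> boxmor B m n f" for m n f
      using that by (simp add: X'_def)
    show "act X' n n (idbox n) = (\<lambda>x\<in>cubes X n. x)" for n
      using s(3) boxmor_id by (auto simp: X'_def fun_eq_iff)
    show "act X' k n (cmp k g f) = compose (cubes X n) (act X' k m f) (act X' m n g)"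
      if "boxmor B k m f" "boxmor B m n g" for k m n f g
    proof
      fix x
      show "act X' k n (cmp k g f) x = compose (cubes X n) (act X' k m f) (act X' m n g) x"
        using that boxmor_comp[OF that] functorial[OF _ that(2,1)] s(1)[OF _ that(2)]
        by (cases "x \<in> cubes X n") (simp_all add: X'_def compose_def)
    qed
  qed
  have degenerate: "act X' m (m - 1) u y \<in> marked X m" if u: "elementary B 0 m u" "y \<in> cubes X (m - 1)" for m u y
    using s(4)[OF u(2) elementary_boxmor[OF u(1)] u(1)] X'_simps(3)[OF elementary_boxmor[OF u(1)] u(2)] by (simp add: factors_def)
  have mc: "mcset B X'"
    unfolding mcset_def
  proof (intro conjI allI impI cs)
    show "marked X' n \<subseteq> cubes X' n" "marked X' 0 = {}" for n
      using mcX unfolding mcset_def cX' mX' by auto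
    show "x \<in> marked X' n" if "degenerate B X' n x" for n x
      using that unfolding degenerate_def cX' mX'
    proof (elim disjE exE conjE)
      fix i y assume "1 \<le> i" "i \<le> n" "y \<in> cubes X (n - 1)" "x = act X' n (n - 1) (degen n i) y"
      then show "x \<in> marked X n" using degenerate[OF elementary_degen[of 0 i n B]] by simp
    next
      fix i c y assume "c \<in> B" "1 \<le> i" "i \<le> n - 1" "y \<in> cubes X (n - 1)" "x = act X' n (n - 1) (conn n i c) y"
      then show "x \<in> marked X n" using degenerate[OF elementary_conn[of c B 0 i n]] by simp
    qed
  qed
  have "mcmap B X' Y \<phi>"
    unfolding mcmap_def
  proof (intro conjI allI impI ballI mc Y)
    show "\<phi> n \<in> cubes X' n \<rightarrow>\<^sub>E cubes Y n" for n using map unfolding mcmap_def cX' by simp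
    show "\<phi> m (act X' m n g x) = act Y m n g (\<phi> n x)" if "boxmor B m n g" "x \<in> cubes X' n" for m n g x
      using s(2) X'_simps(3) that unfolding cX' by simp
    show "\<phi> n x \<in> marked Y n" if "x \<in> marked X' n" for n x
      using map that unfolding mcmap_def mX' by simp
  qed
  moreover have "i_star A X' = X"
  proof -
    have "(if boxmor A m n f then act X' m n f else (\<lambda>_. undefined)) = act X m n f" for m n f
    proof (cases "boxmor A m n f")
      case True
      have "act X' m n f x = act X m n f x" if "x \<in> cubes X n" for x
        using s(5)[OF that boxmor_id True] s(3)[OF that] boxmor_id_left[OF True] X'_simps(3)[OF boxmor_mono[OF True AB] that] by simp
      moreover have "act X m n f \<in> extensional (cubes X n)" "act X' m n f \<in> extensional (cubes X n)"
        using X True cs boxmor_mono[OF True AB] unfolding cset_def cX' by (auto simp: PiE_iff)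
      ultimately show ?thesis using True by (auto intro: extensionalityI)
    next
      case False then show ?thesis using X unfolding cset_def by auto
    qed
    then show ?thesis unfolding i_star_def by (simp add: X'_def)
  qed
  ultimately show thesis by (rule that)
qed

end

section \<open>The generators\<close>

lemma standard_cube_cubes [simp]: "cubes (standard_cube A n) m = {g. boxmor A m n g}"
  by (simp add: standard_cube_def Let_def)

lemma standard_cube_act:
  "act (standard_cube A n) k m f = (if boxmor A k m f then (\<lambda>g\<in>{g. boxmor A m n g}. cmp k g f) else (\<lambda>_. undefined))"
  by (simp add: standard_cube_def Let_def)

lemma standard_cube_marked:
  "g \<in> marked (standard_cube A n) m \<longleftrightarrow> boxmor A m n g \<and> (\<exists>s. elementary A 0 m s \<and> factors m s g)" (is "?L \<longleftrightarrow> ?R")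
proof
  have act: "act (standard_cube A n) m (m - 1) s g' = cmp m g' s" if "elementary A 0 m s" "boxmor A (m - 1) n g'" for s g'
    using that elementary_boxmor by (simp add: standard_cube_act)
  have marked: "marked (standard_cube A n) m = {g. degenerate A (standard_cube A n) m g}"
    unfolding degenerate_def by (simp add: standard_cube_def Let_def degenerate_def)
  {
    assume ?L
    then have "degenerate A (standard_cube A n) m g" unfolding marked by simp
    then obtain s g' where s: "elementary A 0 m s" "boxmor A (m - 1) n g'" "g = act (standard_cube A n) m (m - 1) s g'"
      unfolding degenerate_def
    proof (elim disjE exE conjE)
      fix i y assume "1 \<le> i" "i \<le> m" "y \<in> cubes (standard_cube A n) (m - 1)"
        "g = act (standard_cube A n) m (m - 1) (degen m i) y"
      then show thesis using that[of "degen m i" y] elementary_degen[of 0 i m A] by auto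
    next
      fix i c y assume "c \<in> A" "1 \<le> i" "i \<le> m - 1" "y \<in> cubes (standard_cube A n) (m - 1)"
        "g = act (standard_cube A n) m (m - 1) (conn m i c) y"
      then show thesis using that[of "conn m i c" y] elementary_conn[of c A 0 i m] by auto
    qed
    then show ?R using act[OF s(1,2)] boxmor_comp[OF elementary_boxmor[OF s(1)] s(2)] factors_cmp by auto
  }
  {
    assume ?R
    then obtain s where g: "boxmor A m n g" and s: "elementary A 0 m s" "factors m s g" by blast
    obtain g' where g': "boxmor A (m - 1) n g'" "g = cmp m g' s" using elementary_factor[OF s g] .
    then have eq: "g = act (standard_cube A n) m (m - 1) s g'" using act[OF s(1)] by simp
    from s(1) have "degenerate A (standard_cube A n) m g"
      unfolding elementary_0_iff
    proof (elim disjE exE conjE)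
      fix i assume "1 \<le> i" "i \<le> m" "s = degen m i"
      then show ?thesis unfolding degenerate_def using eq g'(1)
        by (intro disjI1 exI[of _ i] exI[of _ g']) simp
    next
      fix i c assume "c \<in> A" "1 \<le> i" "i < m" "s = conn m i c"
      moreover from this have "i \<le> m - 1" by simp
      ultimately show ?thesis unfolding degenerate_def using eq g'(1)
        by (intro disjI2 exI[of _ i] exI[of _ c] exI[of _ g']) simp
    qed
    then show ?L unfolding marked by simp
  }
qed

text \<open>Comprises the comical cubes, their primed versions and truncations, so that maps out of
  all of them are treated by one Yoneda argument.\<close>

definition cube_like :: "bool set \<Rightarrow> nat \<Rightarrow> cubemap mcset \<Rightarrow> bool" where
  "cube_like A n Z \<longleftrightarrow> cubes Z = cubes (standard_cube A n) \<and> act Z = act (standard_cube A n) \<and>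
     (\<forall>m. marked (standard_cube A n) m \<subseteq> marked Z m) \<and>
     (\<forall>m. marked Z m \<subseteq> cubes (standard_cube A n) m) \<and> marked Z 0 = {}"

lemma cset_standard_cube: "cset A (standard_cube A n)"
  unfolding cset_def
proof (intro conjI allI impI)
  show "act (standard_cube A n) m k f \<in> cubes (standard_cube A n) k \<rightarrow>\<^sub>E cubes (standard_cube A n) m"
    if "boxmor A m k f" for m k f
    using that boxmor_comp by (auto simp: standard_cube_act)
  show "act (standard_cube A n) k k (idbox k) = (\<lambda>x\<in>cubes (standard_cube A n) k. x)" for k
    using boxmor_id boxmor_id_right by (auto simp: standard_cube_act fun_eq_iff)
  show "act (standard_cube A n) k l (cmp k g f) =
      compose (cubes (standard_cube A n) l) (act (standard_cube A n) k m f) (act (standard_cube A n) m l g)"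
    if "boxmor A k m f" "boxmor A m l g" for k m l f g
    using that boxmor_comp boxmor_cmp_assoc[OF that(1)]
    by (auto simp: standard_cube_act fun_eq_iff compose_def)
qed (simp add: standard_cube_act)

lemma degenerate_standard_cube:
  "degenerate A (standard_cube A n) m g \<Longrightarrow> g \<in> marked (standard_cube A n) m"
  by (simp add: degenerate_def standard_cube_def Let_def)

lemma cube_like_mcset:
  assumes "cube_like A n Z"
  shows "mcset A Z"
proof -
  have Z: "cubes Z = cubes (standard_cube A n)" "act Z = act (standard_cube A n)"
    using assms unfolding cube_like_def by auto
  have "cset A Z" using cset_standard_cube[of A n] unfolding cset_def Z .
  moreover have "degenerate A Z m g \<Longrightarrow> degenerate A (standard_cube A n) m g" for m g
    unfolding degenerate_def Z .
  ultimately show ?thesis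
    using degenerate_standard_cube[of A n] assms unfolding mcset_def cube_like_def Z by (meson subsetD)
qed

lemma critical_face_boxmor: "critical_face n i e m d \<Longrightarrow> boxmor A m n d"
  unfolding critical_face_iff using face_composite_boxmor by (metis add_diff_cancel_right')

text \<open>Guarantees that no 0-cube gets marked: the word of a vertex mentions every coordinate,
  in particular \<open>i\<close>, which a critical word avoids.\<close>

lemma critical_face_pos:
  assumes "critical_face n i e m d" "1 \<le> i" "i \<le> n"
  shows "0 < m"
proof (rule ccontr)
  assume "\<not> 0 < m"
  then obtain cs where cs: "face_word n cs" "length cs = n" "crit_word i e cs"
    using assms(1) unfolding critical_face_iff by auto
  have "sorted_wrt (>) xs \<Longrightarrow> distinct xs" for xs :: "nat list" by (induction xs) auto
  then have "distinct (map fst cs)" using cs(1) unfolding face_word_def by blast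
  then have "card (fst ` set cs) = n" using cs(2) distinct_card[of "map fst cs"] by simp
  moreover have "fst ` set cs \<subseteq> {1..n}" using cs(1) unfolding face_word_def by auto
  ultimately have "fst ` set cs = {1..n}" by (intro card_subset_eq) auto
  then show False using crit_word_free(1)[OF cs(3), of i] assms by auto
qed

lemma comical_cube_simps [simp]:
  "cubes (comical_cube A n i e) = cubes (standard_cube A n)"
  "act (comical_cube A n i e) = act (standard_cube A n)"
  by (simp_all add: comical_cube_def)

lemma comical_cube_marked:
  "g \<in> marked (comical_cube A n i e) m \<longleftrightarrow> g \<in> marked (standard_cube A n) m \<or> critical_face n i e m g"
  by (simp add: comical_cube_def)

lemma comical_cube'_simps [simp]:
  "cubes (comical_cube' A n i e) = cubes (standard_cube A n)"
  "act (comical_cube' A n i e) = act (standard_cube A n)"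
  by (simp_all add: comical_cube'_def)

lemma comical_cube'_marked:
  "g \<in> marked (comical_cube' A n i e) m \<longleftrightarrow> g \<in> marked (comical_cube A n i e) m \<or>
     m = n - 1 \<and> (\<exists>j e'. 1 \<le> j \<and> j \<le> n \<and> (j, e') \<noteq> (i, e) \<and> g = face n j e')"
  by (auto simp: comical_cube'_def)

lemma tau_simps [simp]: "cubes (tau k Z) = cubes Z" "act (tau k Z) = act Z"
  by (simp_all add: tau_def)

lemma tau_marked: "marked (tau k Z) m = (if m > k then cubes Z m else marked Z m)"
  by (simp add: tau_def)

lemma elementary_0_0: "\<not> elementary A 0 0 s" using elementary_less by blast

lemma cube_like_comical_cube:
  assumes "1 \<le> i" "i \<le> n"
  shows "cube_like A n (comical_cube A n i e)"
  unfolding cube_like_def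
proof (intro conjI allI)
  show "marked (comical_cube A n i e) m \<subseteq> cubes (standard_cube A n) m" for m
    using critical_face_boxmor by (auto simp: comical_cube_marked standard_cube_marked)
  show "marked (comical_cube A n i e) 0 = {}"
    using critical_face_pos[OF _ assms, of e 0] elementary_0_0 by (auto simp: comical_cube_marked standard_cube_marked)
qed (auto simp: comical_cube_marked)

lemma cube_like_comical_cube':
  assumes "2 \<le> n" "1 \<le> i" "i \<le> n"
  shows "cube_like A n (comical_cube' A n i e)"
proof -
  note c = cube_like_comical_cube[OF assms(2,3), of A e]
  show ?thesis
    unfolding cube_like_def
  proof (intro conjI allI subsetI)
    show "g \<in> marked (comical_cube' A n i e) m" if "g \<in> marked (standard_cube A n) m" for m g
      using that by (simp add: comical_cube'_marked comical_cube_marked)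
    show "g \<in> cubes (standard_cube A n) m" if "g \<in> marked (comical_cube' A n i e) m" for m g
      using that c boxmor_face[of _ n A] unfolding comical_cube'_marked cube_like_def by auto
    have "0 \<noteq> n - 1" using assms(1) by simp
    then show "marked (comical_cube' A n i e) 0 = {}"
      using c unfolding cube_like_def by (auto simp: comical_cube'_marked)
  qed simp_all
qed

lemma cube_like_tau:
  assumes "cube_like A n Z"
  shows "cube_like A n (tau k Z)"
  using assms unfolding cube_like_def by (auto simp: tau_marked)

text \<open>The Yoneda map of \<open>z\<close>. Degenerate cubes are sent to marked ones
  automatically, so only the nondegenerate marked faces impose a condition.\<close>

lemma mcmap_cube_like:
  assumes Z: "cube_like A n Z" and X: "mcset A X" and z: "z \<in> cubes X n"
    and "\<And>m g. g \<in> marked Z m \<Longrightarrow> boxmor A m n g \<Longrightarrow> \<not> (\<exists>s. elementary A 0 m s \<and> factors m s g) \<Longrightarrow> act X m n g z \<in> marked X m"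
  shows "mcmap A Z X (\<lambda>m. \<lambda>g\<in>{g. boxmor A m n g}. act X m n g z)"
proof -
  have cX: "cset A X" using X by (simp add: mcset_def)
  have Zs: "cubes Z = cubes (standard_cube A n)" "act Z = act (standard_cube A n)"
    and Zm: "\<And>m. marked Z m \<subseteq> cubes (standard_cube A n) m" using Z by (auto simp: cube_like_def)
  show ?thesis
    unfolding mcmap_def Zs
  proof (intro conjI allI impI ballI cube_like_mcset[OF Z] X)
    show "(\<lambda>g\<in>{g. boxmor A m n g}. act X m n g z) \<in> cubes (standard_cube A n) m \<rightarrow>\<^sub>E cubes X m" for m
      using act_closed[OF cX _ z] by auto
    show "(\<lambda>g\<in>{g. boxmor A m n g}. act X m n g z) (act (standard_cube A n) m k f g) =
        act X m k f ((\<lambda>g\<in>{g. boxmor A k n g}. act X k n g z) g)"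
      if "boxmor A m k f" "g \<in> cubes (standard_cube A n) k" for m k f g
      using that act_cmp[OF cX that(1) _ z] boxmor_comp[OF that(1)] by (simp add: standard_cube_act)
    show "(\<lambda>g\<in>{g. boxmor A m n g}. act X m n g z) g \<in> marked X m" if g: "g \<in> marked Z m" for m g
    proof -
      have b: "boxmor A m n g" using g Zm[of m] by auto
      show ?thesis
      proof (cases "\<exists>s. elementary A 0 m s \<and> factors m s g")
        case True
        then show ?thesis using act_marked_degenerate[OF X _ _ b z] b by auto
      next
        case False then show ?thesis using assms(4)[OF g b] b by simp
      qed
    qed
  qed
qed

lemma mcmap_cube_like_eq:
  assumes Z: "cube_like A n Z" and u: "mcmap A Z X u" and g: "boxmor A m n g"
  shows "u m g = act X m n g (u n (idbox n))"
proof -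
  have "u m (act Z m n g (idbox n)) = act X m n g (u n (idbox n))"
    using u g boxmor_id Z unfolding mcmap_def cube_like_def by simp
  then show ?thesis using g boxmor_id boxmor_id_left[OF g] Z by (simp add: cube_like_def standard_cube_act)
qed

lemma mcmap_cube: "mcmap A X Y f \<Longrightarrow> x \<in> cubes X n \<Longrightarrow> f n x \<in> cubes Y n"
  unfolding mcmap_def by (auto simp: PiE_iff)

lemma mcmap_ext: "mcmap A X Y f \<Longrightarrow> x \<notin> cubes X n \<Longrightarrow> f n x = undefined"
  unfolding mcmap_def by (auto simp: PiE_iff extensional_def)

lemma mcmap_act: "mcmap A X Y f \<Longrightarrow> boxmor A m n g \<Longrightarrow> x \<in> cubes X n \<Longrightarrow> f m (act X m n g x) = act Y m n g (f n x)"
  unfolding mcmap_def by blast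

lemma mcmap_marked: "mcmap A X Y f \<Longrightarrow> x \<in> marked X n \<Longrightarrow> f n x \<in> marked Y n"
  unfolding mcmap_def by blast

lemma mccomp_apply: "x \<in> cubes X n \<Longrightarrow> mccomp X g f n x = g n (f n x)"
  by (simp add: mccomp_def compose_eq)

lemma mccomp_eqI:
  assumes "\<And>n x. x \<in> cubes X n \<Longrightarrow> g n (f n x) = h n x" and "\<And>n x. x \<notin> cubes X n \<Longrightarrow> h n x = undefined"
  shows "mccomp X g f = h"
  using assms by (intro ext) (auto simp: mccomp_def compose_def)

lemma mccomp_undef: "x \<notin> cubes X n \<Longrightarrow> mccomp X g f n x = undefined"
  by (simp add: mccomp_def compose_def)

text \<open>Presents the box as the union of its facets, so that maps out of it are matching
  families. If the outermost face of a word is the excluded facet, the next one is exchanged with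
  it; it has a smaller direction and is therefore a different facet.\<close>

lemma open_box_cubes:
  "g \<in> cubes (open_box A n i e) m \<longleftrightarrow>
     (\<exists>j c g'. 1 \<le> j \<and> j \<le> n \<and> (j, c) \<noteq> (i, e) \<and> boxmor A m (n - 1) g' \<and> g = cmp m (face n j c) g')"
    (is "_ \<longleftrightarrow> ?R")
proof -
  have open_box: "g \<in> cubes (open_box A n i e) m \<longleftrightarrow> (\<exists>cs g'. face_word n cs \<and> cs \<noteq> [] \<and> cs \<noteq> [(i, e)] \<and>
      boxmor A m (n - length cs) g' \<and> g = cmp m (face_composite n cs) g')"
    by (auto simp: open_box_def regular_sub_def)
  have Cons: "cmp m (face_composite n ((j, c) # cs)) g' = cmp m (face n j c) (cmp m (face_composite (n - 1) cs) g')"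
    if "boxmor A m (n - length ((j, c) # cs)) g'" for n j c cs g'
    using boxmor_cmp_assoc[OF that] by simp
  have comp: "boxmor A m (n - 1) (cmp m (face_composite (n - 1) cs) g')"
    if "face_word n ((j, c) # cs)" "boxmor A m (n - length ((j, c) # cs)) g'" for n j c cs g'
    using boxmor_comp[OF _ face_composite_boxmor, of A m "n - 1" cs g'] that face_word_Cons by simp
  show ?thesis
  proof
    assume "g \<in> cubes (open_box A n i e) m"
    then obtain cs g' where cs: "face_word n cs" "cs \<noteq> []" "cs \<noteq> [(i, e)]"
      and g': "boxmor A m (n - length cs) g'" "g = cmp m (face_composite n cs) g'"
      unfolding open_box by blast
    then obtain j c cs' where j: "cs = (j, c) # cs'" by (cases cs) auto
    have jn: "1 \<le> j" "j \<le> n" "face_word (n - 1) cs'" using cs(1) face_word_Cons j by auto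
    define h where "h = cmp m (face_composite (n - 1) cs') g'"
    have h: "boxmor A m (n - 1) h" "g = cmp m (face n j c) h"
      using comp[of n j c cs' g'] Cons[of n j c cs' g'] cs(1) g' j by (simp_all add: h_def)
    show ?R
    proof (cases "(j, c) = (i, e)")
      case False then show ?thesis using h jn by blast
    next
      case True
      then obtain k c' cs'' where k: "cs' = (k, c') # cs''" using cs(3) j by (cases cs') auto
      have kj: "1 \<le> k" "k < j" "k \<le> n" "j - 1 \<le> n - 1" "1 \<le> j - 1"
        using cs(1) face_word_Cons[of n j c cs'] j k jn face_word_Cons[of "n - 1" k c' cs''] by auto
      define h' where "h' = cmp m (face_composite (n - 1 - 1) cs'') g'"
      have h': "boxmor A m (n - 1 - 1) h'" "h = cmp m (face (n - 1) k c') h'"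
        using comp[of "n - 1" k c' cs'' g'] Cons[of "n - 1" k c' cs'' g'] g' j k jn(3)
        by (simp_all add: h'_def h_def)
      have "g = cmp m (cmp (n - 1 - 1) (face n j c) (face (n - 1) k c')) h'"
        using h(2) h'(2) boxmor_cmp_assoc[OF h'(1)] by simp
      also have "\<dots> = cmp m (face n k c') (cmp m (face (n - 1) (j - 1) c) h')"
        using face_face[OF kj(1,2) jn(2), of c c'] boxmor_cmp_assoc[OF h'(1)] by (simp add: numeral_2_eq_2)
      finally have "g = cmp m (face n k c') (cmp m (face (n - 1) (j - 1) c) h')" .
      moreover have "boxmor A m (n - 1) (cmp m (face (n - 1) (j - 1) c) h')"
        using boxmor_comp[OF h'(1) boxmor_face[OF kj(5,4)]] .
      moreover have "(k, c') \<noteq> (i, e)" using True kj by auto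
      ultimately show ?thesis using kj by blast
    qed
  next
    assume ?R
    then obtain j c g' where j: "1 \<le> j" "j \<le> n" "(j, c) \<noteq> (i, e)" "boxmor A m (n - 1) g'" "g = cmp m (face n j c) g'"
      by blast
    have w: "face_word n [(j, c)]" using j by (simp add: face_word_def)
    have "face_composite n [(j, c)] = face n j c"
      using boxmor_id_right[OF boxmor_face[OF j(1,2), of A c]] by simp
    then show "g \<in> cubes (open_box A n i e) m"
      unfolding open_box using w j by (intro exI[of _ "[(j, c)]"] exI[of _ g']) simp
  qed
qed

lemma open_box_simps:
  "act (open_box A n i e) m k f = restrict (act (standard_cube A n) m k f) (cubes (open_box A n i e) k)"
  "marked (open_box A n i e) m = marked (comical_cube A n i e) m \<inter> cubes (open_box A n i e) m"
  by (simp_all add: open_box_def regular_sub_def)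

lemma open_box_subset: "g \<in> cubes (open_box A n i e) m \<Longrightarrow> boxmor A m n g"
  unfolding open_box_cubes using boxmor_comp boxmor_face by blast

lemma open_box_closed: "g \<in> cubes (open_box A n i e) m \<Longrightarrow> boxmor A k m f \<Longrightarrow> cmp k g f \<in> cubes (open_box A n i e) k"
  unfolding open_box_cubes using boxmor_comp boxmor_cmp_assoc by metis

lemma open_box_act:
  "g \<in> cubes (open_box A n i e) m \<Longrightarrow> boxmor A k m f \<Longrightarrow> act (open_box A n i e) k m f g = cmp k g f"
  using open_box_subset by (simp add: open_box_simps standard_cube_act)

lemma open_box_mcset:
  assumes "1 \<le> i" "i \<le> n"
  shows "mcset A (open_box A n i e)"
proof -
  have cl: "cube_like A n (comical_cube A n i e)" using cube_like_comical_cube[OF assms] .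
  have cs: "cset A (open_box A n i e)"
    unfolding cset_def
  proof (intro conjI allI impI)
    show "act (open_box A n i e) m k f \<in> cubes (open_box A n i e) k \<rightarrow>\<^sub>E cubes (open_box A n i e) m"
      if "boxmor A m k f" for m k f
      using open_box_act[OF _ that] open_box_closed[OF _ that]
      by (auto simp: PiE_iff open_box_simps(1))
    show "act (open_box A n i e) m k f = (\<lambda>_. undefined)" if "\<not> boxmor A m k f" for m k f
      using that by (auto simp: open_box_simps standard_cube_act)
    show "act (open_box A n i e) k k (idbox k) = (\<lambda>x\<in>cubes (open_box A n i e) k. x)" for k
      using boxmor_id boxmor_id_right[OF open_box_subset] open_box_subset
      by (auto simp: open_box_simps standard_cube_act fun_eq_iff)
    show "act (open_box A n i e) k l (cmp k g f) =
        compose (cubes (open_box A n i e) l) (act (open_box A n i e) k m f) (act (open_box A n i e) m l g)"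
      if "boxmor A k m f" "boxmor A m l g" for k m l f g
    proof
      fix x
      show "act (open_box A n i e) k l (cmp k g f) x =
        compose (cubes (open_box A n i e) l) (act (open_box A n i e) k m f) (act (open_box A n i e) m l g) x"
      proof (cases "x \<in> cubes (open_box A n i e) l")
        case True
        show ?thesis
          unfolding compose_eq[OF True] open_box_act[OF True that(2)]
            open_box_act[OF open_box_closed[OF True that(2)] that(1)]
            open_box_act[OF True boxmor_comp[OF that]]
          by (rule boxmor_cmp_assoc[OF that(1), symmetric])
      next
        case False then show ?thesis by (simp add: compose_def open_box_simps(1))
      qed
    qed
  qed
  show ?thesis
    unfolding mcset_def
  proof (intro conjI allI impI cs)
    show "marked (open_box A n i e) m \<subseteq> cubes (open_box A n i e) m" "marked (open_box A n i e) 0 = {}" for m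
      using cl unfolding open_box_simps cube_like_def by auto
    fix m x assume d: "degenerate A (open_box A n i e) m x"
    have *: "x \<in> marked (open_box A n i e) m"
      if s: "elementary A 0 m s" "y \<in> cubes (open_box A n i e) (m - 1)" "x = act (open_box A n i e) m (m - 1) s y" for s y
      using s open_box_act[OF s(2) elementary_boxmor[OF s(1)]] open_box_closed[OF s(2) elementary_boxmor[OF s(1)]]
        open_box_subset[OF open_box_closed[OF s(2) elementary_boxmor[OF s(1)]]] factors_cmp
      by (auto simp: open_box_simps comical_cube_marked standard_cube_marked)
    from d show "x \<in> marked (open_box A n i e) m"
      unfolding degenerate_def
    proof (elim disjE exE conjE)
      fix j y assume "1 \<le> j" "j \<le> m" "y \<in> cubes (open_box A n i e) (m - 1)"
        "x = act (open_box A n i e) m (m - 1) (degen m j) y"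
      then show ?thesis using *[OF elementary_degen[of 0 j m A]] by simp
    next
      fix j c y assume "c \<in> A" "1 \<le> j" "j \<le> m - 1" "y \<in> cubes (open_box A n i e) (m - 1)"
        "x = act (open_box A n i e) m (m - 1) (conn m j c) y"
      then show ?thesis using *[OF elementary_conn[of c A 0 j m]] by simp
    qed
  qed
qed

section \<open>Lifting properties in terms of faces\<close>

lemma boxmor_large_degenerate:
  "boxmor A m n g \<Longrightarrow> n < m \<Longrightarrow> \<exists>s. elementary A 0 m s \<and> factors m s g"
proof (induction n arbitrary: g)
  case 0
  from 0(1) show ?case
    by (cases rule: boxmor_cases_degenerate) (use 0 in \<open>auto simp: const_coord_def\<close>)
next
  case (Suc n)
  from Suc.prems(1) show ?case
  proof (cases rule: boxmor_cases_degenerate)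
    case const
    then obtain j c g' where *: "1 \<le> j" "j \<le> Suc n" "boxmor A m (Suc n - 1) g'" "g = cmp m (face (Suc n) j c) g'"
      using const_coord_obtain[OF Suc.prems(1)] by blast
    then obtain s where "elementary A 0 m s" "factors m s g'" using Suc.IH[of g'] Suc.prems(2) by auto
    then show ?thesis using factors_cmp_left *(4) by blast
  qed (use Suc.prems in auto)
qed

text \<open>Determines the cubes that truncation at \<open>n - 2\<close> can newly mark: apart from
  degenerate ones, the identity and the facets.\<close>

lemma boxmor_codim_1:
  assumes "boxmor A m n g" "n - 1 \<le> m" "1 \<le> n" "\<nexists>s. elementary A 0 m s \<and> factors m s g"
  shows "(m = n \<and> g = idbox n) \<or> (m = n - 1 \<and> (\<exists>j c. 1 \<le> j \<and> j \<le> n \<and> g = face n j c))"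
  using assms(1)
proof (cases rule: boxmor_cases_degenerate)
  case const
  then obtain j c g' where *: "1 \<le> j" "j \<le> n" "boxmor A m (n - 1) g'" "g = cmp m (face n j c) g'"
    using const_coord_obtain[OF assms(1)] by blast
  have nd: "\<nexists>s. elementary A 0 m s \<and> factors m s g'" using assms(4) factors_cmp_left *(4) by blast
  then have m: "m = n - 1" using boxmor_large_degenerate[OF *(3)] assms(2) by fastforce
  from *(3) have "g' = idbox m"
  proof (cases rule: boxmor_cases_degenerate)
    case const
    then obtain j' c' g'' where **: "1 \<le> j'" "j' \<le> n - 1" "boxmor A m (n - 1 - 1) g''" "g' = cmp m (face (n - 1) j' c') g''"
      using const_coord_obtain[OF *(3)] by blast
    then have "\<exists>s. elementary A 0 m s \<and> factors m s g''" using boxmor_large_degenerate[OF **(3)] m by simp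
    then show ?thesis using nd factors_cmp_left **(4) by blast
  qed (use nd m in auto)
  then have "g = face n j c" using *(4) boxmor_id_right[OF boxmor_face[OF *(1,2), of A c]] m by simp
  then show ?thesis using m * by blast
next
  case (degen s) then show ?thesis using assms(4) by blast
qed auto

text \<open>A matching family defines a map on the open box, because the value at a cube does not
  depend on the facet through which it is factored. The filler is marked since the identity, given
  by the empty word, is a critical face.\<close>

lemma rlp_imp_fillable:
  assumes f: "mcmap A X Y f" and rlp: "comical_rlp A X Y f"
  shows "fillable X Y f"
  unfolding fillable_def
proof (intro allI impI)
  fix n i :: nat and e :: bool and y a
  assume i: "1 \<le> i" "i \<le> n" and y: "y \<in> cubes Y n"
    and a: "\<forall>j c. 1 \<le> j \<longrightarrow> j \<le> n \<longrightarrow> (j, c) \<noteq> (i, e) \<longrightarrow> a j c \<in> cubes X (n - 1) \<and> f (n - 1) (a j c) = bd Y n j c y"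
    and compat: "\<forall>j k c c'. 1 \<le> j \<longrightarrow> j < k \<longrightarrow> k \<le> n \<longrightarrow> (j, c) \<noteq> (i, e) \<longrightarrow> (k, c') \<noteq> (i, e) \<longrightarrow>
        bd X (n - 1) j c (a k c') = bd X (n - 1) (k - 1) c' (a j c)"
    and ycrit: "\<forall>cs. face_word n cs \<longrightarrow> crit_word i e cs \<longrightarrow>
        act Y (n - length cs) n (face_composite n cs) y \<in> marked Y (n - length cs)"
    and acrit: "\<forall>j c cs. face_word n ((j, c) # cs) \<longrightarrow> crit_word i e ((j, c) # cs) \<longrightarrow>
        act X (n - 1 - length cs) (n - 1) (face_composite (n - 1) cs) (a j c) \<in> marked X (n - 1 - length cs)"
  have mcX: "mcset A X" and mcY: "mcset A Y" using f by (auto simp: mcmap_def)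
  then have X: "cset A X" and Y: "cset A Y" by (auto simp: mcset_def)
  let ?O = "open_box A n i e" and ?C = "comical_cube A n i e"
  have cl: "cube_like A n ?C" using cube_like_comical_cube[OF i] .
  \<comment> \<open>The choice ranges over all factorisations through admissible facets; the next
    steps show that they give the same value.\<close>
  define u where "u m = (\<lambda>g\<in>cubes ?O m. SOME w. \<exists>j c g'. 1 \<le> j \<and> j \<le> n \<and> (j, c) \<noteq> (i, e) \<and>
      boxmor A m (n - 1) g' \<and> g = cmp m (face n j c) g' \<and> w = act X m (n - 1) g' (a j c))" for m
  have inO: "cmp m (face n j c) g' \<in> cubes ?O m"
    if "1 \<le> j" "j \<le> n" "(j, c) \<noteq> (i, e)" "boxmor A m (n - 1) g'" for m j c g'
    unfolding open_box_cubes using that by blast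
  have u: "u m (cmp m (face n j c) g') = act X m (n - 1) g' (a j c)"
    if j: "1 \<le> j" "j \<le> n" "(j, c) \<noteq> (i, e)" and g': "boxmor A m (n - 1) g'" for m j c g'
  proof -
    have agree: "act X m (n - 1) g' (a j c) = act X m (n - 1) g'' (a k c')"
      if k: "1 \<le> k" "k \<le> n" "(k, c') \<noteq> (i, e)" and g'': "boxmor A m (n - 1) g''"
        and eq: "cmp m (face n j c) g' = cmp m (face n k c') g''" for k c' g''
    proof (rule faces_agree[where ok = "\<lambda>j c. (j, c) \<noteq> (i, e)" and V = "\<lambda>j c g. act X m (n - 1) g (a j c)",
          OF _ j(1,2) g' j(3) k(1,2) g'' k(3) eq])
      fix j k c c' U
      assume jk: "1 \<le> j" "j < k" "k \<le> n" "(j, c) \<noteq> (i, e)" "(k, c') \<noteq> (i, e)" and U: "boxmor A m (n - 1 - 1) U"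
      have 1: "act X m (n - 1) (cmp m (face (n - 1) (k - 1) c') U) (a j c) = act X m (n - 1 - 1) U (bd X (n - 1) (k - 1) c' (a j c))"
        using act_cmp[OF X U boxmor_face[of "k - 1" "n - 1" A c'], of "a j c"] a jk by auto
      have 2: "act X m (n - 1) (cmp m (face (n - 1) j c) U) (a k c') = act X m (n - 1 - 1) U (bd X (n - 1) j c (a k c'))"
        using act_cmp[OF X U boxmor_face[of j "n - 1" A c], of "a k c'"] a jk by auto
      show "act X m (n - 1) (cmp m (face (n - 1) (k - 1) c') U) (a j c) = act X m (n - 1) (cmp m (face (n - 1) j c) U) (a k c')"
        using 1 2 compat jk by simp
    qed
    have "(SOME w. \<exists>k c' g''. 1 \<le> k \<and> k \<le> n \<and> (k, c') \<noteq> (i, e) \<and>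
      boxmor A m (n - 1) g'' \<and> cmp m (face n j c) g' = cmp m (face n k c') g'' \<and> w = act X m (n - 1) g'' (a k c'))
      = act X m (n - 1) g' (a j c)"
    proof (rule some_equality)
      show "\<exists>k c' g''. 1 \<le> k \<and> k \<le> n \<and> (k, c') \<noteq> (i, e) \<and>
        boxmor A m (n - 1) g'' \<and> cmp m (face n j c) g' = cmp m (face n k c') g'' \<and>
        act X m (n - 1) g' (a j c) = act X m (n - 1) g'' (a k c')" using j g' by blast
    qed (use agree in metis)
    then show ?thesis using inO[OF j g'] by (simp add: u_def)
  qed
  have u_face: "u (n - 1) (face n j c) = a j c" if j: "1 \<le> j" "j \<le> n" "(j, c) \<noteq> (i, e)" for j c
    using u[OF j boxmor_id] boxmor_id_right[OF boxmor_face[OF j(1,2), of A c]] act_id[OF X, of "a j c"] a j by simp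
  have u_map: "mcmap A ?O X u"
    unfolding mcmap_def
  proof (intro conjI allI impI ballI mcX open_box_mcset i)
    show "u m \<in> cubes ?O m \<rightarrow>\<^sub>E cubes X m" for m
    proof
      fix g assume "g \<in> cubes ?O m"
      then obtain j c g' where j: "1 \<le> j" "j \<le> n" "(j, c) \<noteq> (i, e)" "boxmor A m (n - 1) g'" "g = cmp m (face n j c) g'"
        unfolding open_box_cubes by blast
      have "a j c \<in> cubes X (n - 1)" using a j(1-3) by blast
      then show "u m g \<in> cubes X m" using u[OF j(1-4)] act_closed[OF X j(4)] j(5) by simp
    qed (simp add: u_def)
    show "u k (act ?O k m h g) = act X k m h (u m g)" if h: "boxmor A k m h" and g: "g \<in> cubes ?O m" for k m h g
    proof -
      obtain j c g' where j: "1 \<le> j" "j \<le> n" "(j, c) \<noteq> (i, e)" "boxmor A m (n - 1) g'" "g = cmp m (face n j c) g'"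
        using g unfolding open_box_cubes by blast
      have aj: "a j c \<in> cubes X (n - 1)" using a j(1-3) by blast
      have "act ?O k m h g = cmp k (face n j c) (cmp k g' h)"
        using open_box_act[OF g h] j(5) boxmor_cmp_assoc[OF h] by simp
      then show ?thesis
        using u[OF j(1-3) boxmor_comp[OF h j(4)]] u[OF j(1-4)] j(5) act_cmp[OF X h j(4) aj] by simp
    qed
    show "u m g \<in> marked X m" if g: "g \<in> marked ?O m" for m g
    proof -
      have gO: "g \<in> cubes ?O m" and gC: "g \<in> marked ?C m" using g by (auto simp: open_box_simps)
      obtain j c g' where j: "1 \<le> j" "j \<le> n" "(j, c) \<noteq> (i, e)" "boxmor A m (n - 1) g'" "g = cmp m (face n j c) g'"
        using gO unfolding open_box_cubes by blast
      from gC consider s where "elementary A 0 m s" "factors m s g" | "critical_face n i e m g"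
        unfolding comical_cube_marked standard_cube_marked by blast
      then show ?thesis
      proof cases
        case 1
        have "g' = cmp m (degen n j) g" using face_retract[OF j(1,2,4)] j(5) by simp
        then have "factors m s g'" using factors_cmp_left[OF 1(2)] by simp
        moreover have "a j c \<in> cubes X (n - 1)" using a j(1-3) by blast
        ultimately show ?thesis using act_marked_degenerate[OF mcX 1(1) _ j(4)] u[OF j(1-4)] j(5) by simp
      next
        case 2
        then obtain cs where cs: "face_word n cs" "m + length cs = n" "g = face_composite n cs" "crit_word i e cs"
          unfolding critical_face_iff by blast
        have "cs \<noteq> []"
        proof
          assume "cs = []"
          then have "g = idbox n" "m = n" using cs by auto
          then show False using const_coord_face[OF j(1,2,4)] j(5) idbox_not_const by metis
        qed
        then obtain k d cs' where k: "cs = (k, d) # cs'" by (cases cs) auto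
        have kn: "1 \<le> k" "k \<le> n" "face_word (n - 1) cs'" using cs(1) face_word_Cons k by auto
        have ne: "(k, d) \<noteq> (i, e)" using crit_word_free(1)[OF cs(4), of i] k by auto
        have m: "m = n - 1 - length cs'" using cs(2) k by simp
        have "u m g = act X m (n - 1) (face_composite (n - 1) cs') (a k d)"
          using u[OF kn(1,2) ne, of m "face_composite (n - 1) cs'"] face_composite_boxmor[OF kn(3)] cs(3) k m by simp
        then show ?thesis using acrit cs k m by auto
      qed
    qed
  qed
  define v where "v m = (\<lambda>g\<in>{g. boxmor A m n g}. act Y m n g y)" for m
  have v_map: "mcmap A ?C Y v"
    unfolding v_def
  proof (rule mcmap_cube_like[OF cl mcY y])
    fix m g assume "g \<in> marked ?C m" "\<nexists>s. elementary A 0 m s \<and> factors m s g"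
    then have "critical_face n i e m g" by (auto simp: comical_cube_marked standard_cube_marked)
    then obtain cs where cs: "face_word n cs" "m + length cs = n" "g = face_composite n cs" "crit_word i e cs"
      unfolding critical_face_iff by blast
    then show "act Y m n g y \<in> marked Y m" using ycrit by fastforce
  qed
  have square: "mccomp ?O f u = mccomp ?O v (mcid ?O)"
  proof (rule mccomp_eqI)
    fix m g assume g: "g \<in> cubes ?O m"
    then obtain j c g' where j: "1 \<le> j" "j \<le> n" "(j, c) \<noteq> (i, e)" "boxmor A m (n - 1) g'" "g = cmp m (face n j c) g'"
      unfolding open_box_cubes by blast
    have aj: "a j c \<in> cubes X (n - 1)" "f (n - 1) (a j c) = bd Y n j c y" using a j(1-3) by blast+
    have "f m (u m g) = act Y m n g y"
      using u[OF j(1-4)] j(5) mcmap_act[OF f j(4) aj(1)] aj(2) act_cmp[OF Y j(4) boxmor_face[OF j(1,2)] y, of c] by simp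
    then show "f m (u m g) = mccomp ?O v (mcid ?O) m g"
      using g open_box_subset[OF g] by (simp add: mccomp_apply mcid_def v_def)
  qed (simp add: mccomp_undef)
  have "lifts A ?O ?C (mcid ?O) X Y f"
    using rlp open_box_inclusion[of n i A e] i unfolding comical_rlp_def by simp
  then obtain h where h: "mcmap A ?C X h" "mccomp ?O h (mcid ?O) = u" "mccomp ?C f h = v"
    using u_map v_map square unfolding lifts_def by blast
  have id: "boxmor A n n (idbox n)" by (rule boxmor_id)
  have "critical_face n i e n (idbox n)"
    unfolding critical_face_iff by (intro exI[of _ "[]"]) (simp add: face_word_def crit_word_def)
  then have "idbox n \<in> marked ?C n" by (simp add: comical_cube_marked)
  then have "h n (idbox n) \<in> marked X n" using mcmap_marked[OF h(1)] by blast
  moreover have "f n (h n (idbox n)) = y"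
    using fun_cong[OF fun_cong[OF h(3), of n], of "idbox n"] id act_id[OF Y y] by (simp add: mccomp_apply v_def)
  moreover have "bd X n j c (h n (idbox n)) = a j c" if j: "1 \<le> j" "j \<le> n" "(j, c) \<noteq> (i, e)" for j c
  proof -
    have O: "face n j c \<in> cubes ?O (n - 1)"
      using inO[OF j boxmor_id] boxmor_id_right[OF boxmor_face[OF j(1,2), of A c]] by simp
    have "h (n - 1) (face n j c) = u (n - 1) (face n j c)"
      using fun_cong[OF fun_cong[OF h(2), of "n - 1"], of "face n j c"] O by (simp add: mccomp_apply mcid_def)
    then show ?thesis using u_face[OF j] mcmap_cube_like_eq[OF cl h(1) boxmor_face[OF j(1,2)]] by simp
  qed
  ultimately show "\<exists>z\<in>marked X n. f n z = y \<and>
        (\<forall>j c. 1 \<le> j \<longrightarrow> j \<le> n \<longrightarrow> (j, c) \<noteq> (i, e) \<longrightarrow> bd X n j c z = a j c)" by blast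
qed

lemma comical_cube_marked_cases:
  assumes "g \<in> marked (comical_cube A n i e) m" "\<nexists>s. elementary A 0 m s \<and> factors m s g"
  obtains cs where "face_word n cs" "m = n - length cs" "g = face_composite n cs" "crit_word i e cs"
proof -
  have "critical_face n i e m g" using assms by (auto simp: comical_cube_marked standard_cube_marked)
  then obtain cs where cs: "face_word n cs" "m + length cs = n" "g = face_composite n cs" "crit_word i e cs"
    unfolding critical_face_iff by blast
  show thesis by (rule that[OF cs(1) _ cs(3,4)]) (use cs(2) in simp)
qed

lemma critical_face_composite:
  "face_word n cs \<Longrightarrow> crit_word i e cs \<Longrightarrow> critical_face n i e (n - length cs) (face_composite n cs)"
  unfolding critical_face_iff using face_composite_mon by (intro exI[of _ cs]) auto

text \<open>The cube \<open>z\<close> and its image form a square against the marking extension,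
  with the hypotheses as its marking conditions. A lift has the same underlying cubical map, so it
  can only express that the remaining facet of \<open>z\<close> is marked.\<close>

lemma rlp_imp_saturated:
  assumes f: "mcmap A X Y f" and rlp: "comical_rlp A X Y f"
  shows "saturated X Y f"
  unfolding saturated_def
proof (intro allI impI)
  fix n i :: nat and e :: bool and z
  assume n: "2 \<le> n" and i: "1 \<le> i" "i \<le> n" and z: "z \<in> cubes X n"
    and crit: "\<forall>cs. face_word n cs \<longrightarrow> crit_word i e cs \<longrightarrow>
        act X (n - length cs) n (face_composite n cs) z \<in> marked X (n - length cs)"
    and faces: "\<forall>j c. 1 \<le> j \<longrightarrow> j \<le> n \<longrightarrow> (j, c) \<noteq> (i, e) \<longrightarrow> bd X n j c z \<in> marked X (n - 1)"
    and face: "bd Y n i e (f n z) \<in> marked Y (n - 1)"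
  have mcX: "mcset A X" and mcY: "mcset A Y" using f by (auto simp: mcmap_def)
  then have X: "cset A X" and Y: "cset A Y" by (auto simp: mcset_def)
  let ?C = "comical_cube' A n i e" and ?T = "tau (n - 2) (comical_cube A n i e)"
  note clC = cube_like_comical_cube'[OF n i, of A e]
  note clT = cube_like_tau[OF cube_like_comical_cube[OF i, of A e], of "n - 2"]
  have fz: "f n z \<in> cubes Y n" using mcmap_cube[OF f z] .
  define u v where "u m = (\<lambda>g\<in>{g. boxmor A m n g}. act X m n g z)" and
    "v m = (\<lambda>g\<in>{g. boxmor A m n g}. act Y m n g (f n z))" for m
  have u: "mcmap A ?C X u"
    unfolding u_def
  proof (rule mcmap_cube_like[OF clC mcX z])
    fix m g assume "g \<in> marked ?C m" and nd: "\<nexists>s. elementary A 0 m s \<and> factors m s g"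
    then consider "g \<in> marked (comical_cube A n i e) m"
      | j c where "m = n - 1" "1 \<le> j" "j \<le> n" "(j, c) \<noteq> (i, e)" "g = face n j c"
      unfolding comical_cube'_marked by blast
    then show "act X m n g z \<in> marked X m"
    proof cases
      case 1
      then show ?thesis using comical_cube_marked_cases[OF _ nd] crit by metis
    next
      case 2 then show ?thesis using faces by blast
    qed
  qed
  have v: "mcmap A ?T Y v"
    unfolding v_def
  proof (rule mcmap_cube_like[OF clT mcY fz])
    fix m g assume g: "g \<in> marked ?T m" "boxmor A m n g" and nd: "\<nexists>s. elementary A 0 m s \<and> factors m s g"
    show "act Y m n g (f n z) \<in> marked Y m"
    proof (cases "n - 2 < m")
      case False
      then have "g \<in> marked (comical_cube A n i e) m" using g(1) by (simp add: tau_marked)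
      then have "act X m n g z \<in> marked X m" using comical_cube_marked_cases[OF _ nd] crit by metis
      then show ?thesis using mcmap_marked[OF f] mcmap_act[OF f g(2) z] by metis
    next
      case True
      have "n - 1 \<le> m" "1 \<le> n" using True n by auto
      from boxmor_codim_1[OF g(2) this nd] show ?thesis
      proof (elim disjE exE conjE)
        assume g': "m = n" "g = idbox n"
        have "act X n n (idbox n) z \<in> marked X n"
          using crit[rule_format, of "[]"] by (simp add: face_word_def crit_word_def)
        then show ?thesis using g' mcmap_marked[OF f] mcmap_act[OF f g(2) z] by metis
      next
        fix j c assume j: "m = n - 1" "1 \<le> j" "j \<le> n" "g = face n j c"
        show ?thesis
        proof (cases "(j, c) = (i, e)")
          case True then show ?thesis using face j by simp
        next
          case False
          then have "bd X n j c z \<in> marked X (n - 1)" using faces j by blast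
          then show ?thesis using j mcmap_marked[OF f] mcmap_act[OF f g(2) z] by metis
        qed
      qed
    qed
  qed
  have square: "mccomp ?C f u = mccomp ?C v (mcid ?C)"
  proof (rule mccomp_eqI)
    fix m g assume "g \<in> cubes ?C m"
    then show "f m (u m g) = mccomp ?C v (mcid ?C) m g"
      using mcmap_act[OF f _ z] by (simp add: mccomp_apply mcid_def u_def v_def)
  qed (simp add: mccomp_undef)
  have "lifts A ?C ?T (mcid ?C) X Y f"
    using rlp marking_extension[of n i A e] n i unfolding comical_rlp_def by simp
  then obtain h where h: "mcmap A ?T X h" "mccomp ?C h (mcid ?C) = u"
    using u v square unfolding lifts_def by blast
  have b: "boxmor A (n - 1) n (face n i e)" using boxmor_face[OF i] .
  have "n - 2 < n - 1" using n by simp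
  then have "face n i e \<in> marked ?T (n - 1)" using b unfolding tau_marked by simp
  then have "h (n - 1) (face n i e) \<in> marked X (n - 1)" using mcmap_marked[OF h(1)] by blast
  moreover have "h (n - 1) (face n i e) = u (n - 1) (face n i e)"
    using fun_cong[OF fun_cong[OF h(2), of "n - 1"], of "face n i e"] b by (simp add: mccomp_apply mcid_def)
  ultimately show "bd X n i e z \<in> marked X (n - 1)" using b by (simp add: u_def)
qed

text \<open>A map out of the open box is read off from its facets, whose common faces agree because
  the map is natural. The resulting filler determines the lift by the Yoneda map.\<close>

lemma fillable_imp_lifts:
  assumes f: "mcmap A X Y f" and fill: "fillable X Y f" and i: "1 \<le> i" "i \<le> n"
  shows "lifts A (open_box A n i e) (comical_cube A n i e) (mcid (open_box A n i e)) X Y f"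
  unfolding lifts_def
proof (intro allI impI, elim conjE)
  let ?O = "open_box A n i e" and ?C = "comical_cube A n i e"
  fix u v assume u: "mcmap A ?O X u" and v: "mcmap A ?C Y v" and square: "mccomp ?O f u = mccomp ?O v (mcid ?O)"
  have mcX: "mcset A X" and mcY: "mcset A Y" using f by (auto simp: mcmap_def)
  then have X: "cset A X" and Y: "cset A Y" by (auto simp: mcset_def)
  note cl = cube_like_comical_cube[OF i, of A e]
  have sq: "f m (u m g) = v m g" if "g \<in> cubes ?O m" for m g
    using fun_cong[OF fun_cong[OF square, of m], of g] that by (simp add: mccomp_apply mcid_def)
  define a where "a j c = u (n - 1) (face n j c)" for j c
  define y where "y = v n (idbox n)"
  have y: "y \<in> cubes Y n" unfolding y_def using mcmap_cube[OF v, of "idbox n" n] boxmor_id by simp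
  have vg: "v m g = act Y m n g y" if "boxmor A m n g" for m g
    unfolding y_def using mcmap_cube_like_eq[OF cl v that] .
  have inO: "cmp m (face n j c) g' \<in> cubes ?O m"
    if "1 \<le> j" "j \<le> n" "(j, c) \<noteq> (i, e)" "boxmor A m (n - 1) g'" for m j c g'
    unfolding open_box_cubes using that by blast
  have faceO: "face n j c \<in> cubes ?O (n - 1)" if j: "1 \<le> j" "j \<le> n" "(j, c) \<noteq> (i, e)" for j c
    using inO[OF j boxmor_id] boxmor_id_right[OF boxmor_face[OF j(1,2), of A c]] by simp
  have a: "a j c \<in> cubes X (n - 1)" if j: "1 \<le> j" "j \<le> n" "(j, c) \<noteq> (i, e)" for j c
    unfolding a_def using mcmap_cube[OF u faceO[OF j]] .
  have ua: "u m (cmp m (face n j c) g') = act X m (n - 1) g' (a j c)"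
    if j: "1 \<le> j" "j \<le> n" "(j, c) \<noteq> (i, e)" and g': "boxmor A m (n - 1) g'" for m j c g'
    using mcmap_act[OF u g' faceO[OF j]] open_box_act[OF faceO[OF j] g'] by (simp add: a_def)
  have acrit: "act X (n - 1 - length cs) (n - 1) (face_composite (n - 1) cs) (a j c) \<in> marked X (n - 1 - length cs)"
    if w: "face_word n ((j, c) # cs)" "crit_word i e ((j, c) # cs)" for j c cs
  proof -
    have j: "1 \<le> j" "j \<le> n" "face_word (n - 1) cs" using w(1) face_word_Cons by auto
    have ne: "(j, c) \<noteq> (i, e)" using crit_word_free(1)[OF w(2), of i] by auto
    have b: "boxmor A (n - 1 - length cs) (n - 1) (face_composite (n - 1) cs)" using face_composite_boxmor[OF j(3)] .
    have "face_composite n ((j, c) # cs) \<in> marked ?C (n - 1 - length cs)"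
      using critical_face_composite[OF w] by (simp add: comical_cube_marked)
    then have "face_composite n ((j, c) # cs) \<in> marked ?O (n - 1 - length cs)"
      using inO[OF j(1,2) ne b] by (simp add: open_box_simps)
    then show ?thesis using mcmap_marked[OF u] ua[OF j(1,2) ne b] by fastforce
  qed
  have "\<exists>z\<in>marked X n. f n z = y \<and>
        (\<forall>j c. 1 \<le> j \<longrightarrow> j \<le> n \<longrightarrow> (j, c) \<noteq> (i, e) \<longrightarrow> bd X n j c z = a j c)"
  proof (rule fill[unfolded fillable_def, rule_format, OF i y])
    show "a j c \<in> cubes X (n - 1) \<and> f (n - 1) (a j c) = bd Y n j c y"
      if j: "1 \<le> j" "j \<le> n" "(j, c) \<noteq> (i, e)" for j c
      using a[OF j] sq[OF faceO[OF j]] vg[OF boxmor_face[OF j(1,2)], of c] by (simp add: a_def)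
    show "bd X (n - 1) j c (a k c') = bd X (n - 1) (k - 1) c' (a j c)"
      if jk: "1 \<le> j" "j < k" "k \<le> n" "(j, c) \<noteq> (i, e)" "(k, c') \<noteq> (i, e)" for j k c c'
    proof -
      have "boxmor A (n - 1 - 1) (n - 1) (face (n - 1) j c)" "boxmor A (n - 1 - 1) (n - 1) (face (n - 1) (k - 1) c')"
        using jk boxmor_face[of j "n - 1" A c] boxmor_face[of "k - 1" "n - 1" A c'] by auto
      then show ?thesis
        using ua[of k c' "n - 1 - 1" "face (n - 1) j c"] ua[of j c "n - 1 - 1" "face (n - 1) (k - 1) c'"] jk
          face_face[OF jk(1-3), of c' c] by (simp add: numeral_2_eq_2)
    qed
    show "act Y (n - length cs) n (face_composite n cs) y \<in> marked Y (n - length cs)"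
      if w: "face_word n cs" "crit_word i e cs" for cs
      using mcmap_marked[OF v, of "face_composite n cs" "n - length cs"] critical_face_composite[OF w]
        vg[OF face_composite_boxmor[OF w(1)]] by (simp add: comical_cube_marked)
  qed (rule acrit)
  then obtain z where z: "z \<in> marked X n" "f n z = y"
    and zf: "\<And>j c. 1 \<le> j \<Longrightarrow> j \<le> n \<Longrightarrow> (j, c) \<noteq> (i, e) \<Longrightarrow> bd X n j c z = a j c" by blast
  have zc: "z \<in> cubes X n" using z mcX unfolding mcset_def by blast
  define h where "h m = (\<lambda>g\<in>{g. boxmor A m n g}. act X m n g z)" for m
  have "mcmap A ?C X h"
    unfolding h_def
  proof (rule mcmap_cube_like[OF cl mcX zc])
    fix m g assume g: "g \<in> marked ?C m" and nd: "\<nexists>s. elementary A 0 m s \<and> factors m s g"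
    obtain cs where cs: "face_word n cs" "m = n - length cs" "g = face_composite n cs" "crit_word i e cs"
      using comical_cube_marked_cases[OF g nd] .
    show "act X m n g z \<in> marked X m"
    proof (cases cs)
      case Nil then show ?thesis using cs z act_id[OF X zc] by simp
    next
      case (Cons jc cs')
      obtain j c where jc: "jc = (j, c)" by force
      have j: "1 \<le> j" "j \<le> n" using cs(1) face_word_Cons Cons jc by auto
      have ne: "(j, c) \<noteq> (i, e)" using crit_word_free(1)[OF cs(4), of i] Cons jc by auto
      show ?thesis
        using act_face_composite_Cons[OF X, of n j c cs' z] zf[OF j ne] acrit[of j c cs'] cs Cons jc zc by simp
    qed
  qed
  moreover have "mccomp ?O h (mcid ?O) = u"
  proof (rule mccomp_eqI)
    fix m g assume g: "g \<in> cubes ?O m"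
    then obtain j c g' where j: "1 \<le> j" "j \<le> n" "(j, c) \<noteq> (i, e)" "boxmor A m (n - 1) g'" "g = cmp m (face n j c) g'"
      unfolding open_box_cubes by blast
    have "h m g = act X m (n - 1) g' (a j c)"
      using open_box_subset[OF g] act_cmp[OF X j(4) boxmor_face[OF j(1,2)] zc, of c] zf[OF j(1-3)] j(5) by (simp add: h_def)
    then show "h m (mcid ?O m g) = u m g" using ua[OF j(1-4)] j(5) g by (simp add: mcid_def)
  qed (rule mcmap_ext[OF u])
  moreover have "mccomp ?C f h = v"
  proof (rule mccomp_eqI)
    fix m g assume "g \<in> cubes ?C m"
    then show "f m (h m g) = v m g" using mcmap_act[OF f _ zc] vg z(2) by (simp add: h_def)
  qed (rule mcmap_ext[OF v])
  ultimately show "\<exists>h. mcmap A ?C X h \<and> mccomp ?O h (mcid ?O) = u \<and> mccomp ?C f h = v" by blast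
qed

text \<open>The marking extension is the identity on cubes, so \<open>u\<close> itself is the lift;
  what has to be shown is that it preserves the larger marking, and the facet in direction
  \<open>i\<close> at \<open>e\<close> is the only new nondegenerate case.\<close>

lemma saturated_imp_lifts:
  assumes f: "mcmap A X Y f" and sat: "saturated X Y f" and n: "2 \<le> n" and i: "1 \<le> i" "i \<le> n"
  shows "lifts A (comical_cube' A n i e) (tau (n - 2) (comical_cube A n i e)) (mcid (comical_cube' A n i e)) X Y f"
  unfolding lifts_def
proof (intro allI impI, elim conjE)
  let ?C = "comical_cube' A n i e" and ?T = "tau (n - 2) (comical_cube A n i e)"
  fix u v assume u: "mcmap A ?C X u" and v: "mcmap A ?T Y v" and square: "mccomp ?C f u = mccomp ?C v (mcid ?C)"
  have mcX: "mcset A X" using f by (auto simp: mcmap_def)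
  note clC = cube_like_comical_cube'[OF n i, of A e]
  note clT = cube_like_tau[OF cube_like_comical_cube[OF i, of A e], of "n - 2"]
  define z where "z = u n (idbox n)"
  have z: "z \<in> cubes X n" unfolding z_def using mcmap_cube[OF u, of "idbox n" n] boxmor_id by simp
  have ug: "u m g = act X m n g z" if "boxmor A m n g" for m g
    unfolding z_def using mcmap_cube_like_eq[OF clC u that] .
  have sq: "f m (u m g) = v m g" if "boxmor A m n g" for m g
    using fun_cong[OF fun_cong[OF square, of m], of g] that by (simp add: mccomp_apply mcid_def)
  have bi: "boxmor A (n - 1) n (face n i e)" using boxmor_face[OF i] .
  have face: "bd X n i e z \<in> marked X (n - 1)"
  proof (rule sat[unfolded saturated_def, rule_format, OF n i z])
    show "act X (n - length cs) n (face_composite n cs) z \<in> marked X (n - length cs)"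
      if w: "face_word n cs" "crit_word i e cs" for cs
      using mcmap_marked[OF u, of "face_composite n cs" "n - length cs"] critical_face_composite[OF w]
        ug[OF face_composite_boxmor[OF w(1)]] by (simp add: comical_cube'_marked comical_cube_marked)
    show "bd X n j c z \<in> marked X (n - 1)" if j: "1 \<le> j" "j \<le> n" "(j, c) \<noteq> (i, e)" for j c
      using mcmap_marked[OF u, of "face n j c" "n - 1"] j ug[OF boxmor_face[OF j(1,2)], of c]
      unfolding comical_cube'_marked by auto
    have "n - 2 < n - 1" using n by simp
    then have "face n i e \<in> marked ?T (n - 1)" using bi unfolding tau_marked by simp
    then show "bd Y n i e (f n z) \<in> marked Y (n - 1)"
      using mcmap_marked[OF v] sq[OF bi] ug[OF bi] mcmap_act[OF f bi z] by metis
  qed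
  have "mcmap A ?T X (\<lambda>m. \<lambda>g\<in>{g. boxmor A m n g}. act X m n g z)"
  proof (rule mcmap_cube_like[OF clT mcX z])
    fix m g assume g: "g \<in> marked ?T m" "boxmor A m n g" and nd: "\<nexists>s. elementary A 0 m s \<and> factors m s g"
    have C: "act X m n g z \<in> marked X m" if "g \<in> marked ?C m" using mcmap_marked[OF u that] ug[OF g(2)] by simp
    show "act X m n g z \<in> marked X m"
    proof (cases "n - 2 < m")
      case False
      then show ?thesis using g(1) by (intro C) (simp add: tau_marked comical_cube'_marked)
    next
      case True
      have "n - 1 \<le> m" "1 \<le> n" using True n by auto
      from boxmor_codim_1[OF g(2) this nd] show ?thesis
      proof (elim disjE exE conjE)
        assume g': "m = n" "g = idbox n"
        have "critical_face n i e n (idbox n)"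
          using critical_face_composite[of n "[]" i e] by (simp add: face_word_def crit_word_def)
        then show ?thesis using g' by (intro C) (simp add: comical_cube'_marked comical_cube_marked)
      next
        fix j c assume j: "m = n - 1" "1 \<le> j" "j \<le> n" "g = face n j c"
        show ?thesis
        proof (cases "(j, c) = (i, e)")
          case True then show ?thesis using face j by simp
        next
          case False
          then have "g \<in> marked ?C m" using j unfolding comical_cube'_marked by blast
          then show ?thesis by (rule C)
        qed
      qed
    qed
  qed
  moreover have "(\<lambda>m. \<lambda>g\<in>{g. boxmor A m n g}. act X m n g z) = u"
  proof (intro ext)
    fix m g show "(\<lambda>g\<in>{g. boxmor A m n g}. act X m n g z) g = u m g"
      using ug mcmap_ext[OF u, of g m] by (cases "boxmor A m n g") simp_all
  qed
  moreover have "mccomp ?C u (mcid ?C) = u"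
    by (rule mccomp_eqI) (simp_all add: mcid_def mcmap_ext[OF u])
  moreover have "mccomp ?T f u = v"
    by (rule mccomp_eqI) (use sq mcmap_ext[OF v] in auto)
  ultimately show "\<exists>h. mcmap A ?T X h \<and> mccomp ?C h (mcid ?C) = u \<and> mccomp ?T f h = v" by metis
qed

theorem comical_rlp_iff:
  assumes "mcmap A X Y f"
  shows "comical_rlp A X Y f \<longleftrightarrow> fillable X Y f \<and> saturated X Y f"
proof
  assume "comical_rlp A X Y f"
  then show "fillable X Y f \<and> saturated X Y f"
    using rlp_imp_fillable rlp_imp_saturated assms by blast
next
  assume *: "fillable X Y f \<and> saturated X Y f"
  show "comical_rlp A X Y f"
    unfolding comical_rlp_def
  proof (intro allI impI)
    fix U V j assume "comical_anodyne_generator A U V j"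
    then show "lifts A U V j X Y f"
      by cases (use * fillable_imp_lifts saturated_imp_lifts assms in auto)
  qed
qed

section \<open>Restriction and the terminal object\<close>

lemma degenerate_mono:
  "A \<subseteq> B \<Longrightarrow> degenerate A (i_star A X) m x \<Longrightarrow> degenerate B X m x"
  unfolding degenerate_def
proof (elim disjE exE conjE)
  fix i y assume "A \<subseteq> B" "1 \<le> i" "i \<le> m" "y \<in> cubes (i_star A X) (m - 1)" "x = act (i_star A X) m (m - 1) (degen m i) y"
  then show "(\<exists>i y. 1 \<le> i \<and> i \<le> m \<and> y \<in> cubes X (m - 1) \<and> x = act X m (m - 1) (degen m i) y) \<or>
    (\<exists>i e y. e \<in> B \<and> 1 \<le> i \<and> i \<le> m - 1 \<and> y \<in> cubes X (m - 1) \<and> x = act X m (m - 1) (conn m i e) y)"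
    using boxmor_degen[of i m A] by (intro disjI1 exI[of _ i] exI[of _ y]) simp
next
  fix i e y assume "A \<subseteq> B" "e \<in> A" "1 \<le> i" "i \<le> m - 1" "y \<in> cubes (i_star A X) (m - 1)"
    "x = act (i_star A X) m (m - 1) (conn m i e) y"
  then show "(\<exists>i y. 1 \<le> i \<and> i \<le> m \<and> y \<in> cubes X (m - 1) \<and> x = act X m (m - 1) (degen m i) y) \<or>
    (\<exists>i e y. e \<in> B \<and> 1 \<le> i \<and> i \<le> m - 1 \<and> y \<in> cubes X (m - 1) \<and> x = act X m (m - 1) (conn m i e) y)"
    using boxmor_conn[of e A i m] by (intro disjI2 exI[of _ i] exI[of _ e] exI[of _ y]) auto
qed

lemma mcset_i_star:
  assumes "mcset B X" "A \<subseteq> B"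
  shows "mcset A (i_star A X)"
proof -
  have X: "cset B X" using assms(1) by (simp add: mcset_def)
  have "cset A (i_star A X)"
    unfolding cset_def
  proof (intro conjI allI impI)
    show "act (i_star A X) m n f \<in> cubes (i_star A X) n \<rightarrow>\<^sub>E cubes (i_star A X) m" if "boxmor A m n f" for m n f
      using X that boxmor_mono[OF that assms(2)] unfolding cset_def by simp
    show "act (i_star A X) m n f = (\<lambda>_. undefined)" if "\<not> boxmor A m n f" for m n f
      using that by (simp add: i_star_def)
    show "act (i_star A X) n n (idbox n) = (\<lambda>x\<in>cubes (i_star A X) n. x)" for n
      using X boxmor_id unfolding cset_def by simp
    show "act (i_star A X) k n (cmp k g f) = compose (cubes (i_star A X) n) (act (i_star A X) k m f) (act (i_star A X) m n g)"
      if "boxmor A k m f" "boxmor A m n g" for k m n f g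
      using X that boxmor_comp[OF that] boxmor_mono[OF that(1) assms(2)] boxmor_mono[OF that(2) assms(2)]
      unfolding cset_def by simp
  qed
  then show ?thesis using assms degenerate_mono unfolding mcset_def by (metis i_star_simps(1,2))
qed

lemma mcmap_i_star:
  assumes "mcmap B X Y f" "A \<subseteq> B"
  shows "mcmap A (i_star A X) (i_star A Y) f"
  unfolding mcmap_def
proof (intro conjI allI impI ballI)
  show "mcset A (i_star A X)" "mcset A (i_star A Y)"
    using assms mcset_i_star unfolding mcmap_def by blast+
  show "f m (act (i_star A X) m n g x) = act (i_star A Y) m n g (f n x)"
    if "boxmor A m n g" "x \<in> cubes (i_star A X) n" for m n g x
    using mcmap_act[OF assms(1) boxmor_mono[OF that(1) assms(2)]] that by simp
qed (use assms(1) in \<open>simp_all add: mcmap_def\<close>)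

lemma i_star_same: "mcset A X \<Longrightarrow> i_star A X = X"
proof -
  assume "mcset A X"
  then have "(if boxmor A m n f then act X m n f else (\<lambda>_. undefined)) = act X m n f" for m n f
    unfolding mcset_def cset_def by simp
  then show ?thesis unfolding i_star_def by simp
qed

lemma i_star_i_star: "A \<subseteq> C \<Longrightarrow> i_star A (i_star C X) = i_star A X"
  using boxmor_mono unfolding i_star_def by (auto simp: fun_eq_iff)

text \<open>The structure maps involved are composites of faces, that is, morphisms over the empty
  set of kinds; agreement along these suffices.\<close>

lemma fillable_cong_imp:
  assumes X: "cubes X' = cubes X" "marked X' = marked X" "\<And>m n g. boxmor {} m n g \<Longrightarrow> act X' m n g = act X m n g"
    and Y: "cubes Y' = cubes Y" "marked Y' = marked Y" "\<And>m n g. boxmor {} m n g \<Longrightarrow> act Y' m n g = act Y m n g"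
    and fill: "fillable X Y f"
  shows "fillable X' Y' f"
  unfolding fillable_def X(1,2) Y(1,2)
proof (intro allI impI)
  have bX: "bd X' n j c x = bd X n j c x" and bY: "bd Y' n j c y = bd Y n j c y" if "1 \<le> j" "j \<le> n" for n j c x y
    using X(3) Y(3) boxmor_face[OF that] by auto
  fix n i e y a
  assume i: "1 \<le> i" "i \<le> n" and y: "y \<in> cubes Y n"
    and a: "\<forall>j c. 1 \<le> j \<longrightarrow> j \<le> n \<longrightarrow> (j, c) \<noteq> (i, e) \<longrightarrow> a j c \<in> cubes X (n - 1) \<and> f (n - 1) (a j c) = bd Y' n j c y"
    and compat: "\<forall>j k c c'. 1 \<le> j \<longrightarrow> j < k \<longrightarrow> k \<le> n \<longrightarrow> (j, c) \<noteq> (i, e) \<longrightarrow> (k, c') \<noteq> (i, e) \<longrightarrow>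
        bd X' (n - 1) j c (a k c') = bd X' (n - 1) (k - 1) c' (a j c)"
    and ycrit: "\<forall>cs. face_word n cs \<longrightarrow> crit_word i e cs \<longrightarrow>
        act Y' (n - length cs) n (face_composite n cs) y \<in> marked Y (n - length cs)"
    and acrit: "\<forall>j c cs. face_word n ((j, c) # cs) \<longrightarrow> crit_word i e ((j, c) # cs) \<longrightarrow>
        act X' (n - 1 - length cs) (n - 1) (face_composite (n - 1) cs) (a j c) \<in> marked X (n - 1 - length cs)"
  have "\<exists>z\<in>marked X n. f n z = y \<and>
      (\<forall>j c. 1 \<le> j \<longrightarrow> j \<le> n \<longrightarrow> (j, c) \<noteq> (i, e) \<longrightarrow> bd X n j c z = a j c)"
  proof (rule fill[unfolded fillable_def, rule_format, OF i y])
    show "a j c \<in> cubes X (n - 1) \<and> f (n - 1) (a j c) = bd Y n j c y"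
      if "1 \<le> j" "j \<le> n" "(j, c) \<noteq> (i, e)" for j c
      using a that bY[OF that(1,2)] by simp
    show "bd X (n - 1) j c (a k c') = bd X (n - 1) (k - 1) c' (a j c)"
      if jk: "1 \<le> j" "j < k" "k \<le> n" "(j, c) \<noteq> (i, e)" "(k, c') \<noteq> (i, e)" for j k c c'
    proof -
      have "bd X' (n - 1) j c (a k c') = bd X' (n - 1) (k - 1) c' (a j c)" using compat jk by blast
      then show ?thesis using bX[of j "n - 1" c "a k c'"] bX[of "k - 1" "n - 1" c' "a j c"] jk by simp
    qed
    show "act Y (n - length cs) n (face_composite n cs) y \<in> marked Y (n - length cs)"
      if "face_word n cs" "crit_word i e cs" for cs
      using ycrit[rule_format, OF that] Y(3)[OF face_composite_boxmor[OF that(1)]] by simp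
    show "act X (n - 1 - length cs) (n - 1) (face_composite (n - 1) cs) (a j c) \<in> marked X (n - 1 - length cs)"
      if "face_word n ((j, c) # cs)" "crit_word i e ((j, c) # cs)" for j c cs
      using acrit[rule_format, OF that] X(3)[OF face_composite_boxmor, of "n - 1" cs] that(1) face_word_Cons by auto
  qed
  then show "\<exists>z\<in>marked X n. f n z = y \<and>
      (\<forall>j c. 1 \<le> j \<longrightarrow> j \<le> n \<longrightarrow> (j, c) \<noteq> (i, e) \<longrightarrow> bd X' n j c z = a j c)"
    using bX by metis
qed

lemma saturated_cong_imp:
  assumes X: "cubes X' = cubes X" "marked X' = marked X" "\<And>m n g. boxmor {} m n g \<Longrightarrow> act X' m n g = act X m n g"
    and Y: "marked Y' = marked Y" "\<And>m n g. boxmor {} m n g \<Longrightarrow> act Y' m n g = act Y m n g"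
    and sat: "saturated X Y f"
  shows "saturated X' Y' f"
  unfolding saturated_def X(1,2) Y(1)
proof (intro allI impI)
  have bX: "bd X' n j c x = bd X n j c x" and bY: "bd Y' n j c y = bd Y n j c y" if "1 \<le> j" "j \<le> n" for n j c x y
    using X(3) Y(2) boxmor_face[OF that] by auto
  fix n i e z
  assume n: "2 \<le> n" and i: "1 \<le> i" "i \<le> n" and z: "z \<in> cubes X n"
    and crit: "\<forall>cs. face_word n cs \<longrightarrow> crit_word i e cs \<longrightarrow>
        act X' (n - length cs) n (face_composite n cs) z \<in> marked X (n - length cs)"
    and faces: "\<forall>j c. 1 \<le> j \<longrightarrow> j \<le> n \<longrightarrow> (j, c) \<noteq> (i, e) \<longrightarrow> bd X' n j c z \<in> marked X (n - 1)"
    and face: "bd Y' n i e (f n z) \<in> marked Y (n - 1)"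
  have "bd X n i e z \<in> marked X (n - 1)"
  proof (rule sat[unfolded saturated_def, rule_format, OF n i z])
    show "act X (n - length cs) n (face_composite n cs) z \<in> marked X (n - length cs)"
      if "face_word n cs" "crit_word i e cs" for cs
      using crit[rule_format, OF that] X(3)[OF face_composite_boxmor[OF that(1)]] by simp
    show "bd X n j c z \<in> marked X (n - 1)" if "1 \<le> j" "j \<le> n" "(j, c) \<noteq> (i, e)" for j c
      using faces that bX[OF that(1,2)] by metis
    show "bd Y n i e (f n z) \<in> marked Y (n - 1)" using face bY[OF i] by simp
  qed
  then show "bd X' n i e z \<in> marked X (n - 1)" using bX[OF i] by simp
qed

lemma comical_rlp_i_star:
  fixes X Y :: "'a mcset"
  assumes "mcmap B X Y f" "A \<subseteq> B"
  shows "comical_rlp A (i_star A X) (i_star A Y) f \<longleftrightarrow> comical_rlp B X Y f"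
proof -
  have act: "act (i_star A Z) m n g = act Z m n g" if "boxmor {} m n g" for m n g and Z :: "'a mcset"
    using boxmor_mono[OF that, of A] by simp
  have "fillable (i_star A X) (i_star A Y) f \<longleftrightarrow> fillable X Y f"
  proof
    show "fillable (i_star A X) (i_star A Y) f" if "fillable X Y f"
      by (rule fillable_cong_imp[OF _ _ _ _ _ _ that]) (simp_all add: act)
    show "fillable X Y f" if "fillable (i_star A X) (i_star A Y) f"
      by (rule fillable_cong_imp[OF _ _ _ _ _ _ that]) (simp_all add: act)
  qed
  moreover have "saturated (i_star A X) (i_star A Y) f \<longleftrightarrow> saturated X Y f"
  proof
    show "saturated (i_star A X) (i_star A Y) f" if "saturated X Y f"
      by (rule saturated_cong_imp[OF _ _ _ _ _ that]) (simp_all add: act)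
    show "saturated X Y f" if "saturated (i_star A X) (i_star A Y) f"
      by (rule saturated_cong_imp[OF _ _ _ _ _ that]) (simp_all add: act)
  qed
  ultimately show ?thesis
    unfolding comical_rlp_iff[OF assms(1)] comical_rlp_iff[OF mcmap_i_star[OF assms]] by simp
qed

text \<open>With \<open>undefined\<close> as its only cube, the constant structure maps are
  extensional and have the prescribed value off the morphisms. Hence one record is terminal over
  every \<open>A\<close> and is fixed by \<open>i_star\<close>.\<close>

definition point :: "'a mcset" where
  "point = \<lparr>cubes = \<lambda>_. {undefined}, act = \<lambda>_ _ _ _. undefined, marked = \<lambda>n. if n = 0 then {} else {undefined}\<rparr>"

definition to_point :: "('a, 'b) mcfun" where
  "to_point = (\<lambda>_ _. undefined)"

lemma point_mcset: "mcset A point"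
  unfolding mcset_def cset_def degenerate_def point_def by (auto simp: fun_eq_iff compose_def)

lemma i_star_point: "i_star A point = point"
  by (rule i_star_same[OF point_mcset])

lemma mcmap_to_point: "mcset A X \<Longrightarrow> mcmap A X point to_point"
  unfolding mcmap_def
proof (intro conjI allI impI ballI point_mcset)
  fix n x assume "mcset A X" "x \<in> marked X n"
  then have "n \<noteq> 0" unfolding mcset_def by (metis empty_iff)
  then show "to_point n x \<in> marked point n" by (simp add: point_def to_point_def)
qed (auto simp: point_def to_point_def)

lemma mcmap_point_unique: "mcmap A X point f \<Longrightarrow> f = to_point"
proof (intro ext)
  fix n x assume "mcmap A X point f"
  then show "f n x = to_point n x"
    using mcmap_cube[of A X point f x n] mcmap_ext[of A X point f x n]
    by (cases "x \<in> cubes X n") (simp_all add: point_def to_point_def)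
qed

lemma mccomp_to_point: "mccomp X to_point f = to_point"
  by (rule mccomp_eqI) (simp_all add: to_point_def)

lemma generator_mcset: "comical_anodyne_generator A U V j \<Longrightarrow> mcset A V"
  by (cases rule: comical_anodyne_generator.cases)
    (auto intro!: cube_like_mcset cube_like_comical_cube cube_like_tau)

text \<open>There is exactly one map to the point, so the lower edge of a square carries no
  information. That it exists uses that the targets of the generators are marked cubical
  sets.\<close>

lemma comical_iff_rlp: "comical A X \<longleftrightarrow> mcset A X \<and> comical_rlp A X point to_point"
proof -
  have "lifts A U V j X point to_point \<longleftrightarrow> (\<forall>u. mcmap A U X u \<longrightarrow> (\<exists>h. mcmap A V X h \<and> mccomp U h j = u))"
    if V: "mcset A V" and X: "mcset A X" for U V j
  proof -
    have v: "mcmap A V point v \<longleftrightarrow> v = to_point" for v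
      using mcmap_to_point[OF V] mcmap_point_unique by blast
    have to: "mccomp U to_point j = to_point" by (rule mccomp_to_point)
    show ?thesis unfolding lifts_def v mccomp_to_point by (auto simp: mccomp_to_point)
  qed
  then show ?thesis
    unfolding comical_def comical_rlp_def using generator_mcset by blast
qed

lemma comical_i_star:
  assumes "mcset B X" "A \<subseteq> B"
  shows "comical A (i_star A X) \<longleftrightarrow> comical B X"
  using comical_rlp_i_star[OF mcmap_to_point[OF assms(1)] assms(2)] mcset_i_star[OF assms] assms(1)
  unfolding comical_iff_rlp by (simp add: i_star_point)

text \<open>Induction on the number of missing kinds. The target is restricted from \<open>B\<close>
  to the intermediate set, and the lifting property passes to the new source because it depends on
  faces and markings only.\<close>

lemma structure_exists:
  assumes "A \<subseteq> B" "mcset B Y" "mcmap A X (i_star A Y) f" "comical_rlp A X (i_star A Y) f"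
  shows "\<exists>X'. mcmap B X' Y f \<and> i_star A X' = X"
  using assms
proof (induction "card (B - A)" arbitrary: A X rule: less_induct)
  case less
  show ?case
  proof (cases "A = B")
    case True
    then have "i_star A Y = Y" "i_star A X = X"
      using less.prems i_star_same unfolding mcmap_def by auto
    then show ?thesis using less.prems True by auto
  next
    case False
    then obtain e where e: "e \<in> B" "e \<notin> A" using less.prems(1) by blast
    define C where "C = insert e A"
    have AC: "A \<subseteq> C" and CB: "C \<subseteq> B" using e less.prems(1) by (auto simp: C_def)
    have AY: "i_star A (i_star C Y) = i_star A Y" by (rule i_star_i_star[OF AC])
    interpret structure_extension A C e X "i_star C Y" f
      using less.prems comical_rlp_iff[OF less.prems(3)] mcset_i_star[OF less.prems(2) CB] e
      by unfold_locales (auto simp: C_def[symmetric] AY)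
    obtain X1 where X1: "mcmap C X1 (i_star C Y) f" "i_star A X1 = X" using structure_exists .
    have rlp: "comical_rlp C X1 (i_star C Y) f"
      using comical_rlp_i_star[OF X1(1) AC] X1(2) AY less.prems(4) by simp
    have "card (B - C) < card (B - A)" using e by (intro psubset_card_mono) (auto simp: C_def)
    then have "\<exists>X2. mcmap B X2 Y f \<and> i_star C X2 = X1"
      by (rule less.hyps[OF _ CB less.prems(2) X1(1) rlp])
    then obtain X2 where X2: "mcmap B X2 Y f" "i_star C X2 = X1" by blast
    then have "i_star A X2 = X" using i_star_i_star[OF AC, of X2] unfolding X2(2) X1(2) by simp
    then show ?thesis using X2(1) by blast
  qed
qed

section \<open>Isomorphic maps\<close>

lemma mccomp_mcmap:
  assumes f: "mcmap A X Y f" and g: "mcmap A Y Z g"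
  shows "mcmap A X Z (mccomp X g f)"
  unfolding mcmap_def
proof (intro conjI allI impI ballI)
  show "mcset A X" "mcset A Z" using f g by (auto simp: mcmap_def)
  show "mccomp X g f n \<in> cubes X n \<rightarrow>\<^sub>E cubes Z n" for n
    using mcmap_cube[OF f] mcmap_cube[OF g] by (auto simp: mccomp_def compose_def)
  show "mccomp X g f m (act X m n h x) = act Z m n h (mccomp X g f n x)" if "boxmor A m n h" "x \<in> cubes X n" for m n h x
  proof -
    have "cset A X" using f by (simp add: mcmap_def mcset_def)
    then have "act X m n h x \<in> cubes X m" using that by (rule act_closed)
    then show ?thesis
      using that mcmap_act[OF f that] mcmap_act[OF g that(1) mcmap_cube[OF f that(2)]] by (simp add: mccomp_apply)
  qed
  show "mccomp X g f n x \<in> marked Z n" if "x \<in> marked X n" for n x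
  proof -
    have "x \<in> cubes X n" using f that unfolding mcmap_def mcset_def by blast
    then show ?thesis using mcmap_marked[OF g mcmap_marked[OF f that]] by (simp add: mccomp_apply)
  qed
qed

lemma mccomp_id_left: "mcmap A X Y f \<Longrightarrow> mccomp X (mcid Y) f = f"
  by (rule mccomp_eqI) (simp_all add: mcid_def mcmap_cube mcmap_ext)

lemma mccomp_id_right: "mcmap A X Y f \<Longrightarrow> mccomp X f (mcid X) = f"
  by (rule mccomp_eqI) (simp_all add: mcid_def mcmap_ext)

lemma mcid_mcmap: "mcset A X \<Longrightarrow> mcmap A X X (mcid X)"
  unfolding mcmap_def
proof (intro conjI allI impI ballI)
  assume X: "mcset A X"
  show "mcid X m (act X m n g x) = act X m n g (mcid X n x)" if "boxmor A m n g" "x \<in> cubes X n" for m n g x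
    using X that act_closed[of A X m n g x] unfolding mcset_def by (simp add: mcid_def)
  show "mcid X n x \<in> marked X n" if "x \<in> marked X n" for n x
    using X that unfolding mcset_def mcid_def by auto
qed (auto simp: mcid_def)

lemma mciso_id: "mcset A X \<Longrightarrow> mciso A X X (mcid X)"
  unfolding mciso_def using mcid_mcmap mccomp_id_left by blast

lemma arrow_iso_refl: "mcmap A X Y f \<Longrightarrow> arrow_iso A X Y f X Y f"
  unfolding arrow_iso_def
  by (intro conjI exI[of _ "mcid X"] exI[of _ "mcid Y"])
    (auto simp: mccomp_id_left mccomp_id_right mcmap_def intro: mciso_id)

lemma comical_rlp_iso:
  assumes iso: "arrow_iso A X Y f X' Y' f'" and rlp: "comical_rlp A X' Y' f'"
  shows "comical_rlp A X Y f"
proof -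
  obtain s t where f: "mcmap A X Y f" "mcmap A X' Y' f'" and s: "mciso A X X' s" and t: "mciso A Y Y' t"
    and st: "mccomp X t f = mccomp X f' s" using iso unfolding arrow_iso_def by blast
  obtain s' where s': "mcmap A X X' s" "mcmap A X' X s'" "mccomp X s' s = mcid X" "mccomp X' s s' = mcid X'"
    using s unfolding mciso_def by blast
  obtain t' where t': "mcmap A Y Y' t" "mcmap A Y' Y t'" "mccomp Y t' t = mcid Y" "mccomp Y' t t' = mcid Y'"
    using t unfolding mciso_def by blast
  show ?thesis
    unfolding comical_rlp_def lifts_def
  proof (intro allI impI, elim conjE)
    fix U V j u v
    assume gen: "comical_anodyne_generator A U V j" and u: "mcmap A U X u" and v: "mcmap A V Y v"
      and sq: "mccomp U f u = mccomp U v j"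
    \<comment> \<open>Composition is extensional, so evaluating a composite after \<open>j\<close>
      requires that \<open>j\<close> lands in the cubes of \<open>V\<close>.\<close>
    have jV: "j n x \<in> cubes V n" if "x \<in> cubes U n" for n x
      using gen
    proof cases
      case (open_box_inclusion n i e) then show ?thesis using that open_box_subset by (simp add: mcid_def)
    next
      case (marking_extension n i e) then show ?thesis using that by (simp add: mcid_def)
    qed
    have sq': "f n (u n x) = v n (j n x)" if "x \<in> cubes U n" for n x
      using fun_cong[OF fun_cong[OF sq, of n], of x] that by (simp add: mccomp_apply)
    have st': "t n (f n x) = f' n (s n x)" if "x \<in> cubes X n" for n x
      using fun_cong[OF fun_cong[OF st, of n], of x] that by (simp add: mccomp_apply)
    have ss: "s' n (s n x) = x" if "x \<in> cubes X n" for n x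
      using fun_cong[OF fun_cong[OF s'(3), of n], of x] that by (simp add: mccomp_apply mcid_def)
    have ss': "s n (s' n x) = x" if "x \<in> cubes X' n" for n x
      using fun_cong[OF fun_cong[OF s'(4), of n], of x] that by (simp add: mccomp_apply mcid_def)
    have tt: "t' n (t n x) = x" if "x \<in> cubes Y n" for n x
      using fun_cong[OF fun_cong[OF t'(3), of n], of x] that by (simp add: mccomp_apply mcid_def)
    have "mccomp U f' (mccomp U s u) = mccomp U (mccomp V t v) j"
    proof (rule mccomp_eqI)
      fix n x assume x: "x \<in> cubes U n"
      show "f' n (mccomp U s u n x) = mccomp U (mccomp V t v) j n x"
        using x jV[OF x] sq'[OF x] st'[OF mcmap_cube[OF u x]] by (simp add: mccomp_apply)
    qed (simp add: mccomp_undef)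
    then obtain h where h: "mcmap A V X' h" "mccomp U h j = mccomp U s u" "mccomp V f' h = mccomp V t v"
      using rlp gen mccomp_mcmap[OF u s'(1)] mccomp_mcmap[OF v t'(1)]
      unfolding comical_rlp_def lifts_def by blast
    have hj: "h n (j n x) = s n (u n x)" if "x \<in> cubes U n" for n x
      using fun_cong[OF fun_cong[OF h(2), of n], of x] that by (simp add: mccomp_apply)
    have fh: "f' n (h n x) = t n (v n x)" if "x \<in> cubes V n" for n x
      using fun_cong[OF fun_cong[OF h(3), of n], of x] that by (simp add: mccomp_apply)
    have "mccomp U (mccomp V s' h) j = u"
    proof (rule mccomp_eqI)
      fix n x assume x: "x \<in> cubes U n"
      then show "mccomp V s' h n (j n x) = u n x"
        using jV[OF x] hj[OF x] ss[OF mcmap_cube[OF u x]] by (simp add: mccomp_apply)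
    qed (rule mcmap_ext[OF u])
    moreover have "mccomp V f (mccomp V s' h) = v"
    proof (rule mccomp_eqI)
      fix n x assume x: "x \<in> cubes V n"
      note hx = mcmap_cube[OF h(1) x]
      note shx = mcmap_cube[OF s'(2) hx]
      have "t n (f n (s' n (h n x))) = t n (v n x)"
        using st'[OF shx] ss'[OF hx] fh[OF x] by simp
      then have "f n (s' n (h n x)) = v n x"
        using tt[OF mcmap_cube[OF f(1) shx]] tt[OF mcmap_cube[OF v x]] by metis
      then show "f n (mccomp V s' h n x) = v n x" using x by (simp add: mccomp_apply)
    qed (rule mcmap_ext[OF v])
    ultimately show "\<exists>h. mcmap A V X h \<and> mccomp U h j = u \<and> mccomp V f h = v"
      using mccomp_mcmap[OF h(1) s'(2)] by blast
  qed
qed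

lemma comical_iso:
  fixes X X' :: "'a mcset"
  assumes "mciso A X X' s" "comical A X'"
  shows "comical A X"
proof -
  have X: "mcset A X" "mcset A X'" using assms(1) unfolding mciso_def mcmap_def by auto
  have maps: "mcmap A X (point :: 'a mcset) to_point" "mcmap A X' (point :: 'a mcset) to_point"
    using X by (auto intro: mcmap_to_point)
  then have "mccomp X (mcid point) (to_point :: ('a, 'a) mcfun) = mccomp X to_point s"
    using mccomp_id_left by (simp add: mccomp_to_point)
  then have "arrow_iso A X point to_point X' point to_point"
    unfolding arrow_iso_def using assms(1) mciso_id[OF point_mcset] maps by blast
  then show ?thesis using comical_rlp_iso assms(2) X(1) unfolding comical_iff_rlp by blast
qed

text \<open>The codomain is treated first, through its map to the point; then the structure on the
  domain is built over this fixed codomain. The lifted map has the same underlying functions as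
  \<open>f\<close>, so the required isomorphism of arrows is the identity. Over a comical codomain,
  fibrations are given by the lifting property.\<close>

theorem proposition3p4:
  fixes A B :: "bool set"
  assumes "A \<subseteq> B"
  shows
    "(\<forall>(W\<^sub>A :: 'a mcclass) (F\<^sub>A :: 'a mcclass) (W\<^sub>B :: 'a mcclass) (F\<^sub>B :: 'a mcclass).
        comical_model_structure A W\<^sub>A F\<^sub>A \<and> comical_model_structure B W\<^sub>B F\<^sub>B \<longrightarrow>
        (\<forall>X Y f. mcmap A X Y f \<longrightarrow>
           (F\<^sub>A X Y f \<and> comical A X \<and> comical A Y \<longleftrightarrow>
            (\<exists>X' Y' f'. F\<^sub>B X' Y' f' \<and> comical B X' \<and> comical B Y' \<and>
               arrow_iso A X Y f (i_star A X') (i_star A Y') f')))) \<and>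
     (\<forall>X :: 'a mcset. mcset A X \<longrightarrow>
        (comical A X \<longleftrightarrow> (\<exists>X' :: 'a mcset. comical B X' \<and> i_star A X' = X)))"
proof -
  have fib: "F X Y p \<longleftrightarrow> comical_rlp C X Y p"
    if "comical_model_structure C W F" "mcmap C X Y p" "comical C Y"
    for C and W F :: "'a mcclass" and X Y p
    using that unfolding comical_model_structure_def by blast
  have F_map: "mcmap C X Y p" if "comical_model_structure C W F" "F X Y p"
    for C and W F :: "'a mcclass" and X Y p
    using that unfolding comical_model_structure_def model_structure_def by blast
  have object: "\<exists>X'. comical B X' \<and> i_star A X' = X" if X: "comical A X" for X :: "'a mcset"
  proof -
    have "mcset A X" using X by (simp add: comical_def)
    then have "mcmap A X (point :: 'a mcset) to_point" by (rule mcmap_to_point)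
    then obtain X' where X': "mcmap B X' (point :: 'a mcset) to_point" "i_star A X' = X"
      using structure_exists[OF assms point_mcset, of X to_point] X
      unfolding comical_iff_rlp i_star_point by blast
    then have "mcset B X'" by (simp add: mcmap_def)
    then show ?thesis using comical_i_star[OF _ assms] X' X by blast
  qed
  show ?thesis
  proof (intro conjI allI impI)
    fix W\<^sub>A F\<^sub>A W\<^sub>B F\<^sub>B :: "'a mcclass" and X Y :: "'a mcset" and f
    assume model: "comical_model_structure A W\<^sub>A F\<^sub>A \<and> comical_model_structure B W\<^sub>B F\<^sub>B"
      and f: "mcmap A X Y f"
    then have A: "comical_model_structure A W\<^sub>A F\<^sub>A" and B: "comical_model_structure B W\<^sub>B F\<^sub>B" by auto
    show "F\<^sub>A X Y f \<and> comical A X \<and> comical A Y \<longleftrightarrow>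
      (\<exists>X' Y' f'. F\<^sub>B X' Y' f' \<and> comical B X' \<and> comical B Y' \<and>
         arrow_iso A X Y f (i_star A X') (i_star A Y') f')"
    proof
      assume *: "F\<^sub>A X Y f \<and> comical A X \<and> comical A Y"
      then have rlp: "comical_rlp A X Y f" using fib[OF A f] by blast
      obtain Y' where Y': "comical B Y'" "i_star A Y' = Y" using object * by blast
      then have "mcset B Y'" by (simp add: comical_def)
      then obtain X' where X': "mcmap B X' Y' f" "i_star A X' = X"
        using structure_exists[OF assms, of Y' X f] f rlp Y'(2) by auto
      have "comical B X'" using comical_i_star[OF _ assms, of X'] X' * by (simp add: mcmap_def)
      moreover have "comical_rlp B X' Y' f" using comical_rlp_i_star[OF X'(1) assms] X'(2) Y'(2) rlp by simp
      then have "F\<^sub>B X' Y' f" using fib[OF B X'(1) Y'(1)] by simp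
      ultimately show "\<exists>X' Y' f'. F\<^sub>B X' Y' f' \<and> comical B X' \<and> comical B Y' \<and>
          arrow_iso A X Y f (i_star A X') (i_star A Y') f'"
        using Y' X'(2) arrow_iso_refl[OF f] by blast
    next
      assume "\<exists>X' Y' f'. F\<^sub>B X' Y' f' \<and> comical B X' \<and> comical B Y' \<and>
          arrow_iso A X Y f (i_star A X') (i_star A Y') f'"
      then obtain X' Y' f' where F: "F\<^sub>B X' Y' f'" and X': "comical B X'" and Y': "comical B Y'"
        and iso: "arrow_iso A X Y f (i_star A X') (i_star A Y') f'" by blast
      have f': "mcmap B X' Y' f'" using F_map[OF B F] .
      then have "comical_rlp A (i_star A X') (i_star A Y') f'"
        using fib[OF B f' Y'] F comical_rlp_i_star[OF f' assms] by simp
      then have rlp: "comical_rlp A X Y f" using comical_rlp_iso[OF iso] by simp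
      have "mcset B X'" "mcset B Y'" using f' by (auto simp: mcmap_def)
      then have c: "comical A (i_star A X')" "comical A (i_star A Y')"
        using comical_i_star[OF _ assms] X' Y' by blast+
      obtain s t where "mciso A X (i_star A X') s" "mciso A Y (i_star A Y') t"
        using iso unfolding arrow_iso_def by blast
      then have "comical A X" "comical A Y" using comical_iso c by blast+
      then show "F\<^sub>A X Y f \<and> comical A X \<and> comical A Y" using fib[OF A f] rlp by blast
    qed
  next
    fix X :: "'a mcset"
    assume "mcset A X"
    show "comical A X \<longleftrightarrow> (\<exists>X' :: 'a mcset. comical B X' \<and> i_star A X' = X)"
    proof
      assume "\<exists>X' :: 'a mcset. comical B X' \<and> i_star A X' = X"
      then obtain X' :: "'a mcset" where X': "comical B X'" "i_star A X' = X" by blast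
      then have "mcset B X'" by (simp add: comical_def)
      then show "comical A X" using comical_i_star[OF _ assms] X' by blast
    qed (rule object)
  qed
qed

end
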